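(* Let $d\ge1$, $0\le s<d$, and let $g$ be $(s,\phi)$-admissible, where $\hat\phi(\xi)\ge C_\phi\langle\xi\rangle^{-r}$ for all $\xi$, for some $C_\phi>0$ and some $r>d$. Suppose $\frac d{d-s}<p\le\infty$. There exists a constant $C=C(d,s,r,p,\phi)>0$ such that the following holds: for any $\mu\in L^1(\mathbb{R}^d)\cap L^p(\mathbb{R}^d)$ with $\int_{\mathbb{R}^d}d\mu=1$ and, if $s=0$, $\int_{(\mathbb{R}^d)^2}|g|(x-y)\,d|\mu|^{\otimes2}(x,y)<\infty$, any $0<\lambda\le1$, and any pairwise distinct configuration $X_N=(x_1,\dots,x_N)\in(\mathbb{R}^d)^N$, $$\Big\|\frac1N\sum_{i=1}^N\delta_{x_i}-\mu\Big\|_{H^{-r/2}}^2\le CC_\zeta\Big(F_N(X_N,\mu)+\frac{g_{\mathrm{Riesz}}(\lambda)+C+C_\rho}{2N}\mathbf 1_{s=0}+CC_\zeta\frac{g_{\mathrm{Riesz}}(\lambda)}{2N}\mathbf 1_{s>0}+CC_\zeta\|\mu\|_{L^p}\lambda^{\frac{d(p-1)}p-s}\Big),$$ where $C_\rho\ge0$ depends only on $\rho$ and $d$, and $C_\rho=0$ when $\rho=0$. In particular, if $g$ is $(s,a)$-admissible for $a>d$, then this holds with $r=a$; and if $g=g_{\mathrm{Riesz}}$, then it holds for any $r>d$.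
   Context: $\langle x\rangle=(1+|x|^2)^{1/2}$; $\hat f(\xi)=\int f(x)e^{-2\pi i\xi\cdot x}dx$. $g_{\mathrm{Riesz}}(x)=\frac1s|x|^{-s}$ if $s\ne0$, $-\log|x|$ if $s=0$ (evaluated at a positive number via $|x|$). For $p=\infty$, $\frac{p-1}p=1$. $F_N(X_N,\mu):=\frac12\int_{(\mathbb{R}^d)^2\setminus\triangle}g(x-y)\,d(\frac1N\sum_i\delta_{x_i}-\mu)^{\otimes2}(x,y)$, $\triangle$ the diagonal. **Admissibility.** $\phi:\mathbb{R}^d\to[0,\infty)$ is a bounded continuous, integrable, radial function (write $\phi(r)$), decreasing in $r$, $\phi(r)\to0$ as $r\to\infty$, not identically zero, $\hat\phi\ge0$, $\phi\in C^1(\mathbb{R}^d\setminus\{0\})$, such that: $\int_0^\infty r^{s-1}\phi(r)dr<\infty$ if $s>0$; $\int_0^\infty|\log(r)\phi'(r)|dr<\infty$ and $\lim_{r\to0^+}(\phi(r)-\phi(0))\log r=\lim_{r\to\infty}\phi(r)\log r=0$ if $s=0$; $\phi(x)\le C_\gamma\langle x\rangle^{-\gamma}$ for some $\gamma>s$; and $|x||\nabla\phi(x)|\le C\phi(cx)$ for some $c,C>0$. Let $\phi_t(x)=t^{-d}\phi(x/t)$, $\mathsf c_{\phi,d,s}^{-1}=s\int_0^\infty r^{s-1}\phi(r)dr$ if $s>0$, $\mathsf c_{\phi,d,0}^{-1}=\phi(0)$, $C_{\phi,T}=\phi(0)\log T-\int_0^\infty\log(r)\phi'(r)dr$. A potential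 $g:\mathbb{R}^d\setminus\{0\}\to\mathbb{R}$ is $(s,\phi)$-admissible if $g(x)=\lim_{T\to\infty}\mathsf c_{\phi,d,s}\big(\int_0^T\zeta(t)\phi_t(x)\frac{dt}t-C_{\phi,T}\mathbf 1_{s=0}\big)$ for all $x\ne0$, where $\zeta:(0,\infty)\to[0,\infty)$ is locally integrable, $C_\zeta^{-1}t^{d-s}\le\zeta(t)\le C_\zeta t^{d-s}$ for all $t>0$ and some $C_\zeta>0$, and, if $s=0$, $\zeta(t)=t^d+\rho(t)$ with $\rho\ge0$ locally integrable on $(0,\infty)$ and $\int_0^\infty\rho(t)t^{-d}\frac{dt}t<\infty$. In the case $s=0$, one takes $C_\zeta=1$ in estimates. $(s,a)$-admissible means $(s,\phi)$-admissible with $\phi=G_a$ the Bessel potential, $\widehat{G_a}(\xi)=(1+4\pi^2|\xi|^2)^{-a/2}$. *)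

theory Defs
  imports "HOL-Probability.Probability" "HOL-Probability.Essential_Supremum"
begin

text \<open>The ambient space is an arbitrary Euclidean space \<open>'a\<close>, of dimension
  \<open>d = DIM('a) \<ge> 1\<close>.\<close>

definition jbracket :: "'a::real_normed_vector \<Rightarrow> real" where
  "jbracket x = sqrt (1 + (norm x)\<^sup>2)"

definition fourier :: "('a::euclidean_space \<Rightarrow> real) \<Rightarrow> 'a \<Rightarrow> complex" where
  "fourier f \<xi> = (LINT x|lborel. f x *\<^sub>R cis (- 2 * pi * (\<xi> \<bullet> x)))"

definition g_Riesz :: "real \<Rightarrow> 'a::real_normed_vector \<Rightarrow> real" where
  "g_Riesz s x = (if s = 0 then - ln (norm x) else norm x powr (- s) / s)"


subsection \<open>Finite signed measures\<close>

text \<open>The list \<open>[(M\<^sub>1, w\<^sub>1), \<dots>, (M\<^sub>k, w\<^sub>k)]\<close> stands for the signed measure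
  \<open>w\<^sub>1 dM\<^sub>1 + \<dots> + w\<^sub>k dM\<^sub>k\<close>.\<close>

type_synonym 'a signed_measure = "('a measure \<times> ('a \<Rightarrow> real)) list"

definition sm_integral ::
  "'a signed_measure \<Rightarrow> ('a \<Rightarrow> 'b::{banach, second_countable_topology}) \<Rightarrow> 'b" where
  "sm_integral \<nu> f = (\<Sum>(M, w)\<leftarrow>\<nu>. LINT x|M. w x *\<^sub>R f x)"

definition sm_tensor ::
  "'a signed_measure \<Rightarrow> 'b signed_measure \<Rightarrow> ('a \<times> 'b) signed_measure" where
  "sm_tensor \<nu> \<kappa> = [(M \<Otimes>\<^sub>M K, \<lambda>(x, y). w x * v y). (M, w) \<leftarrow> \<nu>, (K, v) \<leftarrow> \<kappa>]"

text \<open>\<open>(1/N) \<Sum>\<^sub>i \<delta>\<^bsub>x\<^sub>i\<^esub> - \<mu>\<close>, where \<open>\<mu>\<close> is identified with its Lebesgue density and the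
  points are indexed by \<open>i < N\<close>.\<close>

definition fluctuation ::
  "nat \<Rightarrow> (nat \<Rightarrow> 'a::euclidean_space) \<Rightarrow> ('a \<Rightarrow> real) \<Rightarrow> 'a signed_measure" where
  "fluctuation N X \<mu> =
     [(return borel (X i), \<lambda>_. 1 / real N). i \<leftarrow> [0..<N]] @ [(lborel, \<lambda>x. - \<mu> x)]"

definition modulated_energy ::
  "('a::euclidean_space \<Rightarrow> real) \<Rightarrow> nat \<Rightarrow> (nat \<Rightarrow> 'a) \<Rightarrow> ('a \<Rightarrow> real) \<Rightarrow> real" where
  "modulated_energy g N X \<mu> =
     1 / 2 * sm_integral (sm_tensor (fluctuation N X \<mu>) (fluctuation N X \<mu>))
               (\<lambda>(x, y). if x = y then 0 else g (x - y))"

definition sm_fourier :: "'a::euclidean_space signed_measure \<Rightarrow> 'a \<Rightarrow> complex" where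
  "sm_fourier \<nu> \<xi> = sm_integral \<nu> (\<lambda>x. cis (- 2 * pi * (\<xi> \<bullet> x)))"

text \<open>The squared norm of \<open>H\<^sup>\<sigma>\<close>. It is used below only for \<open>\<sigma> < - d / 2\<close>, where the integral
  is finite because the Fourier transform of a finite measure is bounded.\<close>

definition sobolev_norm_sq :: "real \<Rightarrow> 'a::euclidean_space signed_measure \<Rightarrow> real" where
  "sobolev_norm_sq \<sigma> \<nu> =
     (LINT \<xi>|lborel. jbracket \<xi> powr (2 * \<sigma>) * (cmod (sm_fourier \<nu> \<xi>))\<^sup>2)"


subsection \<open>Lebesgue spaces\<close>

definition in_Lp :: "ennreal \<Rightarrow> ('a::euclidean_space \<Rightarrow> real) \<Rightarrow> bool" where
  "in_Lp p f \<longleftrightarrow> f \<in> borel_measurable lborel \<and>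
     (if p = \<infinity> then esssup lborel (\<lambda>x. ennreal \<bar>f x\<bar>) < \<infinity>
      else integrable lborel (\<lambda>x. \<bar>f x\<bar> powr enn2real p))"

definition Lp_norm :: "ennreal \<Rightarrow> ('a::euclidean_space \<Rightarrow> real) \<Rightarrow> real" where
  "Lp_norm p f =
     (if p = \<infinity> then enn2real (esssup lborel (\<lambda>x. ennreal \<bar>f x\<bar>))
      else (LINT x|lborel. \<bar>f x\<bar> powr enn2real p) powr (1 / enn2real p))"

text \<open>\<open>(p - 1) / p\<close>, read as \<open>1\<close> for \<open>p = \<infinity>\<close>.\<close>

definition conj_ratio :: "ennreal \<Rightarrow> real" where
  "conj_ratio p = (if p = \<infinity> then 1 else (enn2real p - 1) / enn2real p)"


subsection \<open>Admissible kernels and potentials\<close>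

text \<open>The function \<open>r \<mapsto> \<phi>(r)\<close> on \<open>[0,\<infinity>)\<close> associated with a radial \<open>\<phi>\<close>.\<close>

definition profile :: "('a::euclidean_space \<Rightarrow> real) \<Rightarrow> real \<Rightarrow> real" where
  "profile \<phi> r = \<phi> (r *\<^sub>R (SOME b. b \<in> Basis))"

definition admissible_kernel :: "real \<Rightarrow> ('a::euclidean_space \<Rightarrow> real) \<Rightarrow> bool" where
  "admissible_kernel s \<phi> \<longleftrightarrow>
     (\<forall>x. 0 \<le> \<phi> x) \<and> bounded (range \<phi>) \<and> continuous_on UNIV \<phi> \<and> integrable lborel \<phi> \<and>
     (\<forall>x y. norm x = norm y \<longrightarrow> \<phi> x = \<phi> y) \<and>
     (\<forall>r r'. 0 \<le> r \<and> r \<le> r' \<longrightarrow> profile \<phi> r' \<le> profile \<phi> r) \<and>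
     (profile \<phi> \<longlongrightarrow> 0) at_top \<and>
     (\<exists>x. \<phi> x \<noteq> 0) \<and>
     (\<forall>\<xi>. fourier \<phi> \<xi> \<in> \<real> \<and> 0 \<le> Re (fourier \<phi> \<xi>)) \<and>
     (s > 0 \<longrightarrow> set_integrable lborel {0<..} (\<lambda>r. r powr (s - 1) * profile \<phi> r)) \<and>
     (s = 0 \<longrightarrow>
        set_integrable lborel {0<..} (\<lambda>r. \<bar>ln r * deriv (profile \<phi>) r\<bar>) \<and>
        ((\<lambda>r. (profile \<phi> r - \<phi> 0) * ln r) \<longlongrightarrow> 0) (at_right 0) \<and>
        ((\<lambda>r. profile \<phi> r * ln r) \<longlongrightarrow> 0) at_top) \<and>
     (\<exists>\<gamma> C. \<gamma> > s \<and> (\<forall>x. \<phi> x \<le> C * jbracket x powr (- \<gamma>))) \<and>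
     (\<exists>D. (\<forall>x. x \<noteq> 0 \<longrightarrow> GDERIV \<phi> x :> D x) \<and> continuous_on (- {0}) D \<and>
        (\<exists>c C. c > 0 \<and> C > 0 \<and> (\<forall>x. x \<noteq> 0 \<longrightarrow> norm x * norm (D x) \<le> C * \<phi> (c *\<^sub>R x))))"

definition dilate :: "real \<Rightarrow> ('a::euclidean_space \<Rightarrow> real) \<Rightarrow> 'a \<Rightarrow> real" where
  "dilate t \<phi> x = \<phi> (x /\<^sub>R t) / t ^ DIM('a)"

definition c_norm :: "real \<Rightarrow> ('a::euclidean_space \<Rightarrow> real) \<Rightarrow> real" where
  "c_norm s \<phi> =
     1 / (if s = 0 then \<phi> 0 else s * (LINT r:{0<..}|lborel. r powr (s - 1) * profile \<phi> r))"

definition C_trunc :: "('a::euclidean_space \<Rightarrow> real) \<Rightarrow> real \<Rightarrow> real" where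
  "C_trunc \<phi> T = \<phi> 0 * ln T - (LINT r:{0<..}|lborel. ln r * deriv (profile \<phi>) r)"

definition locally_integrable_pos :: "(real \<Rightarrow> real) \<Rightarrow> bool" where
  "locally_integrable_pos f \<longleftrightarrow> (\<forall>a b. 0 < a \<longrightarrow> set_integrable lborel {a..b} f)"

text \<open>\<open>g\<close> is \<open>(s,\<phi>)\<close>-admissible iff \<open>admissible_potential s \<phi> \<zeta> C\<^sub>\<zeta> \<rho> g\<close> holds for some
  \<open>\<zeta>\<close>, \<open>C\<^sub>\<zeta>\<close> and \<open>\<rho>\<close>; these witnesses are arguments because the estimate refers to them.
  For \<open>s > 0\<close> the argument \<open>\<rho>\<close> plays no role. The value of \<open>g\<close> at \<open>0\<close> is irrelevant.\<close>

definition admissible_potential ::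
  "real \<Rightarrow> ('a::euclidean_space \<Rightarrow> real) \<Rightarrow> (real \<Rightarrow> real) \<Rightarrow> real \<Rightarrow> (real \<Rightarrow> real) \<Rightarrow>
   ('a \<Rightarrow> real) \<Rightarrow> bool" where
  "admissible_potential s \<phi> \<zeta> C\<^sub>\<zeta> \<rho> g \<longleftrightarrow>
     admissible_kernel s \<phi> \<and>
     (\<forall>t>0. 0 \<le> \<zeta> t) \<and> locally_integrable_pos \<zeta> \<and>
     C\<^sub>\<zeta> > 0 \<and>
     (\<forall>t>0. t powr (real DIM('a) - s) / C\<^sub>\<zeta> \<le> \<zeta> t \<and> \<zeta> t \<le> C\<^sub>\<zeta> * t powr (real DIM('a) - s)) \<and>
     (s = 0 \<longrightarrow>
        (\<forall>t>0. \<zeta> t = t ^ DIM('a) + \<rho> t \<and> 0 \<le> \<rho> t) \<and> locally_integrable_pos \<rho> \<and>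
        set_integrable lborel {0<..} (\<lambda>t. \<rho> t / t ^ DIM('a) / t)) \<and>
     (\<forall>x. x \<noteq> 0 \<longrightarrow>
        ((\<lambda>T. c_norm s \<phi> * ((LINT t:{0<..<T}|lborel. \<zeta> t * dilate t \<phi> x / t)
                              - (if s = 0 then C_trunc \<phi> T else 0))) \<longlongrightarrow> g x) at_top)"

text \<open>These conditions determine the Bessel potential \<open>G\<^sub>a\<close>, \<open>a > d\<close>, uniquely, by Fourier inversion.\<close>

definition is_bessel_potential :: "real \<Rightarrow> ('a::euclidean_space \<Rightarrow> real) \<Rightarrow> bool" where
  "is_bessel_potential a G \<longleftrightarrow>
     continuous_on UNIV G \<and> integrable lborel G \<and>
     (\<forall>\<xi>. fourier G \<xi> = of_real ((1 + 4 * pi\<^sup>2 * (norm \<xi>)\<^sup>2) powr (- a / 2)))"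


subsection \<open>The coercivity estimate\<close>

text \<open>The argument \<open>K\<close> is the constant \<open>C\<^sub>\<zeta>\<close>, and \<open>R\<close> is the constant \<open>C\<^sub>\<rho>\<close>.\<close>

definition coercivity_estimate ::
  "real \<Rightarrow> real \<Rightarrow> ennreal \<Rightarrow> real \<Rightarrow> real \<Rightarrow> real \<Rightarrow> ('a::euclidean_space \<Rightarrow> real) \<Rightarrow> bool" where
  "coercivity_estimate s r p C K R g \<longleftrightarrow>
     (\<forall>(\<mu> :: 'a \<Rightarrow> real) (lam :: real) (N :: nat) (X :: nat \<Rightarrow> 'a).
        integrable lborel \<mu> \<longrightarrow> in_Lp p \<mu> \<longrightarrow> (LINT x|lborel. \<mu> x) = 1 \<longrightarrow>
        (s = 0 \<longrightarrow>
          integrable (lborel \<Otimes>\<^sub>M lborel) (\<lambda>(x, y). \<bar>g (x - y)\<bar> * (\<bar>\<mu> x\<bar> * \<bar>\<mu> y\<bar>))) \<longrightarrow>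
        0 < lam \<longrightarrow> lam \<le> 1 \<longrightarrow> N \<ge> 1 \<longrightarrow> inj_on X {..<N} \<longrightarrow>
        sobolev_norm_sq (- r / 2) (fluctuation N X \<mu>)
          \<le> C * K * (modulated_energy g N X \<mu>
              + (g_Riesz s lam + C + R) / (2 * real N) * of_bool (s = 0)
              + C * K * (g_Riesz s lam / (2 * real N)) * of_bool (s > 0)
              + C * K * Lp_norm p \<mu> * lam powr (real DIM('a) * conj_ratio p - s)))"

end

theory Submission
  imports Defs
begin

text \<open>Let \<open>\<nu> = 1/N \<Sum>\<^sub>i \<delta>\<^bsub>x\<^sub>i\<^esub> - \<mu>\<close>, a signed measure of total mass zero. An admissible potential is, up to
constants, a superposition \<open>g = c \<integral> \<zeta>(t) \<phi>\<^sub>t dt/t\<close> of dilates of a positive-definite kernel, so its energy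
is a superposition over the scales \<open>t\<close> of the energies of \<open>\<phi>\<^sub>t\<close>. With the diagonal removed, the energy of
a single scale has two lower bounds, which complement each other.

\<^item> The point-point part is nonnegative because \<open>\<phi>\<^sub>t \<ge> 0\<close>, and the background part because \<open>\<phi>\<^sub>t\<close> is
positive definite. Only the mixed terms can be negative, and Hoelder's inequality bounds them by a
multiple of \<open>\<parallel>\<mu>\<parallel>\<^sub>p t\<^bsup>d(p-1)/p - d\<^esup>\<close> (\<open>reduced_energy_ge_cross\<close>). As \<open>p > d/(d-s)\<close>, this is integrable
against \<open>\<zeta>(t) dt/t\<close> near \<open>t = 0\<close>.
\<^item> Restoring the diagonal costs \<open>\<phi>\<^sub>t(0)/N\<close> and produces the full energy
\<open>\<integral> \<phi>\<^sup>^(t \<xi>) |\<nu>\<^sup>^(\<xi>)|\<^sup>2 d\<xi>\<close> (\<open>reduced_energy_eq\<close>, \<open>energy_ge_spectral\<close>). It is nonnegative, and for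
\<open>1 \<le> t \<le> 2\<close> it dominates the squared norm of \<open>H\<^bsup>-r/2\<^esup>\<close> (\<open>spectral_lower\<close>). The cost \<open>\<phi>\<^sub>t(0)/N\<close> is
integrable near \<open>t = \<infinity>\<close> if \<open>s > 0\<close>, and produces the logarithm if \<open>s = 0\<close>.

The first bound is used for \<open>t \<le> \<lambda>\<close> and the second for \<open>t > \<lambda>\<close>. For \<open>s = 0\<close> the perturbation \<open>\<rho>\<close> of the
density is treated by the second bound at all scales. This costs only \<open>\<phi>(0)/N\<close> times the integral of
\<open>\<rho>(t) t\<^bsup>-d\<^esup> dt/t\<close>, so that no other constant depends on \<open>\<rho>\<close>.

The superposition diverges at large scales if \<open>s = 0\<close>. In all cases the proof therefore works with the
decomposition \<open>g = c (S + P - D - b)\<close> (\<open>potential_decomposition\<close>). Here \<open>S\<close> collects the scales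
below \<open>\<lambda>\<close>, \<open>P\<close> the perturbation, and \<open>D\<close> is the integral of the \<^emph>\<open>deficit\<close> \<open>\<zeta>(t) (\<phi>\<^sub>t(0) - \<phi>\<^sub>t) dt/t\<close> over
the scales above \<open>\<lambda>\<close>. The integrand of \<open>D\<close> is nonnegative, so the existence of the limit that defines
\<open>g\<close> already forces convergence; and since \<open>\<nu>\<close> has total mass zero, subtracting the constant
\<open>\<phi>\<^sub>t(0)\<close> turns the full energy into its negative and does nothing else. The constant \<open>b\<close> sees only the
mass \<open>-1/N\<close> that \<open>\<nu> \<otimes> \<nu>\<close> has off the diagonal.

The energies of \<open>S\<close>, \<open>P\<close> and \<open>D\<close> are computed scale by scale with Fubini's theorem, which requires
these functions to be integrable against \<open>|\<nu>| \<otimes> |\<nu>|\<close> off the diagonal. For \<open>S\<close> this is Hoelder's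
inequality again, and \<open>P\<close> is bounded. So is \<open>D\<close> if \<open>s > 0\<close>. If \<open>s = 0\<close>, the function \<open>D\<close> grows like a
logarithm; the hypothesis that \<open>|g|\<close> is integrable against \<open>|\<mu>| \<otimes> |\<mu>|\<close> makes \<open>D(x - \<cdot>)\<close> integrable
against \<open>|\<mu>|\<close> for some \<open>x\<close>, and the doubling inequality \<open>D(2v) \<le> D(v) + \<phi>(0)\<close> carries this over to
every other point (\<open>D_doubling\<close>, \<open>D_cross_finite\<close>).

Bessel potentials are a special case of the result for a kernel with \<open>\<phi>\<^sup>^ \<ge> C \<langle>\<xi>\<rangle>\<^bsup>-r\<^esup>\<close>. A Riesz
potential is by scaling a superposition of the dilates of \<^emph>\<open>any\<close> kernel (\<open>Riesz_limit\<close>, \<open>log_limit\<close>),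
so it remains to exhibit one kernel whose Fourier transform decays no faster than \<open>\<langle>\<xi>\<rangle>\<^bsup>-r\<^esup>\<close>. A
lacunary series of Gaussians has this property (\<open>series_fourier_lower\<close>).\<close>

section \<open>Fourier transforms of Gaussians\<close>

text \<open>This is the characteristic function of the standard normal distribution after the substitution
\<open>x \<mapsto> sqrt (2 \<pi> a) x\<close>.\<close>

lemma gaussian_fourier_real:
  fixes a t :: real assumes "a > 0"
  shows "has_bochner_integral lborel (\<lambda>x. of_real (exp (- pi * a * x\<^sup>2)) * cis (2 * pi * (t * x)))
           (of_real (exp (- pi * t\<^sup>2 / a) / sqrt a) :: complex)"
proof -
  define c where "c = sqrt (2 * pi * a)"
  have c: "c > 0" "c\<^sup>2 = 2 * pi * a" using assms by (auto simp: c_def)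
  define \<tau> where "\<tau> = 2 * pi * t / c"
  have norm_int: "integrable lborel (\<lambda>x. of_real (std_normal_density x) * iexp (\<tau> * x))"
  proof (rule Bochner_Integration.integrable_bound)
    show "integrable lborel std_normal_density" by (rule integrable_normal_density) simp
  qed (auto simp: norm_mult)
  have "of_real (exp (- (\<tau>^2) / 2)) = char std_normal_distribution \<tau>"
    by (simp add: char_std_normal_distribution)
  also have "\<dots> = (CLINT x|lborel. std_normal_density x *\<^sub>R iexp (\<tau> * x))"
    unfolding char_def by (rule integral_density) auto
  also have "\<dots> = (CLINT x|lborel. of_real (std_normal_density x) * iexp (\<tau> * x))"
    by (simp add: scaleR_conv_of_real)
  finally have hb: "has_bochner_integral lborel (\<lambda>x. of_real (std_normal_density x) * iexp (\<tau> * x))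
      (of_real (exp (- (\<tau>^2) / 2)) :: complex)"
    using norm_int by (simp add: has_bochner_integral_iff)
  have "has_bochner_integral lborel
      (\<lambda>x. of_real (std_normal_density (0 + c * x)) * iexp (\<tau> * (0 + c * x)))
      (of_real (exp (- (\<tau>^2) / 2)) /\<^sub>R \<bar>c\<bar>)"
    using c hb by (subst (asm) lborel_has_bochner_integral_real_affine_iff[where c=c and t=0]) auto
  from has_bochner_integral_mult_right[OF this, of "of_real (sqrt (2 * pi))"]
  have 1: "has_bochner_integral lborel
      (\<lambda>x. of_real (sqrt (2 * pi)) * (of_real (std_normal_density (c * x)) * iexp (\<tau> * (c * x))))
      (of_real (sqrt (2 * pi)) * (of_real (exp (- (\<tau>^2) / 2)) /\<^sub>R \<bar>c\<bar>))"
    by (simp add: mult.assoc)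
  have *: "of_real (sqrt (2 * pi)) * (of_real (std_normal_density (c * x)) * iexp (\<tau> * (c * x)))
     = of_real (exp (- pi * a * x\<^sup>2)) * cis (2 * pi * (t * x))" for x
  proof -
    have "sqrt (2 * pi) * std_normal_density (c * x) = exp (- pi * a * x\<^sup>2)"
      using c by (simp add: std_normal_density_def power_mult_distrib)
    then have "complex_of_real (sqrt (2 * pi)) * of_real (std_normal_density (c * x)) = of_real (exp (- pi * a * x\<^sup>2))"
      by (metis of_real_mult)
    moreover have "iexp (\<tau> * (c * x)) = cis (2 * pi * (t * x))"
      using c by (simp add: \<tau>_def cis_conv_exp mult_ac)
    ultimately show ?thesis by (metis mult.assoc)
  qed
  have **: "of_real (sqrt (2 * pi)) * (of_real (exp (- (\<tau>^2) / 2)) /\<^sub>R \<bar>c\<bar>)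
      = (of_real (exp (- pi * t\<^sup>2 / a) / sqrt a) :: complex)"
  proof -
    have "\<tau>\<^sup>2 = 2 * pi * t\<^sup>2 / a" using c assms by (simp add: \<tau>_def power_divide power_mult_distrib power2_eq_square)
    then have e: "exp (- (\<tau>^2) / 2) = exp (- pi * t\<^sup>2 / a)" by simp
    have "sqrt (2 * pi) / c = 1 / sqrt a" by (simp add: c_def real_sqrt_mult)
    then have "sqrt (2 * pi) * (exp (- (\<tau>^2) / 2) / c) = exp (- pi * t\<^sup>2 / a) / sqrt a"
      unfolding e by (metis (no_types, lifting) mult.commute times_divide_eq_left times_divide_eq_right mult.right_neutral)
    moreover have "of_real (sqrt (2 * pi)) * (of_real (exp (- (\<tau>^2) / 2)) /\<^sub>R \<bar>c\<bar>)
      = (of_real (sqrt (2 * pi) * (exp (- (\<tau>^2) / 2) / c)) :: complex)"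
      using c by (simp only: of_real_mult of_real_divide scaleR_conv_of_real of_real_inverse abs_of_pos divide_inverse mult.commute mult.left_commute)
    ultimately show ?thesis by simp
  qed
  show ?thesis using 1 unfolding * ** .
qed

text \<open>Lebesgue measure is the image of a product of copies of the measure on the line, one for each basis
vector, so products of functions of the single coordinates integrate to products.\<close>

lemma has_bochner_integral_lborel_prod:
  fixes f :: "'a::euclidean_space \<Rightarrow> real \<Rightarrow> complex"
  assumes "\<And>b. b \<in> Basis \<Longrightarrow> has_bochner_integral lborel (f b) (I b)"
  shows "has_bochner_integral lborel (\<lambda>x::'a. \<Prod>b\<in>Basis. f b (x \<bullet> b)) (\<Prod>b\<in>Basis. I b)"
proof -
  interpret product_sigma_finite "\<lambda>_::'a. lborel :: real measure" ..
  have i: "\<And>b. b \<in> Basis \<Longrightarrow> integrable lborel (f b)"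
    and v: "\<And>b. b \<in> Basis \<Longrightarrow> integral\<^sup>L lborel (f b) = I b"
    using assms by (auto simp: has_bochner_integral_iff)
  have m[measurable]: "\<And>b. b \<in> Basis \<Longrightarrow> f b \<in> borel_measurable borel"
    using i borel_measurable_integrable measurable_lborel1 by (metis measurable_lborel2)
  have "has_bochner_integral (\<Pi>\<^sub>M b\<in>Basis. lborel) (\<lambda>x. \<Prod>b\<in>Basis. f b (x b)) (\<Prod>b\<in>Basis. I b)"
    unfolding has_bochner_integral_iff
    using product_integrable_prod[OF finite_Basis i] product_integral_prod[OF finite_Basis i] v by auto
  moreover have "(\<Prod>b\<in>Basis. f b (x b)) = (\<Prod>b\<in>Basis. f b ((\<Sum>b\<in>Basis. x b *\<^sub>R b) \<bullet> b))" for x :: "'a \<Rightarrow> real"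
    by (rule prod.cong) simp_all
  ultimately have "has_bochner_integral (distr (\<Pi>\<^sub>M b\<in>Basis. lborel) borel (\<lambda>x. \<Sum>b\<in>Basis. x b *\<^sub>R b))
      (\<lambda>x::'a. \<Prod>b\<in>Basis. f b (x \<bullet> b)) (\<Prod>b\<in>Basis. I b)"
    by (intro has_bochner_integral_distr) auto
  then show ?thesis by (simp add: lborel_eq[where 'a='a])
qed

theorem gaussian_fourier:
  fixes \<xi> :: "'a::euclidean_space" assumes a: "a > 0"
  shows "has_bochner_integral lborel (\<lambda>x. exp (- pi * a * (norm x)\<^sup>2) *\<^sub>R cis (2 * pi * (\<xi> \<bullet> x)))
           (of_real (exp (- pi * (norm \<xi>)\<^sup>2 / a) / sqrt a ^ DIM('a)))"
proof -
  have n: "(norm x)\<^sup>2 = (\<Sum>b\<in>Basis. (x \<bullet> b)\<^sup>2)" for x :: 'a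
    by (metis (no_types, lifting) euclidean_inner power2_eq_square power2_norm_eq_inner sum.cong)
  have "has_bochner_integral lborel
      (\<lambda>x::'a. \<Prod>b\<in>Basis. of_real (exp (- pi * a * (x \<bullet> b)\<^sup>2)) * cis (2 * pi * ((\<xi> \<bullet> b) * (x \<bullet> b))))
      (\<Prod>b\<in>Basis. (of_real (exp (- pi * (\<xi> \<bullet> b)\<^sup>2 / a) / sqrt a) :: complex))"
    by (intro has_bochner_integral_lborel_prod gaussian_fourier_real a)
  moreover have "(\<Prod>b\<in>Basis. of_real (exp (- pi * a * (x \<bullet> b)\<^sup>2)) * cis (2 * pi * ((\<xi> \<bullet> b) * (x \<bullet> b))))
      = exp (- pi * a * (norm x)\<^sup>2) *\<^sub>R cis (2 * pi * (\<xi> \<bullet> x))" for x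
  proof -
    have "(\<Prod>b\<in>Basis. exp (- pi * a * (x \<bullet> b)\<^sup>2)) = exp (- pi * a * (norm x)\<^sup>2)"
      by (simp add: exp_sum[symmetric] n sum_distrib_left)
    moreover have "(\<Prod>b\<in>Basis. cis (2 * pi * ((\<xi> \<bullet> b) * (x \<bullet> b)))) = cis (2 * pi * (\<xi> \<bullet> x))"
      by (subst euclidean_inner) (simp add: cis_conv_exp exp_sum[symmetric] sum_distrib_left sum_distrib_right mult_ac)
    ultimately show ?thesis by (simp add: prod.distrib scaleR_conv_of_real of_real_prod[symmetric] del: of_real_prod)
  qed
  moreover have "(\<Prod>b\<in>Basis. (of_real (exp (- pi * (\<xi> \<bullet> b)\<^sup>2 / a) / sqrt a) :: complex))
     = of_real (exp (- pi * (norm \<xi>)\<^sup>2 / a) / sqrt a ^ DIM('a))"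
    by (simp add: prod_dividef n sum_distrib_left sum_divide_distrib of_real_prod[symmetric] exp_sum[symmetric] sum_negf del: of_real_prod of_real_divide)
  ultimately show ?thesis by simp
qed

lemma lborel_integral_affine:
  fixes f :: "'a::euclidean_space \<Rightarrow> 'b::{banach, second_countable_topology}"
  assumes "c \<noteq> 0" "f \<in> borel_measurable borel"
  shows "integral\<^sup>L lborel f = \<bar>c\<bar> ^ DIM('a) *\<^sub>R (LINT x|lborel. f (y + c *\<^sub>R x))"
  by (subst lborel_affine[OF assms(1), of y])
     (use assms in \<open>simp add: integral_density integral_distr\<close>)

lemma lborel_integrable_affine:
  fixes f :: "'a::euclidean_space \<Rightarrow> 'b::{banach, second_countable_topology}"
  assumes "c \<noteq> 0" "integrable lborel f"
  shows "integrable lborel (\<lambda>x. f (y + c *\<^sub>R x))"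
proof -
  have [measurable]: "f \<in> borel_measurable borel" using assms by auto
  have "integrable (density (distr lborel borel (\<lambda>x. y + c *\<^sub>R x)) (\<lambda>_. ennreal (\<bar>c\<bar>^DIM('a)))) f"
    using assms lborel_affine[OF assms(1), of y] by simp
  then have "integrable (distr lborel borel (\<lambda>x. y + c *\<^sub>R x)) (\<lambda>x. \<bar>c\<bar>^DIM('a) *\<^sub>R f x)"
    by (subst (asm) integrable_density) auto
  then have "integrable lborel (\<lambda>x. \<bar>c\<bar>^DIM('a) *\<^sub>R f (y + c *\<^sub>R x))"
    by (subst (asm) integrable_distr_eq) auto
  from integrable_scaleR_right[OF this, of "inverse (\<bar>c\<bar>^DIM('a))"] show ?thesis
    using assms(1) by simp
qed

section \<open>Integration against finite signed measures\<close>

text \<open>The masses need not be finite: Lebesgue measure is an admissible entry. Sigma-finiteness is what Fubini's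
theorem needs, and finiteness is expressed separately through \<open>sm_tv\<close>.\<close>

definition borel_sm :: "'a::topological_space signed_measure \<Rightarrow> bool" where
  "borel_sm \<nu> \<longleftrightarrow> (\<forall>(M, w)\<in>set \<nu>. sigma_finite_measure M \<and> sets M = sets borel \<and>
     w \<in> borel_measurable borel)"

text \<open>The integral against the sum of the variations of the entries. This dominates the variation of the
signed measure, because entries may cancel. With values in \<open>ennreal\<close>, its finiteness is integrability
against every entry, and monotonicity reduces integrability to estimates.\<close>

definition sm_tv :: "'a signed_measure \<Rightarrow> ('a \<Rightarrow> ennreal) \<Rightarrow> ennreal" where
  "sm_tv \<nu> f = (\<Sum>(M, w)\<leftarrow>\<nu>. \<integral>\<^sup>+x. ennreal \<bar>w x\<bar> * f x \<partial>M)"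

definition sm_integrable ::
  "'a::topological_space signed_measure \<Rightarrow> ('a \<Rightarrow> 'b::{banach, second_countable_topology}) \<Rightarrow> bool" where
  "sm_integrable \<nu> f \<longleftrightarrow> f \<in> borel_measurable borel \<and> sm_tv \<nu> (\<lambda>x. ennreal (norm (f x))) < \<infinity>"

lemma sm_simps [simp]:
  "sm_tv [] h = 0" "sm_tv ((M, w) # \<nu>) h = (\<integral>\<^sup>+x. ennreal \<bar>w x\<bar> * h x \<partial>M) + sm_tv \<nu> h"
  "sm_integral [] f = 0" "sm_integral ((M, w) # \<nu>) f = (LINT x|M. w x *\<^sub>R f x) + sm_integral \<nu> f"
  "sm_tv (\<nu> @ \<kappa>) h = sm_tv \<nu> h + sm_tv \<kappa> h"
  "sm_integral (\<nu> @ \<kappa>) f = sm_integral \<nu> f + sm_integral \<kappa> f"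
  by (auto simp: sm_tv_def sm_integral_def)

lemma borel_sm_simps [simp]:
  "borel_sm []"
  "borel_sm ((M, w) # \<nu>) \<longleftrightarrow> sigma_finite_measure M \<and> sets M = sets borel \<and>
     w \<in> borel_measurable borel \<and> borel_sm \<nu>"
  "borel_sm (\<nu> @ \<kappa>) \<longleftrightarrow> borel_sm \<nu> \<and> borel_sm \<kappa>"
  by (auto simp: borel_sm_def)

lemma measurable_borel_sets:
  "sets M = sets borel \<Longrightarrow> f \<in> measurable borel N \<Longrightarrow> f \<in> measurable M N"
  by (metis measurable_cong_sets)

lemma sm_tv_mono: "(\<And>x. f x \<le> g x) \<Longrightarrow> sm_tv \<nu> f \<le> sm_tv \<nu> g"
  by (induction \<nu>) (auto intro!: add_mono nn_integral_mono mult_left_mono)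

lemma sm_tv_add:
  assumes "borel_sm \<nu>" "f \<in> borel_measurable borel" "g \<in> borel_measurable borel"
  shows "sm_tv \<nu> (\<lambda>x. f x + g x) = sm_tv \<nu> f + sm_tv \<nu> g"
  using assms(1)
proof (induction \<nu>)
  case (Cons p \<nu>)
  obtain M w where p: "p = (M, w)" by force
  have [measurable]: "w \<in> borel_measurable M" "f \<in> borel_measurable M" "g \<in> borel_measurable M"
    using Cons.prems assms by (auto simp: p intro: measurable_borel_sets)
  have "(\<integral>\<^sup>+x. ennreal \<bar>w x\<bar> * (f x + g x) \<partial>M)
      = (\<integral>\<^sup>+x. ennreal \<bar>w x\<bar> * f x \<partial>M) + (\<integral>\<^sup>+x. ennreal \<bar>w x\<bar> * g x \<partial>M)"
    by (simp add: distrib_left nn_integral_add)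
  with Cons show ?case by (simp add: p ac_simps)
qed simp

lemma sm_tv_cmult:
  assumes "borel_sm \<nu>" "f \<in> borel_measurable borel"
  shows "sm_tv \<nu> (\<lambda>x. c * f x) = c * sm_tv \<nu> f"
  using assms(1)
proof (induction \<nu>)
  case (Cons p \<nu>)
  obtain M w where p: "p = (M, w)" by force
  have [measurable]: "w \<in> borel_measurable M" "f \<in> borel_measurable M"
    using Cons.prems assms by (auto simp: p intro: measurable_borel_sets)
  have "(\<integral>\<^sup>+x. ennreal \<bar>w x\<bar> * (c * f x) \<partial>M) = c * (\<integral>\<^sup>+x. ennreal \<bar>w x\<bar> * f x \<partial>M)"
    by (subst nn_integral_cmult[symmetric]) (auto simp: ac_simps)
  with Cons show ?case by (simp add: p distrib_left)
qed simp

lemma sm_integrable_entry: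
  assumes "borel_sm \<nu>" "sm_integrable \<nu> f" "(M, w) \<in> set \<nu>"
  shows "integrable M (\<lambda>x. w x *\<^sub>R f x)"
  using assms
proof (induction \<nu>)
  case (Cons p \<nu>)
  obtain M' w' where p: "p = (M', w')" by force
  have tv: "(\<integral>\<^sup>+x. ennreal \<bar>w' x\<bar> * ennreal (norm (f x)) \<partial>M') < \<infinity>" "sm_tv \<nu> (\<lambda>x. ennreal (norm (f x))) < \<infinity>"
    using Cons.prems by (auto simp: sm_integrable_def p)
  show ?case
  proof (cases "(M, w) = (M', w')")
    case True
    then have [measurable]: "w \<in> borel_measurable M" "f \<in> borel_measurable M"
      using Cons.prems by (auto simp: p sm_integrable_def intro: measurable_borel_sets)
    have "(\<lambda>x. w x *\<^sub>R f x) \<in> borel_measurable M" by measurable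
    moreover have "(\<integral>\<^sup>+x. ennreal (norm (w x *\<^sub>R f x)) \<partial>M) < \<infinity>"
      using tv True by (simp add: ennreal_mult)
    ultimately show ?thesis by (rule integrableI_bounded)
  next
    case False
    then show ?thesis using Cons tv by (auto simp: p sm_integrable_def)
  qed
qed simp

lemma sm_integrable_Cons:
  assumes "borel_sm ((M, w) # \<nu>)" "sm_integrable ((M, w) # \<nu>) f"
  shows "integrable M (\<lambda>x. w x *\<^sub>R f x)" "sm_integrable \<nu> f"
  using sm_integrable_entry[OF assms] assms by (auto simp: sm_integrable_def)

lemma sm_integrable_bound:
  assumes "f \<in> borel_measurable borel" "\<And>x. ennreal (norm (f x)) \<le> h x" "sm_tv \<nu> h < \<infinity>"
  shows "sm_integrable \<nu> f"
  using assms sm_tv_mono[of "\<lambda>x. ennreal (norm (f x))" h \<nu>] by (auto simp: sm_integrable_def)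

lemma sm_integrable_bounded:
  assumes "borel_sm \<nu>" "sm_tv \<nu> (\<lambda>_. 1) < \<infinity>" "f \<in> borel_measurable borel" "\<And>x. norm (f x) \<le> B"
  shows "sm_integrable \<nu> f"
proof (rule sm_integrable_bound)
  show "sm_tv \<nu> (\<lambda>x. ennreal B * 1) < \<infinity>"
    using assms by (subst sm_tv_cmult) (auto simp: ennreal_mult_less_top)
  show "ennreal (norm (f x)) \<le> ennreal B * 1" for x using assms(4)[of x] by (simp add: ennreal_leI)
qed fact

lemma sm_integrable_add:
  assumes "borel_sm \<nu>" "sm_integrable \<nu> f" "sm_integrable \<nu> g"
  shows "sm_integrable \<nu> (\<lambda>x. f x + g x)"
proof (rule sm_integrable_bound)
  have [measurable]: "f \<in> borel_measurable borel" "g \<in> borel_measurable borel"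
    using assms by (auto simp: sm_integrable_def)
  show "(\<lambda>x. f x + g x) \<in> borel_measurable borel" by measurable
  show "sm_tv \<nu> (\<lambda>x. ennreal (norm (f x)) + ennreal (norm (g x))) < \<infinity>"
    using assms by (subst sm_tv_add) (auto simp: sm_integrable_def)
  show "ennreal (norm (f x + g x)) \<le> ennreal (norm (f x)) + ennreal (norm (g x))" for x
    by (simp add: norm_triangle_ineq ennreal_leI flip: ennreal_plus)
qed

lemma sm_integrable_scaleR:
  assumes "borel_sm \<nu>" "sm_integrable \<nu> f"
  shows "sm_integrable \<nu> (\<lambda>x. c *\<^sub>R f x)"
proof (rule sm_integrable_bound)
  have [measurable]: "f \<in> borel_measurable borel" using assms by (auto simp: sm_integrable_def)
  show "(\<lambda>x. c *\<^sub>R f x) \<in> borel_measurable borel" by measurable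
  show "sm_tv \<nu> (\<lambda>x. ennreal \<bar>c\<bar> * ennreal (norm (f x))) < \<infinity>"
    using assms by (subst sm_tv_cmult) (auto simp: sm_integrable_def ennreal_mult_less_top)
qed (auto simp: ennreal_mult)

lemma sm_integral_add:
  assumes "borel_sm \<nu>" "sm_integrable \<nu> f" "sm_integrable \<nu> g"
  shows "sm_integral \<nu> (\<lambda>x. f x + g x) = sm_integral \<nu> f + sm_integral \<nu> g"
  using assms
proof (induction \<nu>)
  case (Cons p \<nu>)
  obtain M w where p: "p = (M, w)" by force
  note 1 = sm_integrable_Cons[OF Cons.prems(1,2)[unfolded p]] sm_integrable_Cons[OF Cons.prems(1,3)[unfolded p]]
  have "(LINT x|M. w x *\<^sub>R (f x + g x)) = (LINT x|M. w x *\<^sub>R f x) + (LINT x|M. w x *\<^sub>R g x)"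
    using 1 by (simp add: scaleR_add_right)
  with Cons 1 show ?case by (simp add: p)
qed simp

lemma sm_integral_scaleR:
  "sm_integral \<nu> (\<lambda>x. c *\<^sub>R f x) = c *\<^sub>R sm_integral \<nu> f"
  by (induction \<nu>)
     (auto simp: scaleR_add_right scaleR_left_commute[of _ c] simp del: scaleR_scaleR)

lemma sm_integral_minus:
  "sm_integral \<nu> (\<lambda>x. - f x) = - sm_integral \<nu> f"
  using sm_integral_scaleR[of \<nu> "-1" f] by simp

lemma sm_integral_diff:
  assumes "borel_sm \<nu>" "sm_integrable \<nu> f" "sm_integrable \<nu> g"
  shows "sm_integral \<nu> (\<lambda>x. f x - g x) = sm_integral \<nu> f - sm_integral \<nu> g"
  using sm_integral_add[OF assms(1,2) sm_integrable_scaleR[OF assms(1,3), of "-1"]]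
  by (simp add: sm_integral_minus)

lemma sm_integral_mult_left:
  fixes f :: "'a \<Rightarrow> 'b::{real_normed_field, banach, second_countable_topology}"
  shows "sm_integral \<nu> (\<lambda>x. c * f x) = c * sm_integral \<nu> f"
  by (induction \<nu>) (auto simp: distrib_left simp flip: mult_scaleR_right)

lemma sm_integral_mult_right:
  fixes f :: "'a \<Rightarrow> 'b::{real_normed_field, banach, second_countable_topology}"
  shows "sm_integral \<nu> (\<lambda>x. f x * c) = sm_integral \<nu> f * c"
  using sm_integral_mult_left[of \<nu> c f] by (simp add: mult.commute)

lemma sm_integral_of_real:
  fixes f :: "'a \<Rightarrow> real"
  shows "sm_integral \<nu> (\<lambda>x. complex_of_real (f x)) = of_real (sm_integral \<nu> f)"
  by (induction \<nu>) (auto simp: scaleR_conv_of_real simp flip: of_real_mult)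

text \<open>The majorant is required everywhere rather than almost everywhere, since the entries do not share
their null sets.\<close>

lemma sm_integral_dominated_convergence:
  fixes f :: "'a::topological_space \<Rightarrow> 'b::{banach, second_countable_topology}"
  assumes "borel_sm \<nu>" "sm_integrable \<nu> h"
    and "\<And>n. F n \<in> borel_measurable borel" "f \<in> borel_measurable borel"
    and "\<And>x. (\<lambda>n. F n x) \<longlonglongrightarrow> f x" "\<And>n x. norm (F n x) \<le> h x"
  shows "(\<lambda>n. sm_integral \<nu> (F n)) \<longlonglongrightarrow> sm_integral \<nu> f"
  using assms(1,2)
proof (induction \<nu>)
  case (Cons p \<nu>)
  obtain M w where p: "p = (M, w)" by force
  note 1 = sm_integrable_Cons[OF Cons.prems(1,2)[unfolded p]]
  have [measurable]: "w \<in> borel_measurable M" "f \<in> borel_measurable M" "\<And>n. F n \<in> borel_measurable M"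
    using Cons.prems assms by (auto simp: p intro: measurable_borel_sets)
  have "(\<lambda>n. LINT x|M. w x *\<^sub>R F n x) \<longlonglongrightarrow> (LINT x|M. w x *\<^sub>R f x)"
  proof (rule integral_dominated_convergence[where w="\<lambda>x. norm (w x *\<^sub>R h x)"])
    show "integrable M (\<lambda>x. norm (w x *\<^sub>R h x))" using 1 by (intro integrable_norm)
    show "AE x in M. (\<lambda>n. w x *\<^sub>R F n x) \<longlonglongrightarrow> w x *\<^sub>R f x" by (auto intro!: tendsto_intros assms)
    show "AE x in M. norm (w x *\<^sub>R F n x) \<le> norm (w x *\<^sub>R h x)" for n
    proof (rule AE_I2)
      fix x
      have "norm (F n x) \<le> \<bar>h x\<bar>" using assms(6)[of n x] by simp
      then show "norm (w x *\<^sub>R F n x) \<le> norm (w x *\<^sub>R h x)"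
        by (simp add: abs_mult mult_left_mono)
    qed
  qed measurable
  with Cons 1 show ?case by (simp add: p tendsto_add)
qed simp

text \<open>Superpositions over a parameter \<open>t\<close> may be integrated parameter by parameter. Below, \<open>t\<close> is either a
frequency or a scale.\<close>

lemma sm_integral_Fubini:
  fixes F :: "'c::euclidean_space \<Rightarrow> 'a::second_countable_topology \<Rightarrow> 'b::{banach, second_countable_topology}"
  assumes "borel_sm \<nu>" and m: "(\<lambda>(t, x). F t x) \<in> borel_measurable borel"
    and fin: "sm_tv \<nu> (\<lambda>x. \<integral>\<^sup>+t. ennreal (norm (F t x)) \<partial>lborel) < \<infinity>"
  shows "sm_integral \<nu> (\<lambda>x. LINT t|lborel. F t x) = (LINT t|lborel. sm_integral \<nu> (F t))"
    and "integrable lborel (\<lambda>t. sm_integral \<nu> (F t))"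
    and "sm_integrable \<nu> (\<lambda>x. LINT t|lborel. F t x)"
proof -
  have "sm_integral \<nu> (\<lambda>x. LINT t|lborel. F t x) = (LINT t|lborel. sm_integral \<nu> (F t)) \<and>
    integrable lborel (\<lambda>t. sm_integral \<nu> (F t))"
    using assms(1) fin
  proof (induction \<nu>)
    case (Cons p \<nu>)
    obtain M w where p: "p = (M, w)" by force
    have M: "sigma_finite_measure M" "sets M = sets borel" using Cons.prems by (auto simp: p)
    interpret pair_sigma_finite "lborel :: 'c measure" M
      by (intro pair_sigma_finite.intro M lborel.sigma_finite_measure_axioms)
    have "(\<lambda>(t, x). F t x) \<in> borel_measurable (borel \<Otimes>\<^sub>M borel)" using m by (simp add: borel_prod)
    then have [measurable]: "(\<lambda>(t, x). F t x) \<in> borel_measurable (lborel \<Otimes>\<^sub>M M)"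
      by (rule measurable_cong_sets[THEN equalityD1, THEN subsetD, rotated -1])
         (auto intro!: sets_pair_measure_cong simp: M)
    have [measurable]: "w \<in> borel_measurable M"
      using Cons.prems by (auto simp: p intro: measurable_borel_sets)
    have F1: "(\<lambda>t. ennreal (norm (F t x))) \<in> borel_measurable lborel" if "x \<in> space M" for x
      using that by measurable
    have "(\<integral>\<^sup>+z. ennreal (norm (case z of (t, x) \<Rightarrow> w x *\<^sub>R F t x)) \<partial>(lborel \<Otimes>\<^sub>M M))
        = (\<integral>\<^sup>+z. (case z of (t, x) \<Rightarrow> ennreal \<bar>w x\<bar> * ennreal (norm (F t x))) \<partial>(lborel \<Otimes>\<^sub>M M))"
      by (intro nn_integral_cong) (auto simp: ennreal_mult)
    also have "\<dots> = (\<integral>\<^sup>+x. (\<integral>\<^sup>+t. ennreal \<bar>w x\<bar> * ennreal (norm (F t x)) \<partial>lborel) \<partial>M)"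
      by (subst nn_integral_snd[symmetric]) auto
    also have "\<dots> = (\<integral>\<^sup>+x. ennreal \<bar>w x\<bar> * (\<integral>\<^sup>+t. ennreal (norm (F t x)) \<partial>lborel) \<partial>M)"
      by (intro nn_integral_cong nn_integral_cmult F1)
    also have "\<dots> < \<infinity>" using Cons.prems by (simp add: p)
    finally have int: "integrable (lborel \<Otimes>\<^sub>M M) (\<lambda>(t, x). w x *\<^sub>R F t x)"
      by (intro integrableI_bounded) auto
    have "(LINT x|M. w x *\<^sub>R (LINT t|lborel. F t x)) = (LINT x|M. (LINT t|lborel. w x *\<^sub>R F t x))"
      by simp
    also have "\<dots> = (LINT t|lborel. (LINT x|M. w x *\<^sub>R F t x))"
      by (rule Fubini_integral[OF int])
    finally have 2: "(LINT x|M. w x *\<^sub>R (LINT t|lborel. F t x)) = (LINT t|lborel. (LINT x|M. w x *\<^sub>R F t x))" .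
    have 3: "integrable lborel (\<lambda>t. LINT x|M. w x *\<^sub>R F t x)"
      by (rule integrable_fst[OF int])
    show ?case using Cons 2 3 by (auto simp: p)
  qed simp
  then show "sm_integral \<nu> (\<lambda>x. LINT t|lborel. F t x) = (LINT t|lborel. sm_integral \<nu> (F t))"
    "integrable lborel (\<lambda>t. sm_integral \<nu> (F t))" by auto
  have [measurable]: "(\<lambda>(t, x). F t x) \<in> borel_measurable (borel \<Otimes>\<^sub>M borel)" using m by (simp add: borel_prod)
  have meas: "(\<lambda>x. LINT t|lborel. F t x) \<in> borel_measurable borel" by measurable
  show "sm_integrable \<nu> (\<lambda>x. LINT t|lborel. F t x)"
  proof (rule sm_integrable_bound[OF meas _ fin])
    fix x
    show "ennreal (norm (LINT t|lborel. F t x)) \<le> (\<integral>\<^sup>+t. ennreal (norm (F t x)) \<partial>lborel)"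
      by (cases "integrable lborel (\<lambda>t. F t x)")
         (auto simp: integral_norm_bound_ennreal not_integrable_integral_eq)
  qed
qed

lemma borel_sm_tensor:
  fixes \<nu> :: "'a::second_countable_topology signed_measure"
    and \<kappa> :: "'b::second_countable_topology signed_measure"
  assumes "borel_sm \<nu>" "borel_sm \<kappa>"
  shows "borel_sm (sm_tensor \<nu> \<kappa>)"
  unfolding borel_sm_def
proof (rule ballI, clarify, intro conjI)
  fix P u assume "(P, u) \<in> set (sm_tensor \<nu> \<kappa>)"
  then obtain M w K v where *: "(M, w) \<in> set \<nu>" "(K, v) \<in> set \<kappa>" "P = M \<Otimes>\<^sub>M K" "u = (\<lambda>(x, y). w x * v y)"
    by (auto simp: sm_tensor_def)
  have M: "sigma_finite_measure M" "sets M = sets borel" "w \<in> borel_measurable borel"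
    and K: "sigma_finite_measure K" "sets K = sets borel" "v \<in> borel_measurable borel"
    using assms * by (auto simp: borel_sm_def)
  interpret pair_sigma_finite M K by (intro pair_sigma_finite.intro M K)
  show "sigma_finite_measure P" using P.sigma_finite_measure_axioms by (simp add: *)
  show "sets P = sets borel"
    using sets_pair_measure_cong[OF M(2) K(2)] unfolding *(3) borel_prod .
  have "(\<lambda>(x, y). w x * v y) \<in> borel_measurable (borel \<Otimes>\<^sub>M borel)" using M(3) K(3) by measurable
  then show "u \<in> borel_measurable borel" unfolding *(4) borel_prod .
qed

lemma sm_tensor_simps [simp]:
  "sm_tensor [] \<kappa> = []"
  "sm_tensor ((M, w) # \<nu>) \<kappa> = map (\<lambda>(K, v). (M \<Otimes>\<^sub>M K, \<lambda>(x, y). w x * v y)) \<kappa> @ sm_tensor \<nu> \<kappa>"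
  by (auto simp: sm_tensor_def)

lemma measurable_tensor_entry:
  assumes "f \<in> borel_measurable (borel :: ('a::second_countable_topology \<times> 'b::second_countable_topology) measure)"
    and "sets M = sets borel" "sets K = sets borel"
  shows "f \<in> borel_measurable (M \<Otimes>\<^sub>M K)"
  using sets_pair_measure_cong[OF assms(2,3)] unfolding borel_prod
  by (rule measurable_borel_sets) fact

text \<open>A fixed entry of the first factor, by induction over the second one. Measurability of the inner
integral has to be part of the induction.\<close>

lemma sm_tv_single_tensor:
  fixes \<kappa> :: "'b::second_countable_topology signed_measure"
    and f :: "'a::second_countable_topology \<times> 'b \<Rightarrow> ennreal"
  assumes M: "sigma_finite_measure M" "sets M = sets borel" "w \<in> borel_measurable borel"
    and k: "borel_sm \<kappa>" and f: "f \<in> borel_measurable borel"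
  shows "sm_tv (map (\<lambda>(K, v). (M \<Otimes>\<^sub>M K, \<lambda>(x, y). w x * v y)) \<kappa>) f
      = (\<integral>\<^sup>+x. ennreal \<bar>w x\<bar> * sm_tv \<kappa> (\<lambda>y. f (x, y)) \<partial>M) \<and> (\<lambda>x. sm_tv \<kappa> (\<lambda>y. f (x, y))) \<in> borel_measurable borel"
  using k
proof (induction \<kappa>)
  case (Cons q \<kappa>)
  obtain K v where q: "q = (K, v)" by force
  have K: "sigma_finite_measure K" "sets K = sets borel" "v \<in> borel_measurable borel"
    using Cons.prems by (auto simp: q)
  interpret pair_sigma_finite M K by (intro pair_sigma_finite.intro M K)
  note [measurable] = measurable_tensor_entry[OF f M(2) K(2)] measurable_borel_sets[OF M(2) M(3)]
    measurable_borel_sets[OF K(2) K(3)] measurable_tensor_entry[OF f refl K(2)]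
  have fx[measurable]: "(\<lambda>y. f (x, y)) \<in> borel_measurable K" for x
    using measurable_compose[OF measurable_Pair1' measurable_tensor_entry[OF f refl K(2)]] by simp
  have "(\<integral>\<^sup>+z. ennreal \<bar>case z of (x, y) \<Rightarrow> w x * v y\<bar> * f z \<partial>(M \<Otimes>\<^sub>M K))
      = (\<integral>\<^sup>+x. \<integral>\<^sup>+y. ennreal \<bar>w x * v y\<bar> * f (x, y) \<partial>K \<partial>M)"
    by (subst M2.nn_integral_fst[symmetric]) auto
  also have "\<dots> = (\<integral>\<^sup>+x. ennreal \<bar>w x\<bar> * (\<integral>\<^sup>+y. ennreal \<bar>v y\<bar> * f (x, y) \<partial>K) \<partial>M)"
    by (intro nn_integral_cong, subst nn_integral_cmult[symmetric])
       (auto simp: abs_mult ennreal_mult mult.assoc)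
  finally have 1: "(\<integral>\<^sup>+z. ennreal \<bar>case z of (x, y) \<Rightarrow> w x * v y\<bar> * f z \<partial>(M \<Otimes>\<^sub>M K))
      = (\<integral>\<^sup>+x. ennreal \<bar>w x\<bar> * (\<integral>\<^sup>+y. ennreal \<bar>v y\<bar> * f (x, y) \<partial>K) \<partial>M)" .
  have 2[measurable]: "(\<lambda>x. \<integral>\<^sup>+y. ennreal \<bar>v y\<bar> * f (x, y) \<partial>K) \<in> borel_measurable borel" by measurable
  have bk: "borel_sm \<kappa>" using Cons.prems by (simp add: q)
  note IH = Cons.IH[OF bk, THEN conjunct1] and IHm = Cons.IH[OF bk, THEN conjunct2]
  note [measurable] = measurable_borel_sets[OF M(2) 2] measurable_borel_sets[OF M(2) IHm]
  have "(\<integral>\<^sup>+x. ennreal \<bar>w x\<bar> * ((\<integral>\<^sup>+y. ennreal \<bar>v y\<bar> * f (x, y) \<partial>K) + sm_tv \<kappa> (\<lambda>y. f (x, y))) \<partial>M)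
     = (\<integral>\<^sup>+x. ennreal \<bar>w x\<bar> * (\<integral>\<^sup>+y. ennreal \<bar>v y\<bar> * f (x, y) \<partial>K) \<partial>M)
     + (\<integral>\<^sup>+x. ennreal \<bar>w x\<bar> * sm_tv \<kappa> (\<lambda>y. f (x, y)) \<partial>M)"
    by (simp only: distrib_left) (rule nn_integral_add; measurable)
  moreover have "(\<lambda>x. (\<integral>\<^sup>+y. ennreal \<bar>v y\<bar> * f (x, y) \<partial>K) + sm_tv \<kappa> (\<lambda>y. f (x, y))) \<in> borel_measurable borel"
    using 2 IHm by (rule borel_measurable_add)
  moreover have "sm_tv (map (\<lambda>(K, v). (M \<Otimes>\<^sub>M K, \<lambda>(x, y). w x * v y)) (q # \<kappa>)) f
     = (\<integral>\<^sup>+x. ennreal \<bar>w x\<bar> * (\<integral>\<^sup>+y. ennreal \<bar>v y\<bar> * f (x, y) \<partial>K) \<partial>M)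
     + (\<integral>\<^sup>+x. ennreal \<bar>w x\<bar> * sm_tv \<kappa> (\<lambda>y. f (x, y)) \<partial>M)"
    unfolding q list.map prod.case sm_simps(2) 1 IH ..
  ultimately show ?case
    unfolding q sm_simps(2) by (intro conjI) (simp only:)+
qed simp

lemma sm_tv_tensor:
  fixes \<nu> :: "'a::second_countable_topology signed_measure"
    and \<kappa> :: "'b::second_countable_topology signed_measure"
  assumes n: "borel_sm \<nu>" and k: "borel_sm \<kappa>" and f: "f \<in> borel_measurable borel"
  shows "sm_tv (sm_tensor \<nu> \<kappa>) f = sm_tv \<nu> (\<lambda>x. sm_tv \<kappa> (\<lambda>y. f (x, y)))"
  using n
proof (induction \<nu>)
  case (Cons p \<nu>)
  obtain M w where p: "p = (M, w)" by force
  show ?case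
    using Cons sm_tv_single_tensor[of M w \<kappa> f] k f by (simp add: p)
qed simp

lemma sm_integral_single_tensor:
  fixes \<kappa> :: "'b::second_countable_topology signed_measure"
    and f :: "'a::second_countable_topology \<times> 'b \<Rightarrow> 'c::{banach, second_countable_topology}"
  assumes M: "sigma_finite_measure M" "sets M = sets borel" "w \<in> borel_measurable borel"
    and k: "borel_sm \<kappa>"
    and f: "sm_integrable (map (\<lambda>(K, v). (M \<Otimes>\<^sub>M K, \<lambda>(x, y). w x * v y)) \<kappa>) f"
  shows "sm_integral (map (\<lambda>(K, v). (M \<Otimes>\<^sub>M K, \<lambda>(x, y). w x * v y)) \<kappa>) f
      = (LINT x|M. w x *\<^sub>R sm_integral \<kappa> (\<lambda>y. f (x, y))) \<and>
      integrable M (\<lambda>x. w x *\<^sub>R sm_integral \<kappa> (\<lambda>y. f (x, y)))"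
  using k f
proof (induction \<kappa>)
  case (Cons q \<kappa>)
  obtain K v where q: "q = (K, v)" by force
  have K: "sigma_finite_measure K" "sets K = sets borel" "v \<in> borel_measurable borel"
    using Cons.prems by (auto simp: q)
  interpret pair_sigma_finite M K by (intro pair_sigma_finite.intro M K)
  have b: "borel_sm (sm_tensor [(M, w)] (q # \<kappa>))"
    using M Cons.prems by (intro borel_sm_tensor) auto
  then have b: "borel_sm ((M \<Otimes>\<^sub>M K, \<lambda>(x, y). w x * v y) # map (\<lambda>(K, v). (M \<Otimes>\<^sub>M K, \<lambda>(x, y). w x * v y)) \<kappa>)"
    by (simp add: q)
  note 0 = sm_integrable_Cons[OF b Cons.prems(2)[unfolded q list.map prod.case]]
  then have int: "integrable (M \<Otimes>\<^sub>M K) (\<lambda>(x, y). w x *\<^sub>R v y *\<^sub>R f (x, y))"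
    by (simp add: split_beta')
  have 1: "(LINT z|(M \<Otimes>\<^sub>M K). (case z of (x, y) \<Rightarrow> w x * v y) *\<^sub>R f z)
      = (LINT x|M. w x *\<^sub>R (LINT y|K. v y *\<^sub>R f (x, y)))"
  proof -
    have "(LINT z|(M \<Otimes>\<^sub>M K). (case z of (x, y) \<Rightarrow> w x * v y) *\<^sub>R f z)
        = (LINT z|(M \<Otimes>\<^sub>M K). (case z of (x, y) \<Rightarrow> w x *\<^sub>R v y *\<^sub>R f (x, y)))"
      by (simp add: split_beta')
    also have "\<dots> = (LINT x|M. LINT y|K. w x *\<^sub>R v y *\<^sub>R f (x, y))"
      using integral_fst'[OF int] by simp
    finally show ?thesis by (simp only: integral_scaleR_right)
  qed
  have 2: "integrable M (\<lambda>x. w x *\<^sub>R (LINT y|K. v y *\<^sub>R f (x, y)))"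
    using integrable_fst[OF int] by (simp only: integral_scaleR_right)
  show ?case
    using Cons 0 1 2 by (simp add: q scaleR_add_right)
qed simp

lemma sm_integral_tensor:
  fixes \<nu> :: "'a::second_countable_topology signed_measure"
    and \<kappa> :: "'b::second_countable_topology signed_measure"
  assumes n: "borel_sm \<nu>" and k: "borel_sm \<kappa>" and f: "sm_integrable (sm_tensor \<nu> \<kappa>) f"
  shows "sm_integral (sm_tensor \<nu> \<kappa>) f = sm_integral \<nu> (\<lambda>x. sm_integral \<kappa> (\<lambda>y. f (x, y)))"
  using n f
proof (induction \<nu>)
  case (Cons p \<nu>)
  obtain M w where p: "p = (M, w)" by force
  have f': "sm_integrable (map (\<lambda>(K, v). (M \<Otimes>\<^sub>M K, \<lambda>(x, y). w x * v y)) \<kappa>) f" "sm_integrable (sm_tensor \<nu> \<kappa>) f"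
    using Cons.prems(2) by (auto simp: sm_integrable_def p)
  show ?case
    using Cons f' sm_integral_single_tensor[of M w \<kappa> f] k by (simp add: p)
qed simp

lemma sm_tv_tensor_finite:
  fixes \<nu> :: "'a::second_countable_topology signed_measure"
    and \<kappa> :: "'b::second_countable_topology signed_measure"
  assumes "borel_sm \<nu>" "borel_sm \<kappa>" "sm_tv \<nu> (\<lambda>_. 1) < \<infinity>" "sm_tv \<kappa> (\<lambda>_. 1) < \<infinity>"
  shows "sm_tv (sm_tensor \<nu> \<kappa>) (\<lambda>_. 1) < \<infinity>"
proof -
  have "sm_tv (sm_tensor \<nu> \<kappa>) (\<lambda>_. 1) = sm_tv \<nu> (\<lambda>_. sm_tv \<kappa> (\<lambda>_. 1) * 1)"
    using assms by (subst sm_tv_tensor) auto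
  also have "\<dots> = sm_tv \<kappa> (\<lambda>_. 1) * sm_tv \<nu> (\<lambda>_. 1)"
    by (rule sm_tv_cmult) (use assms in auto)
  finally show ?thesis using assms by (simp add: ennreal_mult_less_top)
qed

text \<open>Specialised to bounded functions, this is what turns the energy of a character into the square of a
Fourier transform.\<close>

lemma sm_integral_tensor_mult:
  fixes \<nu> :: "'a::second_countable_topology signed_measure"
    and \<kappa> :: "'b::second_countable_topology signed_measure"
    and f :: "'a \<Rightarrow> complex" and h :: "'b \<Rightarrow> complex"
  assumes "borel_sm \<nu>" "borel_sm \<kappa>" "sm_tv \<nu> (\<lambda>_. 1) < \<infinity>" "sm_tv \<kappa> (\<lambda>_. 1) < \<infinity>"
    and [measurable]: "f \<in> borel_measurable borel" "h \<in> borel_measurable borel"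
    and "\<And>x. norm (f x) \<le> 1" "\<And>y. norm (h y) \<le> 1"
  shows "sm_integral (sm_tensor \<nu> \<kappa>) (\<lambda>(x, y). f x * h y) = sm_integral \<nu> f * sm_integral \<kappa> h"
proof -
  have "(\<lambda>(x, y). f x * h y) \<in> borel_measurable (borel \<Otimes>\<^sub>M borel)" by measurable
  then have m: "(\<lambda>(x, y). f x * h y) \<in> borel_measurable borel" by (simp add: borel_prod)
  have "sm_integrable (sm_tensor \<nu> \<kappa>) (\<lambda>(x, y). f x * h y)"
    using assms by (intro sm_integrable_bounded[where B=1] borel_sm_tensor sm_tv_tensor_finite m)
                   (auto simp: norm_mult mult_le_one)
  from sm_integral_tensor[OF assms(1,2) this] show ?thesis
    by (simp add: sm_integral_mult_left sm_integral_mult_right)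
qed

section \<open>Energies of positive-definite kernels\<close>

lemma sigma_finite_return: "sigma_finite_measure (return borel x)"
  by (intro prob_space_imp_sigma_finite prob_space_return) simp

lemma borel_sm_fluctuation:
  "\<mu> \<in> borel_measurable borel \<Longrightarrow> borel_sm (fluctuation N X \<mu>)"
  by (auto simp: borel_sm_def fluctuation_def sigma_finite_return lborel.sigma_finite_measure_axioms)

lemma sm_tv_fluctuation:
  assumes h: "h \<in> borel_measurable borel"
  shows "sm_tv (fluctuation N X \<mu>) h
    = ennreal (1 / real N) * (\<Sum>i<N. h (X i)) + (\<integral>\<^sup>+x. ennreal \<bar>\<mu> x\<bar> * h x \<partial>lborel)"
proof -
  have "(\<integral>\<^sup>+x. ennreal \<bar>1 / real N\<bar> * h x \<partial>return borel (X i)) = ennreal (1 / real N) * h (X i)" for i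
    using h by (subst nn_integral_return) auto
  then show ?thesis
    by (simp add: fluctuation_def sm_tv_def o_def interv_sum_list_conv_sum_set_nat sum_distrib_left
          atLeast0LessThan)
qed

lemma sm_integral_fluctuation:
  fixes f :: "'a::euclidean_space \<Rightarrow> 'b::{banach, second_countable_topology}"
  assumes f: "f \<in> borel_measurable borel"
  shows "sm_integral (fluctuation N X \<mu>) f
    = (1 / real N) *\<^sub>R (\<Sum>i<N. f (X i)) - (LINT x|lborel. \<mu> x *\<^sub>R f x)"
proof -
  have "(LINT x|return borel (X i). f x) = f (X i)" for i
    using f by (subst integral_return) auto
  then show ?thesis
    by (simp add: fluctuation_def sm_integral_def o_def interv_sum_list_conv_sum_set_nat
        scaleR_sum_right atLeast0LessThan)
qed

lemma sm_integral_cnj: "sm_integral \<nu> (\<lambda>x. cnj (f x)) = cnj (sm_integral \<nu> f)"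
proof (induction \<nu>)
  case (Cons p \<nu>)
  obtain M w where p: "p = (M, w)" by force
  have "(LINT x|M. w x *\<^sub>R cnj (f x)) = (LINT x|M. cnj (w x *\<^sub>R f x))"
    by (rule Bochner_Integration.integral_cong) (simp_all add: scaleR_conv_of_real)
  also have "\<dots> = cnj (LINT x|M. w x *\<^sub>R f x)" by (rule Bochner_Integration.integral_cnj)
  finally have "(LINT x|M. w x *\<^sub>R cnj (f x)) = cnj (LINT x|M. w x *\<^sub>R f x)" .
  with Cons show ?case by (simp add: p)
qed simp

lemma continuous_cis [continuous_intros]:
  "continuous_on S f \<Longrightarrow> continuous_on S (\<lambda>x. cis (f x))"
  by (simp add: cis_conv_exp) (intro continuous_intros)

lemma cis_measurable [measurable]: "cis \<in> borel_measurable borel"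
  by (intro borel_measurable_continuous_onI continuous_cis continuous_on_id)

text \<open>The character of a difference is a product of two conjugate characters.\<close>

lemma borel_sm_tensor_char:
  fixes \<nu> :: "'a::euclidean_space signed_measure"
  assumes \<nu>: "borel_sm \<nu>" "sm_tv \<nu> (\<lambda>_. 1) < \<infinity>"
  shows "sm_integral (sm_tensor \<nu> \<nu>) (\<lambda>(x, y). cis (2 * pi * (\<xi> \<bullet> (x - y))))
    = of_real ((cmod (sm_fourier \<nu> \<xi>))\<^sup>2)"
proof -
  have e: "cis (2 * pi * (\<xi> \<bullet> (x - y))) = cnj (cis (- 2 * pi * (\<xi> \<bullet> x))) * cis (- 2 * pi * (\<xi> \<bullet> y))" for x y
    by (simp add: cis_cnj cis_mult inner_diff_right algebra_simps)
  have m: "(\<lambda>x. cis (- 2 * pi * (\<xi> \<bullet> x))) \<in> borel_measurable borel"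
    by (intro borel_measurable_continuous_onI continuous_intros)
  have m': "(\<lambda>x. cnj (cis (- 2 * pi * (\<xi> \<bullet> x)))) \<in> borel_measurable borel"
    by (intro borel_measurable_continuous_onI continuous_intros)
  have "sm_integral (sm_tensor \<nu> \<nu>) (\<lambda>(x, y). cis (2 * pi * (\<xi> \<bullet> (x - y))))
      = cnj (sm_fourier \<nu> \<xi>) * sm_fourier \<nu> \<xi>"
    unfolding e sm_fourier_def
    by (subst sm_integral_tensor_mult[OF \<nu>(1,1,2,2) m' m]) (auto simp: sm_integral_cnj)
  also have "\<dots> = of_real ((cmod (sm_fourier \<nu> \<xi>))\<^sup>2)"
    by (simp add: complex_norm_square mult.commute flip: of_real_power)
  finally show ?thesis .
qed

lemma fourier_measurable [measurable]:
  assumes [measurable]: "f \<in> borel_measurable borel"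
  shows "fourier f \<in> borel_measurable borel"
proof -
  have "(\<lambda>(\<xi>, x). cis (- 2 * pi * (\<xi> \<bullet> x))) \<in> borel_measurable (borel \<Otimes>\<^sub>M (borel :: 'a measure))"
    unfolding borel_prod split_beta'
    by (intro borel_measurable_continuous_onI continuous_intros)
  then have [measurable]: "(\<lambda>(\<xi>, x). cis (- 2 * pi * (\<xi> \<bullet> x))) \<in> borel_measurable (borel \<Otimes>\<^sub>M (lborel :: 'a measure))"
    by simp
  show ?thesis unfolding fourier_def[abs_def] by measurable
qed

lemma sm_fourier_measurable:
  fixes \<nu> :: "'a::euclidean_space signed_measure"
  assumes "borel_sm \<nu>"
  shows "sm_fourier \<nu> \<in> borel_measurable borel"
  using assms
proof (induction \<nu>)
  case (Cons p \<nu>)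
  obtain M w where p: "p = (M, w)" by force
  have M: "sigma_finite_measure M" "sets M = sets borel" and w: "w \<in> borel_measurable borel"
    using Cons.prems by (auto simp: p)
  interpret sigma_finite_measure M by fact
  note [measurable] = measurable_borel_sets[OF M(2) w]
  have "(\<lambda>z. cis (- 2 * pi * (fst z \<bullet> snd z))) \<in> borel_measurable (borel :: ('a \<times> 'a) measure)"
    by (intro borel_measurable_continuous_onI continuous_intros)
  from measurable_tensor_entry[OF this refl M(2)]
  have [measurable]: "(\<lambda>(\<xi>, x). cis (- 2 * pi * (\<xi> \<bullet> x))) \<in> borel_measurable (borel \<Otimes>\<^sub>M M)"
    by (simp add: split_beta')
  have "(\<lambda>\<xi>. LINT x|M. w x *\<^sub>R cis (- 2 * pi * (\<xi> \<bullet> x))) \<in> borel_measurable borel" by measurable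
  with Cons show ?case by (simp add: p sm_fourier_def[abs_def])
qed (simp add: sm_fourier_def[abs_def])

lemma norm_fourier_le:
  "norm (fourier f \<xi>) \<le> (LINT x|lborel. \<bar>f x\<bar>)"
  unfolding fourier_def by (rule order_trans[OF integral_norm_bound]) simp

text \<open>The convolution of \<open>\<phi>\<close> with a Gaussian of total mass one concentrated at distance about \<open>sqrt a\<close> from
the origin, in the variable in which the Gaussian does not depend on \<open>a\<close>.\<close>

definition mollified :: "real \<Rightarrow> ('a::euclidean_space \<Rightarrow> real) \<Rightarrow> 'a \<Rightarrow> real" where
  "mollified a \<phi> z = (LINT w|lborel. exp (- pi * (norm w)\<^sup>2) * \<phi> (z - sqrt a *\<^sub>R w))"

lemma gaussian_integral:
  assumes "a > 0"
  shows "has_bochner_integral lborel (\<lambda>x::'a::euclidean_space. exp (- pi * a * (norm x)\<^sup>2)) (1 / sqrt a ^ DIM('a))"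
proof -
  have "has_bochner_integral lborel (\<lambda>x::'a. of_real (exp (- pi * a * (norm x)\<^sup>2)))
      (of_real (1 / sqrt a ^ DIM('a)) :: complex)"
    using gaussian_fourier[OF assms, of "0::'a"] by (simp add: scaleR_conv_of_real)
  from has_bochner_integral_Re[OF this] show ?thesis by simp
qed

text \<open>For a mollified function, Fourier inversion is an interchange of integrals: the Gaussian factor makes
the double integral over frequency and space absolutely convergent.\<close>

lemma mollified_eq_inverse_fourier:
  fixes \<phi> :: "'a::euclidean_space \<Rightarrow> real"
  assumes a: "a > 0" and \<phi>: "integrable lborel \<phi>"
  shows "of_real (mollified a \<phi> z)
    = (LINT \<xi>|lborel. fourier \<phi> \<xi> * (exp (- pi * a * (norm \<xi>)\<^sup>2) *\<^sub>R cis (2 * pi * (\<xi> \<bullet> z))))"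
proof -
  have [measurable]: "\<phi> \<in> borel_measurable borel" using \<phi> by auto
  let ?G = "\<lambda>\<xi>. exp (- pi * a * (norm \<xi>)\<^sup>2) *\<^sub>R cis (2 * pi * (\<xi> \<bullet> z))"
  let ?F = "\<lambda>\<xi> v. (\<phi> v *\<^sub>R cis (- 2 * pi * (\<xi> \<bullet> v))) * ?G \<xi>"
  have mc: "(\<lambda>(\<xi>, x). cis (- 2 * pi * (\<xi> \<bullet> x))) \<in> borel_measurable (borel \<Otimes>\<^sub>M (borel :: 'a measure))"
    unfolding borel_prod split_beta'
    by (intro borel_measurable_continuous_onI continuous_intros)
  then have [measurable]: "(\<lambda>(\<xi>, x). cis (- 2 * pi * (\<xi> \<bullet> x))) \<in> borel_measurable (lborel \<Otimes>\<^sub>M (lborel :: 'a measure))"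
    by simp
  have G[measurable]: "?G \<in> borel_measurable borel"
    by (intro borel_measurable_continuous_onI continuous_intros)
  have int: "integrable (lborel \<Otimes>\<^sub>M lborel) (\<lambda>(\<xi>, v). ?F \<xi> v)"
  proof (rule Bochner_Integration.integrable_bound)
    show "integrable (lborel \<Otimes>\<^sub>M lborel) (\<lambda>(\<xi>::'a, v). exp (- pi * a * (norm \<xi>)\<^sup>2) * \<phi> v)"
      using gaussian_integral[OF a, where 'a='a] \<phi>
      by (intro lborel_pair.Fubini_integrable) (auto simp: has_bochner_integral_iff abs_mult)
    show "(\<lambda>(\<xi>, v). ?F \<xi> v) \<in> borel_measurable (lborel \<Otimes>\<^sub>M lborel)" by measurable
  qed (auto simp: norm_mult)
  have "(LINT \<xi>|lborel. fourier \<phi> \<xi> * ?G \<xi>) = (LINT \<xi>|lborel. LINT v|lborel. ?F \<xi> v)"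
    unfolding fourier_def integral_mult_left_zero ..
  also have "\<dots> = (LINT v|lborel. LINT \<xi>|lborel. ?F \<xi> v)"
    by (rule lborel_pair.Fubini_integral[OF int, symmetric])
  also have "\<dots> = (LINT v|lborel. of_real (\<phi> v * (exp (- pi * (norm (z - v))\<^sup>2 / a) / sqrt a ^ DIM('a))))"
  proof (intro Bochner_Integration.integral_cong refl)
    fix v
    have "?F \<xi> v = of_real (\<phi> v) * (exp (- pi * a * (norm \<xi>)\<^sup>2) *\<^sub>R cis (2 * pi * ((z - v) \<bullet> \<xi>)))" for \<xi>
    proof -
      have "cis (- 2 * pi * (\<xi> \<bullet> v)) * cis (2 * pi * (\<xi> \<bullet> z)) = cis (2 * pi * ((z - v) \<bullet> \<xi>))"
        by (simp add: cis_mult inner_diff_left inner_commute algebra_simps)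
      then show ?thesis by (simp add: scaleR_conv_of_real mult_ac)
    qed
    then have "(LINT \<xi>|lborel. ?F \<xi> v)
        = of_real (\<phi> v) * (LINT \<xi>|lborel. exp (- pi * a * (norm \<xi>)\<^sup>2) *\<^sub>R cis (2 * pi * ((z - v) \<bullet> \<xi>)))"
      by (simp only: integral_mult_right_zero)
    then show "(LINT \<xi>|lborel. ?F \<xi> v) = of_real (\<phi> v * (exp (- pi * (norm (z - v))\<^sup>2 / a) / sqrt a ^ DIM('a)))"
      using has_bochner_integral_integral_eq[OF gaussian_fourier[OF a, of "z - v"]] by (simp only: of_real_mult)
  qed
  also have "\<dots> = of_real (LINT v|lborel. \<phi> v * (exp (- pi * (norm (z - v))\<^sup>2 / a) / sqrt a ^ DIM('a)))"
    by (rule integral_complex_of_real)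
  also have "(LINT v|lborel. \<phi> v * (exp (- pi * (norm (z - v))\<^sup>2 / a) / sqrt a ^ DIM('a)))
    = \<bar>- sqrt a\<bar> ^ DIM('a) *\<^sub>R (LINT w|lborel. \<phi> (z + (- sqrt a) *\<^sub>R w) *
        (exp (- pi * (norm (z - (z + (- sqrt a) *\<^sub>R w)))\<^sup>2 / a) / sqrt a ^ DIM('a)))"
    using a by (intro lborel_integral_affine) auto
  also have "\<dots> = (LINT w|lborel. \<bar>- sqrt a\<bar> ^ DIM('a) *\<^sub>R (\<phi> (z + (- sqrt a) *\<^sub>R w) *
        (exp (- pi * (norm (z - (z + (- sqrt a) *\<^sub>R w)))\<^sup>2 / a) / sqrt a ^ DIM('a))))"
    by (rule integral_scaleR_right[symmetric])
  also have "\<dots> = mollified a \<phi> z"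
    unfolding mollified_def using a
    by (intro Bochner_Integration.integral_cong refl) (simp add: power_mult_distrib field_simps)
  finally show ?thesis ..
qed

lemma mollified_bounded:
  fixes \<phi> :: "'a::euclidean_space \<Rightarrow> real"
  assumes [measurable]: "\<phi> \<in> borel_measurable borel" and B: "\<And>x. \<bar>\<phi> x\<bar> \<le> B"
  shows "\<bar>mollified a \<phi> z\<bar> \<le> B"
proof -
  have g: "has_bochner_integral lborel (\<lambda>x::'a. exp (- pi * (norm x)\<^sup>2)) 1"
    using gaussian_integral[of 1, where 'a='a] by simp
  have int: "integrable lborel (\<lambda>w::'a. exp (- pi * (norm w)\<^sup>2) * B)"
    using g by (simp add: has_bochner_integral_iff)
  have "norm (mollified a \<phi> z) \<le> (LINT w::'a|lborel. exp (- pi * (norm w)\<^sup>2) * B)"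
    unfolding mollified_def
    by (rule Bochner_Integration.integral_norm_bound_integral[OF Bochner_Integration.integrable_bound[OF int] int])
       (auto simp: abs_mult intro!: mult_mono B intro: order_trans[OF B abs_ge_self])
  then show ?thesis using g by (simp add: has_bochner_integral_iff)
qed

lemma mollified_tendsto:
  fixes \<phi> :: "'a::euclidean_space \<Rightarrow> real"
  assumes c: "continuous_on UNIV \<phi>" and B: "\<And>x. \<bar>\<phi> x\<bar> \<le> B" and a: "a \<longlonglongrightarrow> 0"
  shows "(\<lambda>n. mollified (a n) \<phi> z) \<longlonglongrightarrow> \<phi> z"
proof -
  have [measurable]: "\<phi> \<in> borel_measurable borel" using c by (rule borel_measurable_continuous_onI)
  have g: "has_bochner_integral lborel (\<lambda>x::'a. exp (- pi * (norm x)\<^sup>2)) 1"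
    using gaussian_integral[of 1, where 'a='a] by simp
  have "(\<lambda>n. LINT w|lborel. exp (- pi * (norm w)\<^sup>2) * \<phi> (z - sqrt (a n) *\<^sub>R w))
    \<longlonglongrightarrow> (LINT w::'a|lborel. exp (- pi * (norm w)\<^sup>2) * \<phi> z)"
  proof (rule integral_dominated_convergence[where w="\<lambda>w. exp (- pi * (norm w)\<^sup>2) * B"])
    show "integrable lborel (\<lambda>w::'a. exp (- pi * (norm w)\<^sup>2) * B)"
      using g by (simp add: has_bochner_integral_iff)
    have "(\<lambda>n. \<phi> (z - sqrt (a n) *\<^sub>R w)) \<longlonglongrightarrow> \<phi> z" for w
    proof (rule continuous_on_tendsto_compose[OF c])
      have "(\<lambda>n. z - sqrt (a n) *\<^sub>R w) \<longlonglongrightarrow> z - sqrt 0 *\<^sub>R w" by (intro tendsto_intros a)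
      then show "(\<lambda>n. z - sqrt (a n) *\<^sub>R w) \<longlonglongrightarrow> z" by simp
    qed auto
    then show "AE w in lborel. (\<lambda>n. exp (- pi * (norm w)\<^sup>2) * \<phi> (z - sqrt (a n) *\<^sub>R w))
        \<longlonglongrightarrow> exp (- pi * (norm w)\<^sup>2) * \<phi> z"
      by (auto intro: tendsto_mult_left)
  qed (auto simp: abs_mult intro!: mult_left_mono B)
  then show ?thesis using g by (simp add: mollified_def has_bochner_integral_iff)
qed

lemma mollified_measurable:
  fixes \<phi> :: "'a::euclidean_space \<Rightarrow> real"
  assumes [measurable]: "\<phi> \<in> borel_measurable borel"
  shows "mollified a \<phi> \<in> borel_measurable borel"
  unfolding mollified_def[abs_def] by measurable

lemma borel_measurable_difference:
  fixes f :: "'a::euclidean_space \<Rightarrow> 'b::topological_space"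
  assumes "f \<in> borel_measurable borel"
  shows "(\<lambda>(x, y). f (x - y)) \<in> borel_measurable borel"
proof -
  have "(\<lambda>z. fst z - snd z) \<in> borel_measurable (borel :: ('a \<times> 'a) measure)"
    by (intro borel_measurable_continuous_onI continuous_intros)
  from measurable_compose[OF this assms] show ?thesis by (simp add: split_beta')
qed

text \<open>Plancherel's identity for the energy of the mollified kernel.\<close>

lemma mollified_energy:
  fixes \<phi> :: "'a::euclidean_space \<Rightarrow> real"
  assumes \<nu>: "borel_sm \<nu>" "sm_tv \<nu> (\<lambda>_. 1) < \<infinity>" and a: "a > 0" and \<phi>: "integrable lborel \<phi>"
  shows "has_bochner_integral lborel
      (\<lambda>\<xi>. Re (fourier \<phi> \<xi>) * exp (- pi * a * (norm \<xi>)\<^sup>2) * (cmod (sm_fourier \<nu> \<xi>))\<^sup>2)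
      (sm_integral (sm_tensor \<nu> \<nu>) (\<lambda>(x, y). mollified a \<phi> (x - y)))"
proof -
  have [measurable]: "\<phi> \<in> borel_measurable borel" using \<phi> by auto
  let ?\<kappa> = "sm_tensor \<nu> \<nu>"
  have \<kappa>: "borel_sm ?\<kappa>" "sm_tv ?\<kappa> (\<lambda>_. 1) < \<infinity>"
    by (rule borel_sm_tensor[OF \<nu>(1,1)]) (rule sm_tv_tensor_finite[OF \<nu>(1,1,2,2)])
  let ?F = "\<lambda>\<xi> (x, y). fourier \<phi> \<xi> * (exp (- pi * a * (norm \<xi>)\<^sup>2) *\<^sub>R cis (2 * pi * (\<xi> \<bullet> (x - y))))"
  have F: "(\<lambda>(\<xi>, z). ?F \<xi> z) \<in> borel_measurable borel"
  proof -
    have [measurable]: "fst \<in> borel_measurable (borel :: ('a \<times> 'a \<times> 'a) measure)"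
      by (intro borel_measurable_continuous_onI continuous_intros)
    have [measurable]: "(\<lambda>p. exp (- pi * a * (norm (fst p))\<^sup>2) *\<^sub>R cis (2 * pi * (fst p \<bullet> (fst (snd p) - snd (snd p)))))
        \<in> borel_measurable (borel :: ('a \<times> 'a \<times> 'a) measure)"
      by (intro borel_measurable_continuous_onI continuous_intros)
    have [measurable]: "(\<lambda>p. fourier \<phi> (fst p)) \<in> borel_measurable (borel :: ('a \<times> 'a \<times> 'a) measure)"
      by (rule measurable_compose[OF _ fourier_measurable]) measurable
    show ?thesis unfolding split_beta' by measurable
  qed
  let ?K = "(LINT x|lborel. \<bar>\<phi> x\<bar>) / sqrt a ^ DIM('a)"
  have K: "(\<integral>\<^sup>+\<xi>. ennreal (norm (?F \<xi> z)) \<partial>lborel) \<le> ennreal ?K" for z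
  proof -
    have "(\<integral>\<^sup>+\<xi>. ennreal (norm (?F \<xi> z)) \<partial>lborel)
      \<le> (\<integral>\<^sup>+\<xi>. ennreal ((LINT x|lborel. \<bar>\<phi> x\<bar>) * exp (- pi * a * (norm (\<xi>::'a))\<^sup>2)) \<partial>lborel)"
      by (intro nn_integral_mono ennreal_leI)
         (auto simp: norm_mult split_beta' intro!: mult_right_mono norm_fourier_le)
    also have "\<dots> = ennreal (LINT \<xi>|lborel. (LINT x|lborel. \<bar>\<phi> x\<bar>) * exp (- pi * a * (norm (\<xi>::'a))\<^sup>2))"
      using gaussian_integral[OF a, where 'a='a]
      by (intro nn_integral_eq_integral) (auto simp: has_bochner_integral_iff)
    also have "\<dots> = ennreal ?K"
      using gaussian_integral[OF a, where 'a='a] by (simp add: has_bochner_integral_iff)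
    finally show ?thesis .
  qed
  have fin: "sm_tv ?\<kappa> (\<lambda>z. \<integral>\<^sup>+\<xi>. ennreal (norm (?F \<xi> z)) \<partial>lborel) < \<infinity>"
  proof -
    have "sm_tv ?\<kappa> (\<lambda>z. \<integral>\<^sup>+\<xi>. ennreal (norm (?F \<xi> z)) \<partial>lborel) \<le> sm_tv ?\<kappa> (\<lambda>_. ennreal ?K * 1)"
      using K by (intro sm_tv_mono) simp
    also have "\<dots> < \<infinity>" using \<kappa> by (subst sm_tv_cmult) (auto simp: ennreal_mult_less_top)
    finally show ?thesis .
  qed
  have inner: "sm_integral ?\<kappa> (?F \<xi>)
      = fourier \<phi> \<xi> * of_real (exp (- pi * a * (norm \<xi>)\<^sup>2) * (cmod (sm_fourier \<nu> \<xi>))\<^sup>2)" for \<xi>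
  proof -
    have "?F \<xi> = (\<lambda>z. (fourier \<phi> \<xi> * of_real (exp (- pi * a * (norm \<xi>)\<^sup>2))) * (case z of (x, y) \<Rightarrow> cis (2 * pi * (\<xi> \<bullet> (x - y)))))"
      by (auto simp: scaleR_conv_of_real)
    then show ?thesis
      using borel_sm_tensor_char[OF \<nu>, of \<xi>] by (simp add: sm_integral_mult_left)
  qed
  have "complex_of_real (sm_integral ?\<kappa> (\<lambda>(x, y). mollified a \<phi> (x - y)))
      = sm_integral ?\<kappa> (\<lambda>z. LINT \<xi>|lborel. ?F \<xi> z)"
    by (simp add: mollified_eq_inverse_fourier[OF a \<phi>] split_beta' flip: sm_integral_of_real)
  also have "\<dots> = (LINT \<xi>|lborel. sm_integral ?\<kappa> (?F \<xi>))"
    by (rule sm_integral_Fubini[OF \<kappa>(1) F fin])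
  finally have "has_bochner_integral lborel (\<lambda>\<xi>. sm_integral ?\<kappa> (?F \<xi>))
      (complex_of_real (sm_integral ?\<kappa> (\<lambda>(x, y). mollified a \<phi> (x - y))))"
    using sm_integral_Fubini(2)[OF \<kappa>(1) F fin] by (simp add: has_bochner_integral_iff)
  from has_bochner_integral_Re[OF this] show ?thesis
    unfolding inner by (simp add: mult.assoc)
qed

text \<open>The identity for the mollified kernel passes to the limit on both sides: by dominated convergence in
space, because \<open>\<phi>\<close> is bounded and continuous, and by Fatou's lemma in frequency. The latter
loses the equality and shows at the same time that the left-hand side is finite.\<close>

theorem energy_ge_spectral:
  fixes \<phi> :: "'a::euclidean_space \<Rightarrow> real"
  assumes \<nu>: "borel_sm \<nu>" "sm_tv \<nu> (\<lambda>_. 1) < \<infinity>"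
    and c: "continuous_on UNIV \<phi>" and B: "\<And>x. \<bar>\<phi> x\<bar> \<le> B" and \<phi>: "integrable lborel \<phi>"
    and m[measurable]: "m \<in> borel_measurable borel" and m0: "\<And>\<xi>. 0 \<le> m \<xi>" and m1: "\<And>\<xi>. m \<xi> \<le> Re (fourier \<phi> \<xi>)"
  shows "(\<integral>\<^sup>+\<xi>. ennreal (m \<xi> * (cmod (sm_fourier \<nu> \<xi>))\<^sup>2) \<partial>lborel)
      \<le> ennreal (sm_integral (sm_tensor \<nu> \<nu>) (\<lambda>(x, y). \<phi> (x - y)))" (is "?L \<le> ennreal ?R")
    and "0 \<le> sm_integral (sm_tensor \<nu> \<nu>) (\<lambda>(x, y). \<phi> (x - y))"
proof -
  have [measurable]: "\<phi> \<in> borel_measurable borel" using c by (rule borel_measurable_continuous_onI)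
  let ?\<kappa> = "sm_tensor \<nu> \<nu>"
  have \<kappa>: "borel_sm ?\<kappa>" "sm_tv ?\<kappa> (\<lambda>_. 1) < \<infinity>"
    by (rule borel_sm_tensor[OF \<nu>(1,1)]) (rule sm_tv_tensor_finite[OF \<nu>(1,1,2,2)])
  \<comment> \<open>any sequence of positive widths that tends to zero\<close>
  define a where "a n = 1 / real (Suc n)" for n
  have a: "a n > 0" for n by (simp add: a_def)
  have a0: "a \<longlonglongrightarrow> 0" unfolding a_def by (rule LIMSEQ_Suc[OF lim_1_over_n])
  define I where "I n = sm_integral ?\<kappa> (\<lambda>(x, y). mollified (a n) \<phi> (x - y))" for n
  let ?f = "\<lambda>n \<xi>. Re (fourier \<phi> \<xi>) * exp (- pi * a n * (norm \<xi>)\<^sup>2) * (cmod (sm_fourier \<nu> \<xi>))\<^sup>2"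
  have I: "has_bochner_integral lborel (?f n) (I n)" for n
    unfolding I_def by (rule mollified_energy[OF \<nu> a \<phi>])
  have f0: "0 \<le> ?f n \<xi>" for n \<xi>
    using m0[of \<xi>] m1[of \<xi>] by simp
  have I0: "0 \<le> I n" for n
    using Bochner_Integration.integral_nonneg[of lborel "?f n", OF f0] I[of n]
    by (simp only: has_bochner_integral_iff)
  have lim: "I \<longlonglongrightarrow> ?R"
    unfolding I_def
  proof (rule sm_integral_dominated_convergence[where h="\<lambda>_. B"])
    show "sm_integrable ?\<kappa> (\<lambda>_. B)" by (rule sm_integrable_bounded[OF \<kappa>, where B="\<bar>B\<bar>"]) auto
    show "(\<lambda>n. case z of (x, y) \<Rightarrow> mollified (a n) \<phi> (x - y)) \<longlonglongrightarrow> (case z of (x, y) \<Rightarrow> \<phi> (x - y))" for z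
      using mollified_tendsto[OF c B a0] by (auto simp: split_beta')
    show "norm (case z of (x, y) \<Rightarrow> mollified (a n) \<phi> (x - y)) \<le> B" for n z
      using mollified_bounded[of \<phi> B] B by (auto simp: split_beta')
  qed (auto intro!: \<kappa> borel_measurable_difference mollified_measurable)
  show "0 \<le> ?R" using LIMSEQ_le_const[OF lim] I0 by auto
  note [measurable] = sm_fourier_measurable[OF \<nu>(1)]
  have "?L = (\<integral>\<^sup>+\<xi>. liminf (\<lambda>n. ennreal (m \<xi> * exp (- pi * a n * (norm \<xi>)\<^sup>2) * (cmod (sm_fourier \<nu> \<xi>))\<^sup>2)) \<partial>lborel)"
  proof (intro nn_integral_cong)
    fix \<xi>
    have "(\<lambda>n. m \<xi> * exp (- pi * a n * (norm \<xi>)\<^sup>2) * (cmod (sm_fourier \<nu> \<xi>))\<^sup>2)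
        \<longlonglongrightarrow> m \<xi> * exp (- pi * 0 * (norm \<xi>)\<^sup>2) * (cmod (sm_fourier \<nu> \<xi>))\<^sup>2"
      by (intro tendsto_intros a0)
    then have "(\<lambda>n. ennreal (m \<xi> * exp (- pi * a n * (norm \<xi>)\<^sup>2) * (cmod (sm_fourier \<nu> \<xi>))\<^sup>2))
        \<longlonglongrightarrow> ennreal (m \<xi> * (cmod (sm_fourier \<nu> \<xi>))\<^sup>2)"
      by (intro tendsto_ennrealI) simp
    then show "ennreal (m \<xi> * (cmod (sm_fourier \<nu> \<xi>))\<^sup>2)
        = liminf (\<lambda>n. ennreal (m \<xi> * exp (- pi * a n * (norm \<xi>)\<^sup>2) * (cmod (sm_fourier \<nu> \<xi>))\<^sup>2))"
      by (simp add: lim_imp_Liminf)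
  qed
  also have "\<dots> \<le> liminf (\<lambda>n. \<integral>\<^sup>+\<xi>. ennreal (m \<xi> * exp (- pi * a n * (norm \<xi>)\<^sup>2) * (cmod (sm_fourier \<nu> \<xi>))\<^sup>2) \<partial>lborel)"
    by (intro nn_integral_liminf) measurable
  also have "\<dots> \<le> liminf (\<lambda>n. ennreal (I n))"
  proof (intro Liminf_mono always_eventually allI)
    fix n
    have "(\<integral>\<^sup>+\<xi>. ennreal (m \<xi> * exp (- pi * a n * (norm \<xi>)\<^sup>2) * (cmod (sm_fourier \<nu> \<xi>))\<^sup>2) \<partial>lborel)
        \<le> (\<integral>\<^sup>+\<xi>. ennreal (?f n \<xi>) \<partial>lborel)"
      by (intro nn_integral_mono ennreal_leI mult_right_mono m1) auto
    also have "\<dots> = ennreal (I n)"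
      using I[of n] f0[where n=n] by (subst nn_integral_eq_integral) (auto simp: has_bochner_integral_iff)
    finally show "(\<integral>\<^sup>+\<xi>. ennreal (m \<xi> * exp (- pi * a n * (norm \<xi>)\<^sup>2) * (cmod (sm_fourier \<nu> \<xi>))\<^sup>2) \<partial>lborel) \<le> ennreal (I n)" .
  qed
  also have "\<dots> = ennreal ?R" using lim by (intro lim_imp_Liminf tendsto_ennrealI) auto
  finally show "?L \<le> ennreal ?R" .
qed

section \<open>Energies with the diagonal removed\<close>

lemma dilate_fourier:
  fixes \<phi> :: "'a::euclidean_space \<Rightarrow> real"
  assumes t: "t > 0" and m: "\<phi> \<in> borel_measurable borel"
  shows "fourier (dilate t \<phi>) \<xi> = fourier \<phi> (t *\<^sub>R \<xi>)"
proof -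
  let ?f = "\<lambda>x. dilate t \<phi> x *\<^sub>R cis (- 2 * pi * (\<xi> \<bullet> x))"
  have [measurable]: "(\<lambda>x. cis (- 2 * pi * (\<xi> \<bullet> x))) \<in> borel_measurable borel"
    by (intro borel_measurable_continuous_onI continuous_intros)
  have "integral\<^sup>L lborel ?f = \<bar>t\<bar> ^ DIM('a) *\<^sub>R (LINT x|lborel. ?f (0 + t *\<^sub>R x))"
    using t m by (intro lborel_integral_affine) (auto simp: dilate_def)
  also have "\<dots> = (LINT x|lborel. \<bar>t\<bar> ^ DIM('a) *\<^sub>R ?f (0 + t *\<^sub>R x))"
    by (rule integral_scaleR_right[symmetric])
  also have "\<dots> = fourier \<phi> (t *\<^sub>R \<xi>)"
    unfolding fourier_def
    by (intro Bochner_Integration.integral_cong refl) (use t in \<open>simp add: dilate_def\<close>)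
  finally show ?thesis by (simp add: fourier_def)
qed

lemma dilate_integrable:
  fixes \<phi> :: "'a::euclidean_space \<Rightarrow> real"
  assumes t: "t > 0" and m: "integrable lborel \<phi>"
  shows "integrable lborel (dilate t \<phi>)"
  using lborel_integrable_affine[of "1 / t" \<phi> 0] assms
  by (simp add: dilate_def[abs_def] divide_inverse)

lemma dilate_continuous:
  fixes \<phi> :: "'a::euclidean_space \<Rightarrow> real"
  assumes t: "t > 0" and c: "continuous_on UNIV \<phi>"
  shows "continuous_on UNIV (dilate t \<phi>)"
  unfolding dilate_def[abs_def]
  by (intro continuous_on_divide continuous_on_compose2[OF c] continuous_intros) (use t in auto)

text \<open>The interaction \<open>h (x - y)\<close> with self-interactions removed, as in the modulated energy.\<close>

definition offdiag :: "('a::euclidean_space \<Rightarrow> real) \<Rightarrow> 'a \<times> 'a \<Rightarrow> real" where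
  "offdiag h = (\<lambda>(x, y). if x = y then 0 else h (x - y))"

lemma diagonal_borel: "{z :: 'a \<times> 'a :: t2_space. fst z = snd z} \<in> sets borel"
  by (intro borel_closed closed_Collect_eq continuous_intros)

lemma offdiag_measurable:
  fixes h :: "'a::euclidean_space \<Rightarrow> real"
  assumes "h \<in> borel_measurable borel"
  shows "offdiag h \<in> borel_measurable borel"
proof -
  have "Measurable.pred borel (\<lambda>z::'a \<times> 'a. fst z = snd z)"
    using diagonal_borel[where 'a='a] by (simp add: pred_def)
  moreover have "(\<lambda>z. h (fst z - snd z)) \<in> borel_measurable borel"
    using borel_measurable_difference[OF assms] by (simp add: split_beta')
  ultimately show ?thesis
    by (simp add: offdiag_def split_beta')
qed

locale point_configuration =
  fixes N :: nat and X :: "nat \<Rightarrow> 'a::euclidean_space" and \<mu> :: "'a \<Rightarrow> real"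
  assumes N: "N \<ge> 1" and X: "inj_on X {..<N}" and \<mu>: "integrable lborel \<mu>"
    and mass: "(LINT x|lborel. \<mu> x) = 1"
begin

abbreviation \<nu> :: "'a signed_measure" where "\<nu> \<equiv> fluctuation N X \<mu>"
abbreviation \<kappa> :: "('a \<times> 'a) signed_measure" where "\<kappa> \<equiv> sm_tensor \<nu> \<nu>"

lemma \<mu>_measurable [measurable]: "\<mu> \<in> borel_measurable borel"
  using \<mu> by auto

lemma \<nu>_borel: "borel_sm \<nu>" by (rule borel_sm_fluctuation) measurable

lemma \<mu>_norm_finite: "(\<integral>\<^sup>+x. ennreal \<bar>\<mu> x\<bar> \<partial>lborel) < \<infinity>"
  using \<mu> by (auto simp: integrable_iff_bounded)

lemma \<nu>_finite: "sm_tv \<nu> (\<lambda>_. 1) < \<infinity>"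
  using \<mu>_norm_finite by (subst sm_tv_fluctuation) (auto simp: ennreal_mult_less_top of_nat_less_top)

lemma \<kappa>_borel: "borel_sm \<kappa>" by (rule borel_sm_tensor[OF \<nu>_borel \<nu>_borel])

lemma \<kappa>_finite: "sm_tv \<kappa> (\<lambda>_. 1) < \<infinity>"
  by (rule sm_tv_tensor_finite[OF \<nu>_borel \<nu>_borel \<nu>_finite \<nu>_finite])

lemma total_mass: "sm_integral \<kappa> (\<lambda>_. 1::real) = 0"
proof -
  have 1: "sm_integral \<nu> (\<lambda>_. c) = 0" for c :: real
    using N mass by (subst sm_integral_fluctuation) auto
  have "sm_integrable \<kappa> (\<lambda>_. 1::real)"
    by (rule sm_integrable_bounded[OF \<kappa>_borel \<kappa>_finite]) auto
  from sm_integral_tensor[OF \<nu>_borel \<nu>_borel this] show ?thesis by (simp add: 1)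
qed

lemma integral_point_zero: "(LINT x|lborel. f x * of_bool ((a::'a) = x)) = (0::real)"
proof -
  have "AE x in lborel. f x * of_bool (a = x) = 0"
    using AE_lborel_singleton[of a] by eventually_elim auto
  then show ?thesis by (rule integral_eq_zero_AE)
qed

text \<open>Lebesgue measure does not charge points, so only pairs of point masses meet the diagonal. As the points
are distinct, these are \<open>N\<close> pairs of weight \<open>1 / N\<^sup>2\<close>.\<close>

lemma diagonal_mass: "sm_integral \<kappa> (\<lambda>(x, y). of_bool (x = y)) = 1 / real N"
proof -
  have [measurable]: "Measurable.pred borel (\<lambda>z::'a \<times> 'a. fst z = snd z)"
    using diagonal_borel[where 'a='a] by (simp add: pred_def)
  have 0: "(\<lambda>z. of_bool (fst z = snd z) :: real) \<in> borel_measurable (borel :: ('a \<times> 'a) measure)"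
    by measurable
  have [measurable]: "(\<lambda>y. of_bool (x = y)) \<in> borel_measurable (borel :: 'a measure)" for x
    by measurable
  have "sm_integrable \<kappa> (\<lambda>(x, y). of_bool (x = y) :: real)"
    by (rule sm_integrable_bounded[OF \<kappa>_borel \<kappa>_finite, where B=1]) (use 0 in \<open>auto simp: split_beta'\<close>)
  then have "sm_integral \<kappa> (\<lambda>(x, y). of_bool (x = y))
      = sm_integral \<nu> (\<lambda>x. sm_integral \<nu> (\<lambda>y. of_bool (x = y) :: real))"
    by (simp add: sm_integral_tensor[OF \<nu>_borel \<nu>_borel])
  also have "(\<lambda>x. sm_integral \<nu> (\<lambda>y. of_bool (x = y) :: real)) = (\<lambda>x. (\<Sum>j<N. of_bool (x = X j)) / real N)"
    using integral_point_zero[of \<mu>] by (subst sm_integral_fluctuation) auto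
  also have "sm_integral \<nu> (\<lambda>x. (\<Sum>j<N. of_bool (x = X j)) / real N)
      = (\<Sum>i<N. \<Sum>j<N. of_bool (X i = X j)) / real N / real N - (LINT x|lborel. \<mu> x * ((\<Sum>j<N. of_bool (x = X j)) / real N))"
    by (subst sm_integral_fluctuation) (auto simp: sum_divide_distrib)
  also have "(LINT x|lborel. \<mu> x * ((\<Sum>j<N. of_bool (x = X j)) / real N)) = 0"
  proof (rule integral_eq_zero_AE)
    have "AE x in lborel. \<forall>j\<in>{..<N}. x \<noteq> X j"
      by (intro AE_finite_allI) (auto intro: AE_lborel_singleton)
    then show "AE x in lborel. \<mu> x * ((\<Sum>j<N. of_bool (x = X j)) / real N) = 0"
      by eventually_elim auto
  qed
  also have "(\<Sum>i<N. \<Sum>j<N. of_bool (X i = X j) :: real) = (\<Sum>i<N. \<Sum>j<N. of_bool (i = j))"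
    using X by (intro sum.cong refl) (auto simp: inj_on_def)
  also have "\<dots> = real N" by (simp add: of_bool_def)
  finally show ?thesis using N by simp
qed

text \<open>Removing the diagonal from the energy of a bounded kernel costs the mass of the diagonal times the
value at the origin.\<close>

lemma offdiag_bounded:
  assumes m: "h \<in> borel_measurable borel" and B: "\<And>x. \<bar>h x\<bar> \<le> B"
  shows "sm_integrable \<kappa> (\<lambda>(x, y). h (x - y))" "sm_integrable \<kappa> (offdiag h)"
    and "sm_integral \<kappa> (offdiag h) = sm_integral \<kappa> (\<lambda>(x, y). h (x - y)) - h 0 / real N"
proof -
  have 0: "0 \<le> B" using B[of 0] by simp
  show 1: "sm_integrable \<kappa> (\<lambda>(x, y). h (x - y))"
    by (rule sm_integrable_bounded[OF \<kappa>_borel \<kappa>_finite borel_measurable_difference[OF m], where B=B])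
       (use B in auto)
  show 2: "sm_integrable \<kappa> (offdiag h)"
    by (rule sm_integrable_bounded[OF \<kappa>_borel \<kappa>_finite offdiag_measurable[OF m], where B=B])
       (use B 0 in \<open>auto simp: offdiag_def\<close>)
  have "sm_integral \<kappa> (\<lambda>z. (case z of (x, y) \<Rightarrow> h (x - y)) - offdiag h z)
      = sm_integral \<kappa> (\<lambda>z. h 0 *\<^sub>R (case z of (x, y) \<Rightarrow> of_bool (x = y)))"
    by (rule arg_cong[where f="sm_integral \<kappa>"]) (auto simp: offdiag_def fun_eq_iff)
  also have "\<dots> = h 0 / real N" by (subst sm_integral_scaleR) (simp add: diagonal_mass)
  finally show "sm_integral \<kappa> (offdiag h) = sm_integral \<kappa> (\<lambda>(x, y). h (x - y)) - h 0 / real N"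
    using sm_integral_diff[OF \<kappa>_borel 1 2] by simp
qed

text \<open>The total mass zero of \<open>\<nu> \<otimes> \<nu>\<close> is the sum of \<open>1 / N\<close> on the diagonal and \<open>- 1 / N\<close> off it.\<close>

lemma offdiag_one: "sm_integral \<kappa> (offdiag (\<lambda>_. 1)) = - 1 / real N"
  using offdiag_bounded(3)[of "\<lambda>_. 1" 1] total_mass by (simp add: case_prod_unfold)

text \<open>Expanding the energy gives a point-point term, two equal mixed terms and a background term. The first is
nonnegative because \<open>h\<close> is, the last one because \<open>h\<close> is positive definite.\<close>

lemma offdiag_ge_cross_terms:
  assumes c: "continuous_on UNIV h" and B: "\<And>x. h x \<le> B" and h0: "\<And>x. 0 \<le> h x" and h: "integrable lborel h"
    and even: "\<And>x. h (- x) = h x" and pd: "\<And>\<xi>. 0 \<le> Re (fourier h \<xi>)"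
  shows "sm_integral \<kappa> (offdiag h) \<ge> - 2 / real N * (\<Sum>i<N. LINT y|lborel. \<mu> y * h (X i - y))"
proof -
  have hm[measurable]: "h \<in> borel_measurable borel" using h by auto
  have aB: "\<bar>h x\<bar> \<le> B" for x using B[of x] h0[of x] by simp
  note off = offdiag_bounded[OF hm aB]
  define V where "V x = (LINT y|lborel. \<mu> y * h (x - y))" for x
  have Vm[measurable]: "V \<in> borel_measurable borel" unfolding V_def[abs_def] by measurable
  have Vb: "\<bar>V x\<bar> \<le> (LINT y|lborel. \<bar>\<mu> y\<bar>) * B" for x
  proof -
    have i: "integrable lborel (\<lambda>y. \<bar>\<mu> y\<bar> * B)" using \<mu> by auto
    have "norm (V x) \<le> (LINT y|lborel. \<bar>\<mu> y\<bar> * B)"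
      unfolding V_def
      by (rule Bochner_Integration.integral_norm_bound_integral[OF Bochner_Integration.integrable_bound[OF i] i])
         (auto simp: abs_mult intro!: mult_mono aB intro: order_trans[OF aB abs_ge_self])
    then show ?thesis by simp
  qed
  have Vi: "integrable lborel (\<lambda>x. \<mu> x * V x)"
  proof (rule Bochner_Integration.integrable_bound)
    show "integrable lborel (\<lambda>x. \<mu> x * ((LINT y|lborel. \<bar>\<mu> y\<bar>) * B))" using \<mu> by auto
    have "\<bar>V x\<bar> \<le> \<bar>(LINT y|lborel. \<bar>\<mu> y\<bar>) * B\<bar>" for x using Vb[of x] by linarith
    then show "AE x in lborel. norm (\<mu> x * V x) \<le> norm (\<mu> x * ((LINT y|lborel. \<bar>\<mu> y\<bar>) * B))"
      unfolding real_norm_def abs_mult[of "\<mu> _"] by (intro AE_I2 mult_left_mono) auto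
  qed measurable
  have offm[measurable]: "(\<lambda>y. offdiag h (x, y)) \<in> borel_measurable borel" "(\<lambda>y. offdiag h (y, x)) \<in> borel_measurable borel" for x
    unfolding offdiag_def by auto
  have neq: "AE y in lborel. y \<noteq> x" for x :: 'a by (rule AE_lborel_singleton)
  have U: "sm_integral \<nu> (\<lambda>y. offdiag h (x, y)) = (\<Sum>j<N. offdiag h (x, X j)) / real N - V x" for x
  proof -
    have "(LINT y|lborel. \<mu> y * offdiag h (x, y)) = V x"
      unfolding V_def
    proof (rule integral_cong_AE)
      show "AE y in lborel. \<mu> y * offdiag h (x, y) = \<mu> y * h (x - y)"
        using neq[of x] by eventually_elim (simp add: offdiag_def)
    qed measurable
    then show ?thesis by (subst sm_integral_fluctuation) auto
  qed
  have cross: "(LINT x|lborel. \<mu> x * offdiag h (x, X j)) = V (X j)" for j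
  proof -
    have "h (x - X j) = h (X j - x)" for x using even[of "x - X j"] by simp
    then show ?thesis
      unfolding V_def
    proof (intro integral_cong_AE)
      show "AE x in lborel. \<mu> x * offdiag h (x, X j) = \<mu> x * h (X j - x)"
        using neq[of "X j"] by eventually_elim (simp add: offdiag_def \<open>\<And>x. h (x - X j) = h (X j - x)\<close>)
    qed measurable
  qed
  have ci: "integrable lborel (\<lambda>x. \<mu> x * offdiag h (x, X j))" for j
  proof (rule Bochner_Integration.integrable_bound)
    show "integrable lborel (\<lambda>x. \<mu> x * B)" using \<mu> by auto
    have "\<bar>offdiag h (x, X j)\<bar> \<le> \<bar>B\<bar>" for x using order_trans[OF aB abs_ge_self] by (simp add: offdiag_def)
    then show "AE x in lborel. norm (\<mu> x * offdiag h (x, X j)) \<le> norm (\<mu> x * B)"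
      by (auto simp: abs_mult intro!: mult_left_mono)
  qed measurable
  have "sm_integral \<kappa> (offdiag h) = sm_integral \<nu> (\<lambda>x. (\<Sum>j<N. offdiag h (x, X j)) / real N - V x)"
    using sm_integral_tensor[OF \<nu>_borel \<nu>_borel off(2)] by (simp add: U)
  also have "\<dots> = (\<Sum>i<N. (\<Sum>j<N. offdiag h (X i, X j)) / real N - V (X i)) / real N
      - (LINT x|lborel. \<mu> x * ((\<Sum>j<N. offdiag h (x, X j)) / real N - V x))"
    by (subst sm_integral_fluctuation) auto
  also have "(LINT x|lborel. \<mu> x * ((\<Sum>j<N. offdiag h (x, X j)) / real N - V x))
      = (LINT x|lborel. (\<Sum>j<N. \<mu> x * offdiag h (x, X j)) / real N - \<mu> x * V x)"
    by (simp add: right_diff_distrib sum_distrib_left)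
  also have "\<dots> = (\<Sum>j<N. V (X j)) / real N - (LINT x|lborel. \<mu> x * V x)"
    using ci Vi by (simp add: cross)
  finally have eq: "sm_integral \<kappa> (offdiag h) = (\<Sum>i<N. \<Sum>j<N. offdiag h (X i, X j)) / real N / real N
      - 2 / real N * (\<Sum>j<N. V (X j)) + (LINT x|lborel. \<mu> x * V x)"
    by (simp add: sum_subtractf diff_divide_distrib flip: sum_divide_distrib)
  have "0 \<le> (LINT x|lborel. \<mu> x * V x)"
  proof -
    let ?\<nu> = "[(lborel, \<mu>)] :: 'a signed_measure"
    have b: "borel_sm ?\<nu>" by (simp add: lborel.sigma_finite_measure_axioms)
    have f: "sm_tv ?\<nu> (\<lambda>_. 1) < \<infinity>" using \<mu>_norm_finite by simp
    have "sm_integrable (sm_tensor ?\<nu> ?\<nu>) (\<lambda>(x, y). h (x - y))"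
      by (rule sm_integrable_bounded[OF borel_sm_tensor[OF b b] sm_tv_tensor_finite[OF b b f f]
            borel_measurable_difference[OF hm], where B=B]) (use aB in auto)
    from sm_integral_tensor[OF b b this] show ?thesis
      using energy_ge_spectral(2)[OF b f c aB h, of "\<lambda>_. 0"] pd by (simp add: V_def)
  qed
  moreover have "0 \<le> (\<Sum>i<N. \<Sum>j<N. offdiag h (X i, X j)) / real N / real N"
    using h0 by (intro divide_nonneg_nonneg sum_nonneg) (auto simp: offdiag_def)
  ultimately show ?thesis unfolding eq V_def[symmetric] by simp
qed

end

context point_configuration begin

lemma sm_tv_fluctuation_finite:
  assumes h: "h \<in> borel_measurable borel" and pts: "\<And>i. i < N \<Longrightarrow> h (X i) < \<infinity>"
    and i: "(\<integral>\<^sup>+x. ennreal \<bar>\<mu> x\<bar> * h x \<partial>lborel) < \<infinity>"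
  shows "sm_tv \<nu> h < \<infinity>"
proof -
  have "(\<Sum>i<N. h (X i)) < top" using pts by (simp add: less_top[symmetric])
  then have "ennreal (1 / real N) * (\<Sum>i<N. h (X i)) < top" by (simp add: ennreal_mult_less_top)
  with i show ?thesis by (simp add: sm_tv_fluctuation[OF h])
qed

text \<open>Integrability of an even interaction against the variation of \<open>\<nu> \<otimes> \<nu>\<close> off the diagonal is a statement
about the three kinds of terms. The mixed and the background integrals need not avoid the diagonal,
which is a null set there.\<close>

lemma sm_tv_offdiag_finite:
  fixes h :: "'a \<Rightarrow> ennreal"
  assumes [measurable]: "h \<in> borel_measurable borel" and even: "\<And>x. h (- x) = h x"
    and pts: "\<And>i j. i < N \<Longrightarrow> j < N \<Longrightarrow> i \<noteq> j \<Longrightarrow> h (X i - X j) < \<infinity>"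
    and cross: "\<And>i. i < N \<Longrightarrow> (\<integral>\<^sup>+y. ennreal \<bar>\<mu> y\<bar> * h (X i - y) \<partial>lborel) < \<infinity>"
    and double: "(\<integral>\<^sup>+x. ennreal \<bar>\<mu> x\<bar> * (\<integral>\<^sup>+y. ennreal \<bar>\<mu> y\<bar> * h (x - y) \<partial>lborel) \<partial>lborel) < \<infinity>"
  shows "sm_tv \<kappa> (\<lambda>(x, y). if x = y then 0 else h (x - y)) < \<infinity>"
proof -
  let ?f = "\<lambda>(x, y). if x = y then 0 else h (x - y)"
  have [measurable]: "Measurable.pred borel (\<lambda>z::'a \<times> 'a. fst z = snd z)"
    using diagonal_borel[where 'a='a] by (simp add: pred_def)
  have "(\<lambda>z. h (fst z - snd z)) \<in> borel_measurable borel"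
    using borel_measurable_difference[of h] by (simp add: split_beta')
  then have fm: "?f \<in> borel_measurable borel" unfolding split_beta' by measurable
  have fX: "(\<lambda>x. ?f (x, a)) \<in> borel_measurable borel" for a by simp
  have Vm: "(\<lambda>x. \<integral>\<^sup>+y. ennreal \<bar>\<mu> y\<bar> * h (x - y) \<partial>lborel) \<in> borel_measurable borel" by measurable
  have Sm: "(\<lambda>x. \<Sum>j<N. ?f (x, X j)) \<in> borel_measurable borel" by (intro borel_measurable_sum fX)
  have 1: "sm_tv \<nu> (\<lambda>y. ?f (x, y)) = ennreal (1 / real N) * (\<Sum>j<N. ?f (x, X j)) + (\<integral>\<^sup>+y. ennreal \<bar>\<mu> y\<bar> * h (x - y) \<partial>lborel)" for x
  proof -
    have "(\<integral>\<^sup>+y. ennreal \<bar>\<mu> y\<bar> * ?f (x, y) \<partial>lborel) = (\<integral>\<^sup>+y. ennreal \<bar>\<mu> y\<bar> * h (x - y) \<partial>lborel)"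
    proof (rule nn_integral_cong_AE)
      show "AE y in lborel. ennreal \<bar>\<mu> y\<bar> * ?f (x, y) = ennreal \<bar>\<mu> y\<bar> * h (x - y)"
        using AE_lborel_singleton[of x] by eventually_elim auto
    qed
    then show ?thesis by (subst sm_tv_fluctuation) auto
  qed
  have "sm_tv \<kappa> ?f = sm_tv \<nu> (\<lambda>x. sm_tv \<nu> (\<lambda>y. ?f (x, y)))"
    by (rule sm_tv_tensor[OF \<nu>_borel \<nu>_borel fm])
  also have "\<dots> = sm_tv \<nu> (\<lambda>x. ennreal (1 / real N) * (\<Sum>j<N. ?f (x, X j)) + (\<integral>\<^sup>+y. ennreal \<bar>\<mu> y\<bar> * h (x - y) \<partial>lborel))"
    unfolding 1 ..
  also have "\<dots> = sm_tv \<nu> (\<lambda>x. ennreal (1 / real N) * (\<Sum>j<N. ?f (x, X j))) + sm_tv \<nu> (\<lambda>x. \<integral>\<^sup>+y. ennreal \<bar>\<mu> y\<bar> * h (x - y) \<partial>lborel)"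
    by (intro sm_tv_add \<nu>_borel borel_measurable_times_ennreal borel_measurable_const Sm Vm)
  also have "sm_tv \<nu> (\<lambda>x. ennreal (1 / real N) * (\<Sum>j<N. ?f (x, X j)))
     = ennreal (1 / real N) * sm_tv \<nu> (\<lambda>x. \<Sum>j<N. ?f (x, X j))"
    by (rule sm_tv_cmult[OF \<nu>_borel Sm])
  finally have 2: "sm_tv \<kappa> ?f = ennreal (1 / real N) * sm_tv \<nu> (\<lambda>x. \<Sum>j<N. ?f (x, X j)) + sm_tv \<nu> (\<lambda>x. \<integral>\<^sup>+y. ennreal \<bar>\<mu> y\<bar> * h (x - y) \<partial>lborel)" .
  have ci: "(\<integral>\<^sup>+x. ennreal \<bar>\<mu> x\<bar> * ?f (x, X j) \<partial>lborel) < \<infinity>" if "j < N" for j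
  proof -
    have "(\<integral>\<^sup>+x. ennreal \<bar>\<mu> x\<bar> * ?f (x, X j) \<partial>lborel) \<le> (\<integral>\<^sup>+y. ennreal \<bar>\<mu> y\<bar> * h (X j - y) \<partial>lborel)"
    proof (intro nn_integral_mono mult_left_mono)
      fix x show "?f (x, X j) \<le> h (X j - x)" using even[of "x - X j"] by auto
    qed auto
    then show ?thesis using cross[OF that] by (simp add: le_less_trans)
  qed
  have 3: "sm_tv \<nu> (\<lambda>x. \<Sum>j<N. ?f (x, X j)) < \<infinity>"
  proof -
    have "(\<integral>\<^sup>+x. ennreal \<bar>\<mu> x\<bar> * (\<Sum>j<N. ?f (x, X j)) \<partial>lborel) = (\<Sum>j<N. \<integral>\<^sup>+x. ennreal \<bar>\<mu> x\<bar> * ?f (x, X j) \<partial>lborel)"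
      by (simp add: sum_distrib_left nn_integral_sum)
    also have "\<dots> < \<infinity>" using ci by (simp add: less_top[symmetric])
    finally have i: "(\<integral>\<^sup>+x. ennreal \<bar>\<mu> x\<bar> * (\<Sum>j<N. ?f (x, X j)) \<partial>lborel) < \<infinity>" .
    show ?thesis
    proof (rule sm_tv_fluctuation_finite[OF Sm _ i])
      fix i assume "i < N"
      then have "?f (X i, X j) < \<infinity>" if "j < N" for j using pts[of i j] that by (cases "i = j") auto
      then show "(\<Sum>j<N. ?f (X i, X j)) < \<infinity>" by (simp add: less_top[symmetric])
    qed
  qed
  have 4: "sm_tv \<nu> (\<lambda>x. \<integral>\<^sup>+y. ennreal \<bar>\<mu> y\<bar> * h (x - y) \<partial>lborel) < \<infinity>"
    by (rule sm_tv_fluctuation_finite[OF Vm cross double])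
  show ?thesis unfolding 2 using 3 4 by (simp add: ennreal_mult_less_top)
qed

text \<open>The energy of a superposition \<open>\<integral> H t dt\<close> of even nonnegative interactions is the superposition of
the energies.\<close>

lemma offdiag_mixture:
  fixes H :: "real \<Rightarrow> 'a \<Rightarrow> real"
  assumes H[measurable]: "(\<lambda>(t, x). H t x) \<in> borel_measurable borel"
    and H0: "\<And>t x. 0 \<le> H t x" and even: "\<And>t x. H t (- x) = H t x"
    and pts: "\<And>x. x \<noteq> 0 \<Longrightarrow> integrable lborel (\<lambda>t. H t x)"
    and cross: "\<And>i. i < N \<Longrightarrow> (\<integral>\<^sup>+y. ennreal \<bar>\<mu> y\<bar> * (\<integral>\<^sup>+t. ennreal (H t (X i - y)) \<partial>lborel) \<partial>lborel) < \<infinity>"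
    and double: "(\<integral>\<^sup>+x. ennreal \<bar>\<mu> x\<bar> * (\<integral>\<^sup>+y. ennreal \<bar>\<mu> y\<bar> * (\<integral>\<^sup>+t. ennreal (H t (x - y)) \<partial>lborel) \<partial>lborel) \<partial>lborel) < \<infinity>"
  shows "sm_integral \<kappa> (offdiag (\<lambda>x. LINT t|lborel. H t x)) = (LINT t|lborel. sm_integral \<kappa> (offdiag (H t)))"
    and "integrable lborel (\<lambda>t. sm_integral \<kappa> (offdiag (H t)))"
    and "sm_integrable \<kappa> (offdiag (\<lambda>x. LINT t|lborel. H t x))"
proof -
  have "(\<lambda>(t, x). H t x) \<in> borel_measurable (borel \<Otimes>\<^sub>M borel)" using H by (simp add: borel_prod)
  then have [measurable]: "(\<lambda>(x, t). H t x) \<in> borel_measurable (borel \<Otimes>\<^sub>M lborel)"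
    by (simp add: measurable_split_conv measurable_pair_swap_iff[of _ borel lborel] split_beta')
  have eq: "offdiag (\<lambda>x. LINT t|lborel. H t x) = (\<lambda>z. LINT t|lborel. offdiag (H t) z)"
    by (auto simp: offdiag_def fun_eq_iff)
  have m: "(\<lambda>(t, z). offdiag (H t) z) \<in> borel_measurable borel"
  proof -
    have [measurable]: "Measurable.pred borel (\<lambda>z::real \<times> 'a \<times> 'a. fst (snd z) = snd (snd z))"
      unfolding pred_def by (simp, intro borel_closed closed_Collect_eq continuous_intros)
    have "(\<lambda>p. (fst p, fst (snd p) - snd (snd p))) \<in> borel_measurable (borel :: (real \<times> 'a \<times> 'a) measure)"
      by (intro borel_measurable_continuous_onI continuous_intros)
    from measurable_compose[OF this H]
    have "(\<lambda>p. H (fst p) (fst (snd p) - snd (snd p))) \<in> borel_measurable (borel :: (real \<times> 'a \<times> 'a) measure)"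
      by simp
    then show ?thesis by (simp add: offdiag_def split_beta')
  qed
  have nn: "(\<lambda>z. \<integral>\<^sup>+t. ennreal (norm (offdiag (H t) z)) \<partial>lborel)
      = (\<lambda>(x, y). if x = y then 0 else (\<integral>\<^sup>+t. ennreal (H t (x - y)) \<partial>lborel))"
    using H0 by (auto simp: offdiag_def fun_eq_iff)
  have hm: "(\<lambda>x. \<integral>\<^sup>+t. ennreal (H t x) \<partial>lborel) \<in> borel_measurable borel" by measurable
  have fin: "sm_tv \<kappa> (\<lambda>z. \<integral>\<^sup>+t. ennreal (norm (offdiag (H t) z)) \<partial>lborel) < \<infinity>"
    unfolding nn
  proof (rule sm_tv_offdiag_finite[OF hm _ _ cross double])
    fix i j assume ij: "i < N" "j < N" "i \<noteq> j"
    then have "X i - X j \<noteq> 0" using X by (auto simp: inj_on_def)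
    from pts[OF this] show "(\<integral>\<^sup>+t. ennreal (H t (X i - X j)) \<partial>lborel) < \<infinity>"
      using H0 by (auto simp: integrable_iff_bounded)
  qed (simp add: even)
  show "sm_integral \<kappa> (offdiag (\<lambda>x. LINT t|lborel. H t x)) = (LINT t|lborel. sm_integral \<kappa> (offdiag (H t)))"
    "integrable lborel (\<lambda>t. sm_integral \<kappa> (offdiag (H t)))"
    "sm_integrable \<kappa> (offdiag (\<lambda>x. LINT t|lborel. H t x))"
    using sm_integral_Fubini[OF \<kappa>_borel m fin] by (simp_all add: eq)
qed

end

section \<open>Hoelder bounds for dilated kernels\<close>

text \<open>The two power integrals decide which lower bound may be used at which scales: one over small
scales and one over large scales.\<close>

lemma powr_integral_near_0:
  fixes a l :: real
  assumes "a > 0" "l \<ge> 0"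
  shows "has_bochner_integral lborel (\<lambda>t. indicator {0<..l} t * t powr (a - 1)) (l powr a / a)"
proof (rule has_bochner_integral_nn_integral)
  have "((\<lambda>t. t powr (a - 1)) has_integral (l powr (a - 1 + 1) / (a - 1 + 1))) {0..l}"
    using assms by (intro has_integral_powr_from_0) auto
  then have "(\<integral>\<^sup>+t. ennreal (indicator {0..l} t * t powr (a - 1)) \<partial>lborel) = ennreal (l powr a / a)"
    by (subst nn_integral_has_integral_lebesgue) auto
  moreover have "(\<integral>\<^sup>+t. ennreal (indicator {0<..l} t * t powr (a - 1)) \<partial>lborel)
      = (\<integral>\<^sup>+t. ennreal (indicator {0..l} t * t powr (a - 1)) \<partial>lborel)"
  proof (rule nn_integral_cong)
    fix t :: real
    show "ennreal (indicator {0<..l} t * t powr (a - 1)) = ennreal (indicator {0..l} t * t powr (a - 1))"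
      by (cases "t = 0") (auto simp: indicator_def)
  qed
  ultimately show "(\<integral>\<^sup>+t. ennreal (indicator {0<..l} t * t powr (a - 1)) \<partial>lborel) = ennreal (l powr a / a)"
    by metis
qed (use assms in \<open>auto simp: indicator_def\<close>)

lemma powr_integral_near_infinity:
  fixes a l :: real
  assumes "a > 0" "l > 0"
  shows "has_bochner_integral lborel (\<lambda>t. indicator {l..} t * t powr (- a - 1)) (l powr (- a) / a)"
proof (rule has_bochner_integral_nn_integral)
  have "((\<lambda>t. t powr (- a - 1)) has_integral (- (l powr (- a - 1 + 1)) / (- a - 1 + 1))) {l..}"
    using assms by (intro has_integral_powr_to_inf) auto
  then show "(\<integral>\<^sup>+t. ennreal (indicator {l..} t * t powr (- a - 1)) \<partial>lborel) = ennreal (l powr (- a) / a)"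
    by (subst nn_integral_has_integral_lebesgue) auto
qed (use assms in \<open>auto simp: indicator_def\<close>)

lemma Lp_norm_nonneg: "0 \<le> Lp_norm p f"
  by (auto simp: Lp_norm_def)

text \<open>Young's inequality for the functions normalised in their Lebesgue norms; the cases of norm zero are
separate.\<close>

lemma Hoelder_finite:
  fixes f h :: "'a \<Rightarrow> real"
  assumes P: "P > 1" "q > 1" "1 / P + 1 / q = 1"
    and [measurable]: "f \<in> borel_measurable M" "h \<in> borel_measurable M"
    and f0: "\<And>x. 0 \<le> f x" and h0: "\<And>x. 0 \<le> h x"
    and fi: "integrable M (\<lambda>x. f x powr P)" and hi: "integrable M (\<lambda>x. h x powr q)"
  shows "(LINT x|M. f x * h x) \<le> (LINT x|M. f x powr P) powr (1 / P) * (LINT x|M. h x powr q) powr (1 / q)"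
proof -
  define F where "F = (LINT x|M. f x powr P)"
  define G where "G = (LINT x|M. h x powr q)"
  have FG: "0 \<le> F" "0 \<le> G" unfolding F_def G_def by (auto intro!: Bochner_Integration.integral_nonneg)
  consider "F = 0" | "G = 0" | "F > 0" "G > 0" using FG by linarith
  then show ?thesis
  proof cases
    case 1
    have "AE x in M. f x powr P = 0"
      using integral_nonneg_eq_0_iff_AE[OF fi] 1 by (auto simp: F_def)
    then have "AE x in M. f x * h x = 0" by eventually_elim auto
    then have "(LINT x|M. f x * h x) = 0" by (rule integral_eq_zero_AE)
    then show ?thesis by simp
  next
    case 2
    have "AE x in M. h x powr q = 0"
      using integral_nonneg_eq_0_iff_AE[OF hi] 2 by (auto simp: G_def)
    then have "AE x in M. f x * h x = 0" by eventually_elim auto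
    then have "(LINT x|M. f x * h x) = 0" by (rule integral_eq_zero_AE)
    then show ?thesis by simp
  next
    case 3
    let ?a = "F powr (1 / P)" and ?b = "G powr (1 / q)"
    have ab: "?a > 0" "?b > 0" "?a powr P = F" "?b powr q = G"
      using 3 P by (auto simp: powr_powr)
    have le: "f x * h x \<le> ?a * ?b * (f x powr P / F / P + h x powr q / G / q)" for x
    proof -
      have "(f x / ?a) * (h x / ?b) \<le> (f x / ?a) powr P / P + (h x / ?b) powr q / q"
        using P f0 h0 ab by (intro Youngs_inequality) auto
      also have "\<dots> = f x powr P / F / P + h x powr q / G / q"
        using f0 h0 ab by (simp add: powr_divide)
      finally show ?thesis using ab by (simp add: field_simps)
    qed
    have "(LINT x|M. f x * h x) \<le> (LINT x|M. ?a * ?b * (f x powr P / F / P + h x powr q / G / q))"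
      using fi hi by (intro integral_mono' le order_trans[OF mult_nonneg_nonneg[OF f0 h0] le]) auto
    also have "\<dots> = ?a * ?b * (F / F / P + G / G / q)"
      using fi hi by (simp add: F_def G_def)
    also have "\<dots> = ?a * ?b" using 3 P by simp
    finally show ?thesis by (simp add: F_def G_def)
  qed
qed

lemma conj_ratio_bounds:
  assumes "p > 1" shows "0 < conj_ratio p" "conj_ratio p \<le> 1"
proof -
  have "enn2real p > 1" if "p \<noteq> \<infinity>"
    using assms that by (cases p rule: ennreal_cases) auto
  then show "0 < conj_ratio p" "conj_ratio p \<le> 1" by (auto simp: conj_ratio_def)
qed

text \<open>The exponent conjugate to \<open>p\<close> is \<open>1 / conj_ratio p\<close>, also for \<open>p = \<infinity>\<close>. A bounded integrable function
belongs to every Lebesgue space, so the right-hand side is a genuine norm.\<close>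

lemma Hoelder_Lp:
  fixes \<mu> h :: "'a::euclidean_space \<Rightarrow> real"
  assumes p: "p > 1" and \<mu>: "integrable lborel \<mu>" "in_Lp p \<mu>"
    and h: "integrable lborel h" "\<And>x. 0 \<le> h x" "\<And>x. h x \<le> B"
  shows "(LINT y|lborel. \<bar>\<mu> y\<bar> * h y)
    \<le> Lp_norm p \<mu> * (LINT y|lborel. h y powr (1 / conj_ratio p)) powr conj_ratio p"
proof (cases "p = \<infinity>")
  case True
  define m where "m = Lp_norm p \<mu>"
  have fin: "esssup lborel (\<lambda>x. ennreal \<bar>\<mu> x\<bar>) < \<infinity>" using \<mu> True by (simp add: in_Lp_def)
  have "AE x in lborel. ennreal \<bar>\<mu> x\<bar> \<le> esssup lborel (\<lambda>x. ennreal \<bar>\<mu> x\<bar>)" by (rule esssup_AE)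
  then have ae: "AE x in lborel. \<bar>\<mu> x\<bar> \<le> m"
  proof eventually_elim
    case (elim x)
    then have "enn2real (ennreal \<bar>\<mu> x\<bar>) \<le> enn2real (esssup lborel (\<lambda>x. ennreal \<bar>\<mu> x\<bar>))"
      using fin by (intro enn2real_mono) auto
    then show ?case using True by (simp add: m_def Lp_norm_def)
  qed
  have [measurable]: "\<mu> \<in> borel_measurable borel" "h \<in> borel_measurable borel" using \<mu> h by auto
  have m0: "0 \<le> m" by (simp add: m_def Lp_norm_nonneg)
  have "(LINT y|lborel. \<bar>\<mu> y\<bar> * h y) \<le> (LINT y|lborel. m * h y)"
  proof (rule integral_mono_AE')
    show "AE x in lborel. \<bar>\<mu> x\<bar> * h x \<le> m * h x"
      using ae by eventually_elim (use h in \<open>auto intro: mult_right_mono\<close>)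
  qed (use h m0 in auto)
  also have "\<dots> = m * (LINT y|lborel. h y)" by simp
  also have "(LINT y|lborel. h y) = (LINT y|lborel. h y powr (1 / conj_ratio p)) powr conj_ratio p"
    using h True by (simp add: conj_ratio_def Bochner_Integration.integral_nonneg)
  finally show ?thesis by (simp add: m_def)
next
  case False
  define P where "P = enn2real p"
  have P: "P > 1" using p False by (cases p rule: ennreal_cases) (auto simp: P_def)
  have cr: "conj_ratio p = (P - 1) / P" using False by (simp add: conj_ratio_def P_def)
  \<comment> \<open>the conjugate exponent\<close>
  define q where "q = P / (P - 1)"
  have q: "q > 1" "1 / P + 1 / q = 1" "1 / conj_ratio p = q" "conj_ratio p = 1 / q"
    using P by (auto simp: q_def cr field_simps)
  have [measurable]: "\<mu> \<in> borel_measurable borel" "h \<in> borel_measurable borel" using \<mu> h by auto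
  have B: "0 \<le> B" using h(2,3)[of undefined] by linarith
  have hi: "integrable lborel (\<lambda>y. h y powr q)"
  proof (rule Bochner_Integration.integrable_bound)
    show "integrable lborel (\<lambda>y. B powr (q - 1) * h y)" using h by auto
    show "AE y in lborel. norm (h y powr q) \<le> norm (B powr (q - 1) * h y)"
    proof (rule AE_I2)
      fix y
      have "h y powr q = h y powr (q - 1) * h y"
        using h(2)[of y] by (cases "h y = 0") (auto simp flip: powr_mult_base powr_add simp: mult.commute powr_diff)
      also have "\<dots> \<le> B powr (q - 1) * h y"
        using h q by (intro mult_right_mono powr_mono2) auto
      finally show "norm (h y powr q) \<le> norm (B powr (q - 1) * h y)" using h(2)[of y] by simp
    qed
  qed measurable
  have "integrable lborel (\<lambda>y. \<bar>\<mu> y\<bar> powr P)" using \<mu> False by (simp add: in_Lp_def P_def)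
  from Hoelder_finite[OF P q(1,2) _ _ _ h(2) this hi] show ?thesis
    using False by (simp add: Lp_norm_def P_def q)
qed

text \<open>Dilation by \<open>t\<close> multiplies the norm with exponent \<open>q\<close> by \<open>t powr (d / q - d)\<close>.\<close>

lemma dilate_Hoelder:
  fixes \<mu> \<phi> :: "'a::euclidean_space \<Rightarrow> real"
  assumes p: "p > 1" and \<mu>: "integrable lborel \<mu>" "in_Lp p \<mu>" and t: "t > 0"
    and \<phi>: "integrable lborel \<phi>" "\<And>x. 0 \<le> \<phi> x" "\<And>x. \<phi> x \<le> B"
  shows "(LINT y|lborel. \<bar>\<mu> y\<bar> * dilate t \<phi> (z - y))
    \<le> Lp_norm p \<mu> * (LINT y|lborel. \<phi> y powr (1 / conj_ratio p)) powr conj_ratio p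
        * t powr (DIM('a) * conj_ratio p - DIM('a))"
proof -
  let ?h = "\<lambda>y. dilate t \<phi> (z - y)" and ?q = "1 / conj_ratio p" and ?c = "conj_ratio p"
  let ?I = "LINT y|lborel. \<phi> y powr (1 / conj_ratio p)"
  have [measurable]: "\<phi> \<in> borel_measurable borel" using \<phi> by auto
  have c: "0 < ?c" "?c \<le> 1" using conj_ratio_bounds[OF p] by auto
  have hi: "integrable lborel ?h"
    using lborel_integrable_affine[of "-1" "dilate t \<phi>" z] dilate_integrable[OF t \<phi>(1)] by simp
  have "(LINT y|lborel. ?h y powr ?q)
      = \<bar>-t\<bar> ^ DIM('a) *\<^sub>R (LINT y|lborel. ?h (z + (-t) *\<^sub>R y) powr ?q)"
    using t by (intro lborel_integral_affine) (auto simp: dilate_def)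
  also have "(\<lambda>y. ?h (z + (-t) *\<^sub>R y) powr ?q) = (\<lambda>y. t powr (- DIM('a) * ?q) * \<phi> y powr ?q)"
    using t by (auto simp: dilate_def powr_divide powr_realpow[symmetric] powr_powr powr_minus_divide field_simps fun_eq_iff)
  also have "\<bar>-t\<bar> ^ DIM('a) *\<^sub>R (LINT y|lborel. t powr (- DIM('a) * ?q) * \<phi> y powr ?q)
      = t powr (DIM('a) - DIM('a) * ?q) * ?I"
    using t by (simp add: powr_realpow[symmetric] powr_add[symmetric])
  finally have eq: "(LINT y|lborel. ?h y powr ?q) = t powr (DIM('a) - DIM('a) * ?q) * ?I" .
  have "(LINT y|lborel. \<bar>\<mu> y\<bar> * ?h y) \<le> Lp_norm p \<mu> * (LINT y|lborel. ?h y powr ?q) powr ?c"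
  proof (rule Hoelder_Lp[OF p \<mu> hi])
    show "0 \<le> ?h x" for x using t \<phi> by (simp add: dilate_def)
    show "?h x \<le> B / t ^ DIM('a)" for x using t \<phi> by (simp add: dilate_def divide_right_mono)
  qed
  also have "(LINT y|lborel. ?h y powr ?q) powr ?c = t powr ((DIM('a) - DIM('a) * ?q) * ?c) * ?I powr ?c"
    unfolding eq by (subst powr_mult) (auto simp: powr_powr Bochner_Integration.integral_nonneg)
  also have "(DIM('a) - DIM('a) * ?q) * ?c = DIM('a) * ?c - DIM('a)" using c by (simp add: field_simps)
  finally show ?thesis by (simp add: mult_ac)
qed

section \<open>Radial kernels and superpositions of their dilates\<close>

text \<open>The last assumption bounds the kernel at distances large compared with the scale; it makes the
contribution of small scales to the potential converge away from the origin. Monotonicity in the norm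
contains radial symmetry.\<close>

locale radial_kernel =
  fixes \<phi> :: "'a::euclidean_space \<Rightarrow> real" and s \<gamma> C\<^sub>\<gamma> :: real
  assumes s: "0 \<le> s" "s < DIM('a)"
    and nonneg: "\<And>x. 0 \<le> \<phi> x" and cont: "continuous_on UNIV \<phi>" and int: "integrable lborel \<phi>"
    and decr: "\<And>x y. norm x \<le> norm y \<Longrightarrow> \<phi> y \<le> \<phi> x" and pos: "0 < \<phi> 0"
    and pd: "\<And>\<xi>. 0 \<le> Re (fourier \<phi> \<xi>)"
    and decay: "s < \<gamma>" "\<And>x. \<phi> x \<le> C\<^sub>\<gamma> * jbracket x powr (- \<gamma>)"
begin

lemma measurable_kernel [measurable]: "\<phi> \<in> borel_measurable borel"
  using int by auto

lemma le_at_0: "\<phi> x \<le> \<phi> 0" by (rule decr) simp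

lemma even: "\<phi> (- x) = \<phi> x" by (intro antisym decr) auto

lemma dilate_bounds: "t > 0 \<Longrightarrow> 0 \<le> dilate t \<phi> x" "t > 0 \<Longrightarrow> dilate t \<phi> x \<le> \<phi> 0 / t ^ DIM('a)"
  using nonneg le_at_0 by (auto simp: dilate_def divide_right_mono)

lemma dilate_even: "dilate t \<phi> (- x) = dilate t \<phi> x"
  using even by (simp add: dilate_def)

lemma dilate_decr: "t > 0 \<Longrightarrow> norm x \<le> norm y \<Longrightarrow> dilate t \<phi> y \<le> dilate t \<phi> x"
  unfolding dilate_def by (intro divide_right_mono decr) (auto intro: mult_left_mono)

lemma dilate_measurable [measurable]: "(\<lambda>(t, x). dilate t \<phi> x) \<in> borel_measurable borel"
proof -
  have "(\<lambda>(t, x). dilate t \<phi> x) \<in> borel_measurable (borel \<Otimes>\<^sub>M borel)"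
    unfolding dilate_def by measurable
  then show ?thesis by (simp add: borel_prod)
qed

lemma dilate_measurable2 [measurable]: "dilate t \<phi> \<in> borel_measurable borel" "(\<lambda>t. dilate t \<phi> x) \<in> borel_measurable borel"
  unfolding dilate_def by measurable

lemma C_decay_nonneg: "0 \<le> C\<^sub>\<gamma>"
proof -
  have "0 < C\<^sub>\<gamma> * jbracket (0::'a) powr (- \<gamma>)" using pos decay(2)[of 0] by linarith
  then show ?thesis by (simp add: jbracket_def)
qed

text \<open>The exponent on the right exceeds \<open>-1\<close>, so that the integral over small scales converges.\<close>

lemma dilate_decay:
  assumes t: "t > 0" and x: "x \<noteq> 0"
  shows "t powr (DIM('a) - s) * dilate t \<phi> x / t \<le> C\<^sub>\<gamma> * norm x powr (- \<gamma>) * t powr (\<gamma> - s - 1)"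
proof -
  have g: "0 \<le> \<gamma>" using decay s by linarith
  have "norm x / t \<le> jbracket (x /\<^sub>R t)"
    using t by (simp add: jbracket_def divide_inverse mult.commute real_le_rsqrt)
  moreover have "norm x / t > 0" using t x by simp
  ultimately have "jbracket (x /\<^sub>R t) powr (- \<gamma>) \<le> (norm x / t) powr (- \<gamma>)"
    using g by (intro powr_mono2') auto
  then have "\<phi> (x /\<^sub>R t) \<le> C\<^sub>\<gamma> * (norm x / t) powr (- \<gamma>)"
    using decay(2)[of "x /\<^sub>R t"] C_decay_nonneg by (meson mult_left_mono order_trans)
  then have "t powr (DIM('a) - s) * dilate t \<phi> x / t
      \<le> t powr (DIM('a) - s) * (C\<^sub>\<gamma> * (norm x / t) powr (- \<gamma>) / t ^ DIM('a)) / t"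
    unfolding dilate_def using t by (intro divide_right_mono mult_left_mono) auto
  also have "\<dots> = C\<^sub>\<gamma> * norm x powr (- \<gamma>) * (t powr (DIM('a) - s) * t powr \<gamma> * t powr (- DIM('a)) * t powr (- 1))"
    using t x by (simp add: powr_divide powr_minus powr_realpow field_simps)
  also have "t powr (DIM('a) - s) * t powr \<gamma> * t powr (- DIM('a)) * t powr (- 1) = t powr (\<gamma> - s - 1)"
  proof -
    have "t powr (DIM('a) - s) * t powr \<gamma> * t powr (- DIM('a)) * t powr (- 1) = t powr (DIM('a) - s + \<gamma> + - DIM('a) + - 1)"
      by (simp only: powr_add)
    also have "DIM('a) - s + \<gamma> + - DIM('a) + - 1 = \<gamma> - s - 1" by simp
    finally show ?thesis .
  qed
  finally show ?thesis .
qed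

end

lemma density_tail_le:
  assumes "t > 0" "z \<le> K * t powr (real d - s)"
  shows "z / t ^ d / t \<le> K * t powr (- s - 1)"
proof -
  have "z / t ^ d / t \<le> K * t powr (real d - s) / t ^ d / t"
    using assms by (intro divide_right_mono) auto
  also have "\<dots> = K * (t powr (real d - s) / t powr real d / t powr 1)"
    using assms by (simp add: powr_realpow)
  also have "t powr (real d - s) / t powr real d / t powr 1 = t powr (- s - 1)"
    by (simp only: powr_diff[symmetric]) simp
  finally show ?thesis .
qed

text \<open>The data of an admissible potential in a form that covers \<open>s > 0\<close> and \<open>s = 0\<close> together. The density is
\<open>\<zeta> + \<rho>\<close>, where \<open>\<zeta>\<close> is comparable to \<open>t powr (d - s)\<close> with constant \<open>K\<close> and \<open>\<rho>\<close> is a perturbation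
whose weighted integral over all scales is finite. The constant \<open>B T\<close> is subtracted when the superposition is truncated at \<open>T\<close>, and
\<open>b\<close> is the limit of what remains of it after the values at the origin of the kernels of scale between \<open>lam\<close>
and \<open>T\<close> have been taken out.\<close>

locale scale_mixture = radial_kernel \<phi> s \<gamma> C\<^sub>\<gamma>
  for \<phi> :: "'a::euclidean_space \<Rightarrow> real" and s \<gamma> C\<^sub>\<gamma> :: real +
  fixes \<zeta> \<rho> :: "real \<Rightarrow> real" and K c lam b :: real and B :: "real \<Rightarrow> real" and g :: "'a \<Rightarrow> real"
  assumes \<zeta>_measurable [measurable]: "\<zeta> \<in> borel_measurable borel"
    and \<rho>_measurable [measurable]: "\<rho> \<in> borel_measurable borel"
    and K: "K > 0"
    and \<zeta>_lower: "\<And>t. t > 0 \<Longrightarrow> t powr (DIM('a) - s) / K \<le> \<zeta> t"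
    and \<zeta>_upper: "\<And>t. t > 0 \<Longrightarrow> \<zeta> t \<le> K * t powr (DIM('a) - s)"
    and \<rho>_nonneg: "\<And>t. t > 0 \<Longrightarrow> 0 \<le> \<rho> t"
    and \<rho>_int: "set_integrable lborel {0<..} (\<lambda>t. \<rho> t / t ^ DIM('a) / t)"
    and lam: "0 < lam" "lam \<le> 1"
    and c: "c > 0"
    and limit: "\<And>x. x \<noteq> 0 \<Longrightarrow>
      (\<lambda>n. c * ((LINT t:{0<..<real n}|lborel. (\<zeta> t + \<rho> t) * dilate t \<phi> x / t) - B (real n))) \<longlonglongrightarrow> g x"
    and offset: "(\<lambda>n. B (real n) - \<phi> 0 * (LINT t:{lam<..<real n}|lborel. \<zeta> t / t ^ DIM('a) / t)) \<longlonglongrightarrow> b"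
begin

text \<open>The densities in \<open>t\<close> of the three parts of the potential: small scales, perturbation, and the deficit
of the large scales with respect to their value at the origin.\<close>

definition Sk :: "real \<Rightarrow> 'a \<Rightarrow> real" where
  "Sk t x = indicator {0<..lam} t * (\<zeta> t * dilate t \<phi> x / t)"
definition Pk :: "real \<Rightarrow> 'a \<Rightarrow> real" where
  "Pk t x = indicator {0<..} t * (\<rho> t * dilate t \<phi> x / t)"
definition Dk :: "real \<Rightarrow> 'a \<Rightarrow> real" where
  "Dk t x = indicator {lam<..} t * (\<zeta> t * (\<phi> 0 / t ^ DIM('a) - dilate t \<phi> x) / t)"

definition S :: "'a \<Rightarrow> real" where "S x = (LINT t|lborel. Sk t x)"
definition P :: "'a \<Rightarrow> real" where "P x = (LINT t|lborel. Pk t x)"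
definition D :: "'a \<Rightarrow> real" where "D x = (LINT t|lborel. Dk t x)"
definition R :: real where "R = (LINT t:{0<..}|lborel. \<rho> t / t ^ DIM('a) / t)"

lemma \<zeta>_nonneg: "t > 0 \<Longrightarrow> 0 \<le> \<zeta> t"
  using \<zeta>_lower[of t] K by (meson divide_nonneg_pos order_trans powr_ge_zero)

lemma part_nonneg: "0 \<le> Sk t x" "0 \<le> Pk t x" "0 \<le> Dk t x"
  using \<zeta>_nonneg \<rho>_nonneg dilate_bounds lam by (auto simp: Sk_def Pk_def Dk_def indicator_def)

lemma part_even: "Sk t (- x) = Sk t x" "Pk t (- x) = Pk t x" "Dk t (- x) = Dk t x"
  by (auto simp: Sk_def Pk_def Dk_def dilate_even)

lemma part_measurable:
  "(\<lambda>(t, x). Sk t x) \<in> borel_measurable borel"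
  "(\<lambda>(t, x). Pk t x) \<in> borel_measurable borel"
  "(\<lambda>(t, x). Dk t x) \<in> borel_measurable borel"
proof -
  have [measurable]: "(\<lambda>(t, x). dilate t \<phi> x) \<in> borel_measurable (borel \<Otimes>\<^sub>M borel)"
    using dilate_measurable by (simp add: borel_prod)
  have "(\<lambda>(t, x). Sk t x) \<in> borel_measurable (borel \<Otimes>\<^sub>M borel)"
    "(\<lambda>(t, x). Pk t x) \<in> borel_measurable (borel \<Otimes>\<^sub>M borel)"
    "(\<lambda>(t, x). Dk t x) \<in> borel_measurable (borel \<Otimes>\<^sub>M borel)"
    unfolding Sk_def Pk_def Dk_def by measurable
  then show "(\<lambda>(t, x). Sk t x) \<in> borel_measurable borel"
    "(\<lambda>(t, x). Pk t x) \<in> borel_measurable borel"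
    "(\<lambda>(t, x). Dk t x) \<in> borel_measurable borel" by (simp_all add: borel_prod)
qed

lemma part_measurable1 [measurable]:
  "(\<lambda>t. Sk t x) \<in> borel_measurable borel" "(\<lambda>t. Pk t x) \<in> borel_measurable borel" "(\<lambda>t. Dk t x) \<in> borel_measurable borel"
  unfolding Sk_def Pk_def Dk_def by measurable

lemma Sk_integrable:
  assumes "x \<noteq> 0" shows "integrable lborel (\<lambda>t. Sk t x)"
proof (rule Bochner_Integration.integrable_bound)
  let ?C = "K * (C\<^sub>\<gamma> * norm x powr (- \<gamma>))"
  show "integrable lborel (\<lambda>t. ?C * (indicator {0<..lam} t * t powr ((\<gamma> - s) - 1)))"
    using powr_integral_near_0[of "\<gamma> - s" lam] decay(1) lam by (auto simp: has_bochner_integral_iff)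
  show "AE t in lborel. norm (Sk t x) \<le> norm (?C * (indicator {0<..lam} t * t powr ((\<gamma> - s) - 1)))"
  proof (rule AE_I2)
    fix t
    have "Sk t x \<le> ?C * t powr ((\<gamma> - s) - 1)" if t: "t \<in> {0<..lam}"
    proof -
      have "\<zeta> t * dilate t \<phi> x / t \<le> K * t powr (DIM('a) - s) * dilate t \<phi> x / t"
        using t \<zeta>_upper[of t] dilate_bounds[of t x] by (intro divide_right_mono mult_right_mono) auto
      also have "\<dots> = K * (t powr (DIM('a) - s) * dilate t \<phi> x / t)" by simp
      also have "\<dots> \<le> K * (C\<^sub>\<gamma> * norm x powr (- \<gamma>) * t powr (\<gamma> - s - 1))"
        using t K assms by (intro mult_left_mono dilate_decay) auto
      finally show ?thesis using t by (simp add: Sk_def mult.assoc)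
    qed
    moreover have "0 \<le> ?C * t powr ((\<gamma> - s) - 1)" using K C_decay_nonneg by auto
    ultimately show "norm (Sk t x) \<le> norm (?C * (indicator {0<..lam} t * t powr ((\<gamma> - s) - 1)))"
      using part_nonneg(1)[of t x] by (auto simp: indicator_def Sk_def)
  qed
qed measurable

lemma Pk_bound: "Pk t x \<le> \<phi> 0 * (indicator {0<..} t * (\<rho> t / t ^ DIM('a) / t))"
proof (cases "t > 0")
  case True
  have "\<rho> t * dilate t \<phi> x / t \<le> \<rho> t * (\<phi> 0 / t ^ DIM('a)) / t"
    using True \<rho>_nonneg dilate_bounds by (intro divide_right_mono mult_left_mono) auto
  then show ?thesis using True by (simp add: Pk_def mult_ac)
qed (simp add: Pk_def)

lemma \<rho>_int': "integrable lborel (\<lambda>t. \<phi> 0 * (indicator {0<..} t * (\<rho> t / t ^ DIM('a) / t)))"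
proof -
  have "integrable lborel (\<lambda>t. indicator {0<..} t * (\<rho> t / t ^ DIM('a) / t))"
    using \<rho>_int unfolding set_integrable_def real_scaleR_def .
  then show ?thesis by (rule integrable_mult_right)
qed

lemma Pk_integrable: "integrable lborel (\<lambda>t. Pk t x)"
proof (rule Bochner_Integration.integrable_bound[OF \<rho>_int'])
  show "AE t in lborel. norm (Pk t x) \<le> norm (\<phi> 0 * (indicator {0<..} t * (\<rho> t / t ^ DIM('a) / t)))"
  proof (rule AE_I2)
    fix t
    show "norm (Pk t x) \<le> norm (\<phi> 0 * (indicator {0<..} t * (\<rho> t / t ^ DIM('a) / t)))"
      using Pk_bound[of t x] part_nonneg(2)[of t x] unfolding real_norm_def by linarith
  qed
qed measurable

lemma \<zeta>_tail_le: "t > 0 \<Longrightarrow> \<zeta> t / t ^ DIM('a) / t \<le> K * t powr (- s - 1)"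
  by (rule density_tail_le[OF _ \<zeta>_upper])

lemma \<zeta>_middle_integrable:
  assumes f[measurable]: "f \<in> borel_measurable borel" and f0: "\<And>t. t > 0 \<Longrightarrow> 0 \<le> f t" and f1: "\<And>t. t > 0 \<Longrightarrow> f t \<le> M / t ^ DIM('a)"
  shows "integrable lborel (\<lambda>t. indicator {lam<..<T} t * (\<zeta> t * f t / t))"
proof (rule Bochner_Integration.integrable_bound)
  let ?C = "\<bar>M\<bar> * (K * lam powr (- s - 1))"
  have "integrable lborel (indicator {lam<..<T} :: real \<Rightarrow> real)"
    by (cases "lam \<le> T") auto
  then show "integrable lborel (\<lambda>t. ?C * indicator {lam<..<T} t)" by (rule integrable_mult_right)
  show "AE t in lborel. norm (indicator {lam<..<T} t * (\<zeta> t * f t / t)) \<le> norm (?C * indicator {lam<..<T} t)"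
  proof (rule AE_I2)
    fix t
    have "\<zeta> t * f t / t \<le> ?C" "0 \<le> \<zeta> t * f t / t" if t: "t > lam"
    proof -
      have t0: "t > 0" using t lam by simp
      have "\<zeta> t * f t / t \<le> \<zeta> t * (\<bar>M\<bar> / t ^ DIM('a)) / t"
      proof (intro divide_right_mono mult_left_mono)
        have "M / t ^ DIM('a) \<le> \<bar>M\<bar> / t ^ DIM('a)" using t0 by (intro divide_right_mono) auto
        then show "f t \<le> \<bar>M\<bar> / t ^ DIM('a)" using f1[OF t0] by linarith
      qed (use t0 \<zeta>_nonneg[OF t0] in auto)
      also have "\<dots> = \<bar>M\<bar> * (\<zeta> t / t ^ DIM('a) / t)" by simp
      also have "\<dots> \<le> \<bar>M\<bar> * (K * t powr (- s - 1))"
        using \<zeta>_tail_le[OF t0] by (intro mult_left_mono) auto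
      also have "\<dots> \<le> ?C" using t lam K s by (intro mult_left_mono powr_mono2') auto
      finally show "\<zeta> t * f t / t \<le> ?C" .
      show "0 \<le> \<zeta> t * f t / t" using t0 \<zeta>_nonneg[OF t0] f0[OF t0] by simp
    qed
    then show "norm (indicator {lam<..<T} t * (\<zeta> t * f t / t)) \<le> norm (?C * indicator {lam<..<T} t)"
      by (auto simp: indicator_def intro: order_trans[OF _ abs_ge_self])
  qed
qed measurable

lemma Dk_truncated:
  "indicator {lam<..<T} t * Dk t x = indicator {lam<..<T} t * (\<zeta> t * (\<phi> 0 / t ^ DIM('a)) / t)
     - indicator {lam<..<T} t * (\<zeta> t * dilate t \<phi> x / t)"
  by (cases "t \<in> {lam<..<T}") (auto simp: Dk_def right_diff_distrib diff_divide_distrib)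

text \<open>The truncated deficits increase with the truncation, and the assumed limits identify their limit. Hence the
deficit is integrable up to \<open>\<infinity>\<close> although the kernels themselves are not if \<open>s = 0\<close>.\<close>

lemma has_integral_Dk:
  assumes x: "x \<noteq> 0"
  shows "has_bochner_integral lborel (\<lambda>t. Dk t x) (S x + P x - b - g x / c)"
proof -
  let ?i = "\<lambda>n t. indicator {lam<..<real n} t :: real"
  let ?Dn = "\<lambda>n. LINT t|lborel. ?i n t * Dk t x"
  have i1: "integrable lborel (\<lambda>t. ?i n t * (\<zeta> t * (\<phi> 0 / t ^ DIM('a)) / t))" for n
    using pos by (intro \<zeta>_middle_integrable[where M="\<phi> 0"]) auto
  have i2: "integrable lborel (\<lambda>t. ?i n t * (\<zeta> t * dilate t \<phi> x / t))" for n
    using dilate_bounds by (intro \<zeta>_middle_integrable[where M="\<phi> 0"]) auto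
  have iD: "integrable lborel (\<lambda>t. ?i n t * Dk t x)" for n
    unfolding Dk_truncated using i1[of n] i2[of n] by (rule Bochner_Integration.integrable_diff)
  let ?Pn = "\<lambda>n. LINT t|lborel. indicator {..<real n} t * Pk t x"
  have iP: "integrable lborel (\<lambda>t. indicator {..<real n} t * Pk t x)" for n
    by (rule integrable_real_mult_indicator[OF _ Pk_integrable, of "{..<real n}" x, unfolded mult.commute[of "Pk _ x"]]) auto
  \<comment> \<open>splitting the truncated superposition at \<open>lam\<close> expresses the truncated deficit through quantities with known limits\<close>
  have key: "?Dn n = S x + ?Pn n - (B n - \<phi> 0 * (LINT t:{lam<..<real n}|lborel. \<zeta> t / t ^ DIM('a) / t))
      - (c * ((LINT t:{0<..<real n}|lborel. (\<zeta> t + \<rho> t) * dilate t \<phi> x / t) - B n)) / c" if n: "real n > lam" for n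
  proof -
    have e: "indicator {0<..<real n} t *\<^sub>R ((\<zeta> t + \<rho> t) * dilate t \<phi> x / t)
        = Sk t x + indicator {..<real n} t * Pk t x + ?i n t * (\<zeta> t * dilate t \<phi> x / t)" for t
      using n lam by (auto simp: Sk_def Pk_def indicator_def field_simps)
    have "(LINT t:{0<..<real n}|lborel. (\<zeta> t + \<rho> t) * dilate t \<phi> x / t)
        = S x + ?Pn n + (LINT t|lborel. ?i n t * (\<zeta> t * dilate t \<phi> x / t))"
      unfolding set_lebesgue_integral_def e S_def
      using Sk_integrable[OF x] iP[of n] i2[of n] by simp
    moreover have "?Dn n = \<phi> 0 * (LINT t:{lam<..<real n}|lborel. \<zeta> t / t ^ DIM('a) / t)
        - (LINT t|lborel. ?i n t * (\<zeta> t * dilate t \<phi> x / t))"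
    proof -
      have "?Dn n = (LINT t|lborel. ?i n t * (\<zeta> t * (\<phi> 0 / t ^ DIM('a)) / t))
          - (LINT t|lborel. ?i n t * (\<zeta> t * dilate t \<phi> x / t))"
        unfolding Dk_truncated using i1[of n] i2[of n] by (rule Bochner_Integration.integral_diff)
      also have "(LINT t|lborel. ?i n t * (\<zeta> t * (\<phi> 0 / t ^ DIM('a)) / t))
          = \<phi> 0 * (LINT t:{lam<..<real n}|lborel. \<zeta> t / t ^ DIM('a) / t)"
        unfolding set_lebesgue_integral_def by (subst integral_mult_right_zero[symmetric]) (simp add: mult_ac)
      finally show ?thesis .
    qed
    ultimately show ?thesis using c by simp
  qed
  have Plim: "?Pn \<longlonglongrightarrow> P x"
    unfolding P_def
  proof (rule integral_dominated_convergence[where w="\<lambda>t. Pk t x"])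
    show "AE t in lborel. (\<lambda>n. indicator {..<real n} t * Pk t x) \<longlonglongrightarrow> Pk t x"
    proof (rule AE_I2)
      fix t
      have "\<forall>\<^sub>F n in sequentially. t < real n"
        using filterlim_real_sequentially unfolding filterlim_at_top_dense by blast
      then have "\<forall>\<^sub>F n in sequentially. indicator {..<real n} t * Pk t x = Pk t x"
        by eventually_elim auto
      then show "(\<lambda>n. indicator {..<real n} t * Pk t x) \<longlonglongrightarrow> Pk t x" by (rule tendsto_eventually)
    qed
  qed (auto simp: Pk_integrable part_nonneg indicator_def)
  have lim: "?Dn \<longlonglongrightarrow> S x + P x - b - g x / c"
  proof (rule Lim_transform_eventually)
    show "(\<lambda>n. S x + ?Pn n - (B n - \<phi> 0 * (LINT t:{lam<..<real n}|lborel. \<zeta> t / t ^ DIM('a) / t))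
      - (c * ((LINT t:{0<..<real n}|lborel. (\<zeta> t + \<rho> t) * dilate t \<phi> x / t) - B n)) / c)
      \<longlonglongrightarrow> S x + P x - b - g x / c"
      using c by (intro tendsto_intros Plim limit[OF x] offset) auto
    obtain m :: nat where m: "lam < real m" using reals_Archimedean2 by blast
    show "\<forall>\<^sub>F n in sequentially. S x + ?Pn n - (B n - \<phi> 0 * (LINT t:{lam<..<real n}|lborel. \<zeta> t / t ^ DIM('a) / t))
      - (c * ((LINT t:{0<..<real n}|lborel. (\<zeta> t + \<rho> t) * dilate t \<phi> x / t) - B n)) / c = ?Dn n"
      using eventually_ge_at_top[of m] by eventually_elim (rule key[symmetric], use m in simp)
  qed
  show ?thesis
  proof (rule has_bochner_integral_monotone_convergence[OF iD _ _ lim])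
    show "AE t in lborel. mono (\<lambda>n. ?i n t * Dk t x)"
      by (auto simp: mono_def indicator_def part_nonneg)
    show "AE t in lborel. (\<lambda>n. ?i n t * Dk t x) \<longlonglongrightarrow> Dk t x"
    proof (rule AE_I2)
      fix t
      have "\<forall>\<^sub>F n in sequentially. t < real n"
        using filterlim_real_sequentially unfolding filterlim_at_top_dense by blast
      then have "\<forall>\<^sub>F n in sequentially. ?i n t * Dk t x = Dk t x"
        by eventually_elim (auto simp: Dk_def indicator_def)
      then show "(\<lambda>n. ?i n t * Dk t x) \<longlonglongrightarrow> Dk t x" by (rule tendsto_eventually)
    qed
  qed measurable
qed

lemma Dk_integrable: "integrable lborel (\<lambda>t. Dk t x)"
proof (cases "x = 0")
  case True
  then show ?thesis by (simp add: Dk_def dilate_def)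
next
  case False
  then show ?thesis using has_integral_Dk by (simp add: has_bochner_integral_iff)
qed

lemma potential_decomposition:
  assumes "x \<noteq> 0" shows "g x = c * (S x + P x - D x - b)"
proof -
  have "D x = S x + P x - b - g x / c"
    using has_integral_Dk[OF assms] by (simp add: D_def has_bochner_integral_iff)
  then show ?thesis using c by (simp add: field_simps)
qed

lemma SPD_nonneg: "0 \<le> S x" "0 \<le> P x" "0 \<le> D x"
  unfolding S_def P_def D_def by (auto intro!: Bochner_Integration.integral_nonneg part_nonneg)

lemma P_le: "P x \<le> \<phi> 0 * R"
proof -
  have "P x \<le> (LINT t|lborel. \<phi> 0 * (indicator {0<..} t * (\<rho> t / t ^ DIM('a) / t)))"
    unfolding P_def by (intro integral_mono Pk_integrable \<rho>_int' Pk_bound)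
  also have "\<dots> = \<phi> 0 * R"
    unfolding R_def set_lebesgue_integral_def real_scaleR_def by (rule integral_mult_right_zero)
  finally show ?thesis .
qed

lemma D_nn_integral: "(\<integral>\<^sup>+t. ennreal (Dk t x) \<partial>lborel) = ennreal (D x)"
  unfolding D_def by (intro nn_integral_eq_integral Dk_integrable) (auto simp: part_nonneg)

lemma P_nn_integral: "(\<integral>\<^sup>+t. ennreal (Pk t x) \<partial>lborel) = ennreal (P x)"
  unfolding P_def by (intro nn_integral_eq_integral Pk_integrable) (auto simp: part_nonneg)

text \<open>Inherited from the kernel, whose dilates decrease in the norm.\<close>

lemma D_mono: assumes "norm x \<le> norm y" shows "D x \<le> D y"
  unfolding D_def
proof (rule integral_mono[OF Dk_integrable Dk_integrable])
  fix t
  show "Dk t x \<le> Dk t y"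
    using \<zeta>_nonneg dilate_decr[OF _ assms] lam
    by (auto simp: Dk_def indicator_def intro!: divide_right_mono mult_left_mono)
qed

lemma SPD_measurable [measurable]: "S \<in> borel_measurable borel" "P \<in> borel_measurable borel" "D \<in> borel_measurable borel"
proof -
  have *: "(\<lambda>(x, t). f t x) \<in> borel_measurable (borel \<Otimes>\<^sub>M lborel)" if "(\<lambda>(t, x). f t x) \<in> borel_measurable borel"
    for f :: "real \<Rightarrow> 'a \<Rightarrow> real"
  proof -
    have "(\<lambda>(t, x). f t x) \<in> borel_measurable (borel \<Otimes>\<^sub>M borel)" using that by (simp add: borel_prod)
    then show ?thesis by (simp add: measurable_pair_swap_iff[of _ borel lborel] split_beta')
  qed
  show "S \<in> borel_measurable borel" "P \<in> borel_measurable borel" "D \<in> borel_measurable borel"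
    unfolding S_def[abs_def] P_def[abs_def] D_def[abs_def]
    by (intro lborel.borel_measurable_lebesgue_integral * part_measurable)+
qed

end

section \<open>Lower bound for the modulated energy\<close>

text \<open>The condition on \<open>p\<close> is that the exponent \<open>q\<close> below is positive.\<close>

locale mixture_configuration =
  scale_mixture \<phi> s \<gamma> C\<^sub>\<gamma> \<zeta> \<rho> K c lam b B g + point_configuration N X \<mu>
  for \<phi> :: "'a::euclidean_space \<Rightarrow> real" and s \<gamma> C\<^sub>\<gamma> :: real and \<zeta> \<rho> :: "real \<Rightarrow> real"
    and K c lam b :: real and B :: "real \<Rightarrow> real" and g :: "'a \<Rightarrow> real"
    and N :: nat and X :: "nat \<Rightarrow> 'a" and \<mu> :: "'a \<Rightarrow> real" +
  fixes p :: ennreal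
  assumes p: "ennreal (DIM('a) / (DIM('a) - s)) < p" and \<mu>_Lp: "in_Lp p \<mu>"
begin

definition q :: real where "q = DIM('a) * conj_ratio p - s"
definition A :: real where "A = (LINT y|lborel. \<phi> y powr (1 / conj_ratio p)) powr conj_ratio p"

lemma p_gt_1: "p > 1"
proof -
  have "1 \<le> DIM('a) / (DIM('a) - s)" using s by simp
  then have "1 \<le> ennreal (DIM('a) / (DIM('a) - s))" by (simp add: ennreal_ge_1)
  then show ?thesis using p by (rule le_less_trans)
qed

lemma q_pos: "q > 0"
proof (cases p rule: ennreal_cases)
  case (real P)
  have ds: "DIM('a) - s > 0" using s by simp
  have "DIM('a) / (DIM('a) - s) < P"
    using p real s by (simp add: ennreal_less_iff)
  then have "DIM('a) < P * (DIM('a) - s)" using ds by (simp add: pos_divide_less_eq)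
  moreover have "P > 0" using \<open>DIM('a) / (DIM('a) - s) < P\<close> ds by (smt (verit) divide_nonneg_pos of_nat_0_le_iff)
  ultimately show ?thesis
    unfolding q_def conj_ratio_def using real by (simp add: field_simps)
next
  case top
  then show ?thesis unfolding q_def conj_ratio_def using s by simp
qed

definition H :: real where "H = Lp_norm p \<mu> * A"

lemma H_nonneg: "0 \<le> H" by (simp add: H_def A_def Lp_norm_nonneg)

lemma abs_\<mu>_dilate_integrable:
  assumes t: "t > 0" shows "integrable lborel (\<lambda>y. \<bar>\<mu> y\<bar> * dilate t \<phi> (z - y))"
proof (rule Bochner_Integration.integrable_bound)
  show "integrable lborel (\<lambda>y. \<bar>\<mu> y\<bar> * (\<phi> 0 / t ^ DIM('a)))" using \<mu> by auto
  show "AE y in lborel. norm (\<bar>\<mu> y\<bar> * dilate t \<phi> (z - y)) \<le> norm (\<bar>\<mu> y\<bar> * (\<phi> 0 / t ^ DIM('a)))"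
  proof (rule AE_I2)
    fix y
    have "\<bar>dilate t \<phi> (z - y)\<bar> \<le> \<bar>\<phi> 0 / t ^ DIM('a)\<bar>"
      using dilate_bounds[OF t, of "z - y"] by linarith
    then show "norm (\<bar>\<mu> y\<bar> * dilate t \<phi> (z - y)) \<le> norm (\<bar>\<mu> y\<bar> * (\<phi> 0 / t ^ DIM('a)))"
      unfolding real_norm_def abs_mult by (intro mult_left_mono) auto
  qed
qed measurable

lemma cross_term_le:
  assumes t: "t > 0"
  shows "(LINT y|lborel. \<bar>\<mu> y\<bar> * dilate t \<phi> (z - y)) \<le> H * t powr (DIM('a) * conj_ratio p - DIM('a))"
  unfolding H_def A_def
  by (rule dilate_Hoelder[OF p_gt_1 \<mu> \<mu>_Lp t int nonneg le_at_0])

text \<open>The energies of the kernel at scale \<open>t\<close>, without and with the diagonal.\<close>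

definition reduced_energy :: "real \<Rightarrow> real" where "reduced_energy t = sm_integral \<kappa> (offdiag (dilate t \<phi>))"
definition full_energy :: "real \<Rightarrow> real" where "full_energy t = sm_integral \<kappa> (\<lambda>(x, y). dilate t \<phi> (x - y))"

lemma dilate_abs: "t > 0 \<Longrightarrow> \<bar>dilate t \<phi> x\<bar> \<le> \<phi> 0 / t ^ DIM('a)"
  using dilate_bounds[of t x] by simp

lemma dilate_pd: "t > 0 \<Longrightarrow> 0 \<le> Re (fourier (dilate t \<phi>) \<xi>)"
  using pd by (simp add: dilate_fourier)

lemma full_energy_nonneg: "t > 0 \<Longrightarrow> 0 \<le> full_energy t"
  unfolding full_energy_def
  by (rule energy_ge_spectral(2)[OF \<nu>_borel \<nu>_finite dilate_continuous[OF _ cont] dilate_abs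
        dilate_integrable[OF _ int], where m="\<lambda>_. 0"]) (auto simp: dilate_pd)

lemma reduced_energy_eq: "t > 0 \<Longrightarrow> reduced_energy t = full_energy t - \<phi> 0 / t ^ DIM('a) / real N"
  unfolding reduced_energy_def full_energy_def
  by (subst offdiag_bounded(3)[OF dilate_measurable2(1) dilate_abs]) (auto simp: dilate_def)

lemma reduced_energy_ge_self: "t > 0 \<Longrightarrow> reduced_energy t \<ge> - (\<phi> 0 / t ^ DIM('a) / real N)"
  using reduced_energy_eq full_energy_nonneg by simp

lemma reduced_energy_ge_cross:
  assumes t: "t > 0"
  shows "reduced_energy t \<ge> - 2 * H * t powr (DIM('a) * conj_ratio p - DIM('a))"
proof -
  let ?h = "H * t powr (DIM('a) * conj_ratio p - DIM('a))"
  have "(LINT y|lborel. \<mu> y * dilate t \<phi> (X i - y)) \<le> ?h" for i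
  proof -
    have "(LINT y|lborel. \<mu> y * dilate t \<phi> (X i - y)) \<le> (LINT y|lborel. \<bar>\<mu> y\<bar> * dilate t \<phi> (X i - y))"
      using dilate_bounds[OF t] by (intro integral_mono' abs_\<mu>_dilate_integrable t) (auto intro!: mult_right_mono)
    then show ?thesis using cross_term_le[OF t, of "X i"] by linarith
  qed
  then have "(\<Sum>i<N. LINT y|lborel. \<mu> y * dilate t \<phi> (X i - y)) \<le> real N * ?h"
    using sum_bounded_above[of "{..<N}" "\<lambda>i. LINT y|lborel. \<mu> y * dilate t \<phi> (X i - y)" ?h] by simp
  then have "2 / real N * (\<Sum>i<N. LINT y|lborel. \<mu> y * dilate t \<phi> (X i - y)) \<le> 2 / real N * (real N * ?h)"
    by (intro mult_left_mono) auto
  moreover have "2 / real N * (real N * ?h) = 2 * ?h" using N by simp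
  moreover have "reduced_energy t \<ge> - 2 / real N * (\<Sum>i<N. LINT y|lborel. \<mu> y * dilate t \<phi> (X i - y))"
    unfolding reduced_energy_def
    by (rule offdiag_ge_cross_terms[OF dilate_continuous[OF t cont] dilate_bounds(2)[OF t]
          dilate_bounds(1)[OF t] dilate_integrable[OF t int] dilate_even dilate_pd[OF t]])
  ultimately show ?thesis by simp
qed

lemma \<zeta>_Hoelder:
  assumes "t > 0" shows "\<zeta> t * t powr (DIM('a) * conj_ratio p - DIM('a)) / t \<le> K * t powr (q - 1)"
proof -
  have "\<zeta> t * t powr (DIM('a) * conj_ratio p - DIM('a)) / t
      \<le> K * t powr (DIM('a) - s) * t powr (DIM('a) * conj_ratio p - DIM('a)) / t"
    using assms \<zeta>_upper[of t] by (intro divide_right_mono mult_right_mono) auto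
  also have "\<dots> = K * (t powr (DIM('a) - s) * t powr (DIM('a) * conj_ratio p - DIM('a)) / t powr 1)"
    using assms by simp
  also have "t powr (DIM('a) - s) * t powr (DIM('a) * conj_ratio p - DIM('a)) / t powr 1 = t powr (q - 1)"
    by (simp only: powr_add[symmetric] powr_diff[symmetric] q_def) (simp add: algebra_simps)
  finally show ?thesis .
qed

text \<open>By Tonelli, the mixed terms of all small scales together are bounded uniformly in the position of
the point.\<close>

lemma S_cross: "(\<integral>\<^sup>+y. ennreal \<bar>\<mu> y\<bar> * (\<integral>\<^sup>+t. ennreal (Sk t (z - y)) \<partial>lborel) \<partial>lborel)
    \<le> ennreal (H * K * (lam powr q / q))"
proof -
  have [measurable]: "(\<lambda>(t, y). Sk t (z - y)) \<in> borel_measurable (lborel \<Otimes>\<^sub>M lborel)"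
  proof -
    have "(\<lambda>p. (fst p, z - snd p)) \<in> borel_measurable (borel :: (real \<times> 'a) measure)"
      by (intro borel_measurable_continuous_onI continuous_intros)
    from measurable_compose[OF this part_measurable(1)]
    have "(\<lambda>(t, y). Sk t (z - y)) \<in> borel_measurable (borel \<Otimes>\<^sub>M borel)"
      by (simp add: split_beta' borel_prod)
    then show ?thesis by simp
  qed
  have "(\<integral>\<^sup>+y. ennreal \<bar>\<mu> y\<bar> * (\<integral>\<^sup>+t. ennreal (Sk t (z - y)) \<partial>lborel) \<partial>lborel)
      = (\<integral>\<^sup>+y. (\<integral>\<^sup>+t. ennreal \<bar>\<mu> y\<bar> * ennreal (Sk t (z - y)) \<partial>lborel) \<partial>lborel)"
    by (intro nn_integral_cong nn_integral_cmult[symmetric]) auto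
  also have "\<dots> = (\<integral>\<^sup>+t. (\<integral>\<^sup>+y. ennreal \<bar>\<mu> y\<bar> * ennreal (Sk t (z - y)) \<partial>lborel) \<partial>lborel)"
    by (intro lborel_pair.Fubini') measurable
  also have "\<dots> \<le> (\<integral>\<^sup>+t. ennreal (H * K * (indicator {0<..lam} t * t powr (q - 1))) \<partial>lborel)"
  proof (rule nn_integral_mono)
    fix t
    show "(\<integral>\<^sup>+y. ennreal \<bar>\<mu> y\<bar> * ennreal (Sk t (z - y)) \<partial>lborel) \<le> ennreal (H * K * (indicator {0<..lam} t * t powr (q - 1)))"
    proof (cases "t \<in> {0<..lam}")
      case True
      then have t: "t > 0" by simp
      have z: "0 \<le> \<zeta> t / t" using t \<zeta>_nonneg[OF t] by simp
      have "(\<integral>\<^sup>+y. ennreal \<bar>\<mu> y\<bar> * ennreal (Sk t (z - y)) \<partial>lborel)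
          = (\<integral>\<^sup>+y. ennreal (\<zeta> t / t * (\<bar>\<mu> y\<bar> * dilate t \<phi> (z - y))) \<partial>lborel)"
        using True by (intro nn_integral_cong) (simp add: Sk_def ennreal_mult'[symmetric] mult_ac)
      also have "\<dots> = ennreal (LINT y|lborel. \<zeta> t / t * (\<bar>\<mu> y\<bar> * dilate t \<phi> (z - y)))"
        using abs_\<mu>_dilate_integrable[OF t, of z] z dilate_bounds(1)[OF t]
        by (intro nn_integral_eq_integral integrable_mult_right AE_I2 mult_nonneg_nonneg) auto
      also have "\<dots> = ennreal (\<zeta> t / t * (LINT y|lborel. \<bar>\<mu> y\<bar> * dilate t \<phi> (z - y)))"
        by (simp only: integral_mult_right_zero)
      also have "\<dots> \<le> ennreal (\<zeta> t / t * (H * t powr (DIM('a) * conj_ratio p - DIM('a))))"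
        by (intro ennreal_leI mult_left_mono cross_term_le t z)
      also have "\<dots> = ennreal (H * (\<zeta> t * t powr (DIM('a) * conj_ratio p - DIM('a)) / t))"
        by (simp add: mult_ac)
      also have "\<dots> \<le> ennreal (H * (K * t powr (q - 1)))"
        by (intro ennreal_leI mult_left_mono \<zeta>_Hoelder t H_nonneg)
      finally show ?thesis using True by (simp add: mult.assoc)
    qed (simp add: Sk_def)
  qed
  also have "\<dots> = ennreal (LINT t|lborel. H * K * (indicator {0<..lam} t * t powr (q - 1)))"
    using powr_integral_near_0[OF q_pos, of lam] lam H_nonneg K
    by (intro nn_integral_eq_integral integrable_mult_right AE_I2) (auto simp: has_bochner_integral_iff indicator_def)
  also have "\<dots> = ennreal (H * K * (lam powr q / q))"
    using powr_integral_near_0[OF q_pos, of lam] lam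
    by (simp only: integral_mult_right_zero) (simp add: has_bochner_integral_iff)
  finally show ?thesis .
qed

lemma double_from_cross:
  assumes "\<And>x. F x \<le> ennreal M"
  shows "(\<integral>\<^sup>+x. ennreal \<bar>\<mu> x\<bar> * F x \<partial>lborel) < \<infinity>"
proof -
  have "(\<integral>\<^sup>+x. ennreal \<bar>\<mu> x\<bar> * F x \<partial>lborel) \<le> (\<integral>\<^sup>+x. ennreal \<bar>\<mu> x\<bar> * ennreal M \<partial>lborel)"
    by (intro nn_integral_mono mult_left_mono assms) auto
  also have "\<dots> = (\<integral>\<^sup>+x. ennreal \<bar>\<mu> x\<bar> \<partial>lborel) * ennreal M"
    by (rule nn_integral_multc) measurable
  also have "\<dots> < \<infinity>" using \<mu>_norm_finite by (simp add: ennreal_mult_less_top)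
  finally show ?thesis .
qed

lemma cross_from_bounded:
  assumes "\<And>x. F x \<le> ennreal M"
  shows "(\<integral>\<^sup>+y. ennreal \<bar>\<mu> y\<bar> * F (z - y) \<partial>lborel) \<le> ennreal ((LINT y|lborel. \<bar>\<mu> y\<bar>) * M)"
    and "0 \<le> M \<Longrightarrow> (\<integral>\<^sup>+y. ennreal \<bar>\<mu> y\<bar> * F (z - y) \<partial>lborel) < \<infinity>"
proof -
  have "(\<integral>\<^sup>+y. ennreal \<bar>\<mu> y\<bar> * F (z - y) \<partial>lborel) \<le> (\<integral>\<^sup>+y. ennreal \<bar>\<mu> y\<bar> * ennreal M \<partial>lborel)"
    by (intro nn_integral_mono mult_left_mono assms) auto
  also have "\<dots> = (\<integral>\<^sup>+y. ennreal \<bar>\<mu> y\<bar> \<partial>lborel) * ennreal M"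
    by (rule nn_integral_multc) measurable
  also have "(\<integral>\<^sup>+y. ennreal \<bar>\<mu> y\<bar> \<partial>lborel) = ennreal (LINT y|lborel. \<bar>\<mu> y\<bar>)"
    using \<mu> by (intro nn_integral_eq_integral) auto
  finally show 1: "(\<integral>\<^sup>+y. ennreal \<bar>\<mu> y\<bar> * F (z - y) \<partial>lborel) \<le> ennreal ((LINT y|lborel. \<bar>\<mu> y\<bar>) * M)"
    by (simp add: ennreal_mult')
  then show "(\<integral>\<^sup>+y. ennreal \<bar>\<mu> y\<bar> * F (z - y) \<partial>lborel) < \<infinity>"
    by (rule le_less_trans) simp
qed

text \<open>Small scales are estimated by the mixed terms alone.\<close>

lemma S_energy:
  shows "sm_integrable \<kappa> (offdiag S)"
    and "sm_integral \<kappa> (offdiag S) \<ge> - 2 * H * K * (lam powr q / q)"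
proof -
  have cross: "(\<integral>\<^sup>+y. ennreal \<bar>\<mu> y\<bar> * (\<integral>\<^sup>+t. ennreal (Sk t (z - y)) \<partial>lborel) \<partial>lborel) < \<infinity>" for z
    by (rule le_less_trans[OF S_cross]) simp
  note * = offdiag_mixture[OF part_measurable(1) part_nonneg(1) part_even(1) Sk_integrable cross
      double_from_cross[OF S_cross], folded S_def]
  show "sm_integrable \<kappa> (offdiag S)" using *(3) .
  have eq: "sm_integral \<kappa> (offdiag (Sk t)) = indicator {0<..lam} t * (\<zeta> t * reduced_energy t / t)" for t
  proof -
    have "offdiag (Sk t) = (\<lambda>z. (indicator {0<..lam} t * \<zeta> t / t) *\<^sub>R offdiag (dilate t \<phi>) z)"
      by (auto simp: offdiag_def Sk_def fun_eq_iff)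
    then show ?thesis by (simp only: sm_integral_scaleR reduced_energy_def) simp
  qed
  have i: "has_bochner_integral lborel (\<lambda>t. (- 2 * H * K) * (indicator {0<..lam} t * t powr (q - 1))) ((- 2 * H * K) * (lam powr q / q))"
    using powr_integral_near_0[OF q_pos, of lam] lam by (intro has_bochner_integral_mult_right) auto
  have "(- 2 * H * K) * (lam powr q / q) = (LINT t|lborel. (- 2 * H * K) * (indicator {0<..lam} t * t powr (q - 1)))"
    using i by (simp add: has_bochner_integral_iff)
  also have "\<dots> \<le> (LINT t|lborel. indicator {0<..lam} t * (\<zeta> t * reduced_energy t / t))"
  proof (rule integral_mono)
    show "integrable lborel (\<lambda>t. (- 2 * H * K) * (indicator {0<..lam} t * t powr (q - 1)))"
      using i by (simp add: has_bochner_integral_iff)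
    show "integrable lborel (\<lambda>t. indicator {0<..lam} t * (\<zeta> t * reduced_energy t / t))"
      using *(2) by (simp add: eq)
    fix t
    show "(- 2 * H * K) * (indicator {0<..lam} t * t powr (q - 1)) \<le> indicator {0<..lam} t * (\<zeta> t * reduced_energy t / t)"
    proof (cases "t \<in> {0<..lam}")
      case True
      then have t: "t > 0" by simp
      have "2 * H * (\<zeta> t * t powr (DIM('a) * conj_ratio p - DIM('a)) / t) \<le> 2 * H * (K * t powr (q - 1))"
        using H_nonneg by (intro mult_left_mono \<zeta>_Hoelder t) auto
      moreover have "\<zeta> t / t * (- 2 * H * t powr (DIM('a) * conj_ratio p - DIM('a))) \<le> \<zeta> t / t * reduced_energy t"
        using t \<zeta>_nonneg[OF t] by (intro mult_left_mono reduced_energy_ge_cross) auto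
      ultimately show ?thesis using True by (simp add: mult_ac)
    qed simp
  qed
  finally show "sm_integral \<kappa> (offdiag S) \<ge> - 2 * H * K * (lam powr q / q)"
    using *(1) by (simp add: eq)
qed

text \<open>The perturbation is estimated at all scales by positivity of the full energy. The loss \<open>\<phi> 0 * R / N\<close> is
independent of \<open>\<mu>\<close>, whereas an estimate by the mixed terms would bring in a product of \<open>R\<close> and the norm
of \<open>\<mu>\<close>.\<close>

lemma P_energy:
  shows "sm_integrable \<kappa> (offdiag P)"
    and "sm_integral \<kappa> (offdiag P) \<ge> - (\<phi> 0 * R / real N)"
proof -
  have R0: "0 \<le> R" unfolding R_def set_lebesgue_integral_def
    using \<rho>_nonneg by (intro Bochner_Integration.integral_nonneg) (auto simp: indicator_def)
  have le: "(\<integral>\<^sup>+t. ennreal (Pk t x) \<partial>lborel) \<le> ennreal (\<phi> 0 * R)" for x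
    unfolding P_nn_integral by (intro ennreal_leI P_le)
  have M0: "0 \<le> \<phi> 0 * R" using R0 pos by simp
  note * = offdiag_mixture[OF part_measurable(2) part_nonneg(2) part_even(2) Pk_integrable
      cross_from_bounded(2)[OF le M0] double_from_cross[OF cross_from_bounded(1)[OF le]], folded P_def]
  show "sm_integrable \<kappa> (offdiag P)" using *(3) .
  have eq: "sm_integral \<kappa> (offdiag (Pk t)) = indicator {0<..} t * (\<rho> t * reduced_energy t / t)" for t
  proof -
    have "offdiag (Pk t) = (\<lambda>z. (indicator {0<..} t * \<rho> t / t) *\<^sub>R offdiag (dilate t \<phi>) z)"
      by (auto simp: offdiag_def Pk_def fun_eq_iff)
    then show ?thesis by (simp only: sm_integral_scaleR reduced_energy_def) simp
  qed
  have "- (\<phi> 0 * R / real N) = (LINT t|lborel. (- 1 / real N) * (\<phi> 0 * (indicator {0<..} t * (\<rho> t / t ^ DIM('a) / t))))"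
    unfolding R_def set_lebesgue_integral_def real_scaleR_def integral_mult_right_zero by simp
  also have "\<dots> \<le> (LINT t|lborel. indicator {0<..} t * (\<rho> t * reduced_energy t / t))"
  proof (rule integral_mono)
    show "integrable lborel (\<lambda>t. (- 1 / real N) * (\<phi> 0 * (indicator {0<..} t * (\<rho> t / t ^ DIM('a) / t))))"
      by (rule integrable_mult_right[OF \<rho>_int'])
    show "integrable lborel (\<lambda>t. indicator {0<..} t * (\<rho> t * reduced_energy t / t))"
      using *(2) by (simp add: eq)
    fix t
    show "(- 1 / real N) * (\<phi> 0 * (indicator {0<..} t * (\<rho> t / t ^ DIM('a) / t))) \<le> indicator {0<..} t * (\<rho> t * reduced_energy t / t)"
    proof (cases "t > 0")
      case True
      have "\<rho> t / t * - (\<phi> 0 / t ^ DIM('a) / real N) \<le> \<rho> t / t * reduced_energy t"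
        using True \<rho>_nonneg by (intro mult_left_mono reduced_energy_ge_self) auto
      then show ?thesis using True by (simp add: mult_ac)
    qed simp
  qed
  finally show "sm_integral \<kappa> (offdiag P) \<ge> - (\<phi> 0 * R / real N)"
    using *(1) by (simp add: eq)
qed

text \<open>At a fixed scale the deficit vanishes on the diagonal and differs from the negative of the kernel by a
constant, which has no energy because the total mass is zero. So its energy is the negative of the full
energy. Of all scales above \<open>lam\<close>, only those between 1 and 2 are kept; this is where \<open>lam \<le> 1\<close>
enters.\<close>

lemma D_energy:
  assumes D_cross: "\<And>i. i < N \<Longrightarrow> (\<integral>\<^sup>+y. ennreal \<bar>\<mu> y\<bar> * ennreal (D (X i - y)) \<partial>lborel) < \<infinity>"
    and D_double: "(\<integral>\<^sup>+x. ennreal \<bar>\<mu> x\<bar> * (\<integral>\<^sup>+y. ennreal \<bar>\<mu> y\<bar> * ennreal (D (x - y)) \<partial>lborel) \<partial>lborel) < \<infinity>"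
    and Q: "\<And>t. 1 \<le> t \<Longrightarrow> t \<le> 2 \<Longrightarrow> Q \<le> full_energy t" "0 \<le> Q"
  shows "sm_integrable \<kappa> (offdiag D)"
    and "- sm_integral \<kappa> (offdiag D) \<ge> Q / (2 * K)"
proof -
  note * = offdiag_mixture[OF part_measurable(3) part_nonneg(3) part_even(3) Dk_integrable,
      unfolded D_nn_integral, OF D_cross D_double, folded D_def]
  show "sm_integrable \<kappa> (offdiag D)" using *(3) .
  have eq: "sm_integral \<kappa> (offdiag (Dk t)) = - (indicator {lam<..} t * (\<zeta> t * full_energy t / t))" for t
  proof (cases "t > lam")
    case True
    then have t: "t > 0" using lam by simp
    let ?h = "\<lambda>x. \<phi> 0 / t ^ DIM('a) - dilate t \<phi> x"
    have b: "\<bar>?h x\<bar> \<le> \<phi> 0 / t ^ DIM('a)" for x using dilate_bounds[OF t, of x] by simp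
    have m: "?h \<in> borel_measurable borel" by measurable
    \<comment> \<open>the deficit vanishes at the origin, so the diagonal may be restored at no cost\<close>
    have "sm_integral \<kappa> (offdiag ?h) = sm_integral \<kappa> (\<lambda>(x, y). ?h (x - y))"
      using offdiag_bounded(3)[OF m b] by (simp add: dilate_def)
    also have "\<dots> = sm_integral \<kappa> (\<lambda>z. (\<phi> 0 / t ^ DIM('a)) *\<^sub>R 1 - (case z of (x, y) \<Rightarrow> dilate t \<phi> (x - y)))"
      by (rule arg_cong[where f="sm_integral \<kappa>"]) auto
    also have "\<dots> = sm_integral \<kappa> (\<lambda>z. (\<phi> 0 / t ^ DIM('a)) *\<^sub>R 1) - full_energy t"
      unfolding full_energy_def
      by (intro sm_integral_diff \<kappa>_borel sm_integrable_bounded[OF \<kappa>_borel \<kappa>_finite]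
           offdiag_bounded(1)[OF dilate_measurable2(1) dilate_abs[OF t]]) auto
    also have "\<dots> = - full_energy t" by (simp only: sm_integral_scaleR total_mass) simp
    finally have h: "sm_integral \<kappa> (offdiag ?h) = - full_energy t" .
    have "offdiag (Dk t) = (\<lambda>z. (\<zeta> t / t) *\<^sub>R offdiag ?h z)"
      using True by (auto simp: offdiag_def Dk_def fun_eq_iff)
    then show ?thesis using True by (simp only: sm_integral_scaleR h) simp
  next
    case False
    then have "offdiag (Dk t) = (\<lambda>z. 0 *\<^sub>R 0)" by (auto simp: offdiag_def Dk_def fun_eq_iff)
    then show ?thesis using False by (simp only: sm_integral_scaleR) simp
  qed
  have "Q / (2 * K) = (LINT t|lborel. Q / (2 * K) * indicator {1<..2::real} t)" by simp
  also have "\<dots> \<le> (LINT t|lborel. indicator {lam<..} t * (\<zeta> t * full_energy t / t))"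
  proof (rule integral_mono)
    show "integrable lborel (\<lambda>t. Q / (2 * K) * indicator {1<..2::real} t)" by (intro integrable_mult_right) auto
    show "integrable lborel (\<lambda>t. indicator {lam<..} t * (\<zeta> t * full_energy t / t))"
      using *(2) by (simp add: eq)
    fix t :: real
    show "Q / (2 * K) * indicator {1<..2::real} t \<le> indicator {lam<..} t * (\<zeta> t * full_energy t / t)"
    proof (cases "t \<in> {1<..2}")
      case True
      then have t: "t > 0" "t > lam" "1 \<le> t" "t \<le> 2" using lam by auto
      have "1 \<le> t powr (DIM('a) - s)" using t s by (intro ge_one_powr_ge_zero) auto
      then have "1 / K \<le> \<zeta> t" using \<zeta>_lower[OF t(1)] K by (meson divide_right_mono less_imp_le order_trans)
      moreover have "1 / 2 \<le> 1 / t" using t by (simp add: field_simps)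
      ultimately have "(1 / K) * (1 / 2) \<le> \<zeta> t * (1 / t)"
        using K t \<zeta>_nonneg by (intro mult_mono) auto
      then have "(1 / K) * (1 / 2) * Q \<le> \<zeta> t * (1 / t) * full_energy t"
        by (rule mult_mono[OF _ Q(1)[OF t(3,4)]]) (use Q(2) t \<zeta>_nonneg[OF t(1)] in auto)
      then show ?thesis using True t by (simp add: mult_ac)
    next
      case False
      then show ?thesis using lam \<zeta>_nonneg full_energy_nonneg by (auto simp: indicator_def)
    qed
  qed
  finally show "- sm_integral \<kappa> (offdiag D) \<ge> Q / (2 * K)" using *(1) by (simp add: eq)
qed

text \<open>The three parts and the constant \<open>b\<close> are added up; \<open>b\<close> contributes through the mass \<open>- 1 / N\<close> off the
diagonal.\<close>

theorem modulated_energy_ge: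
  assumes D_cross: "\<And>i. i < N \<Longrightarrow> (\<integral>\<^sup>+y. ennreal \<bar>\<mu> y\<bar> * ennreal (D (X i - y)) \<partial>lborel) < \<infinity>"
    and D_double: "(\<integral>\<^sup>+x. ennreal \<bar>\<mu> x\<bar> * (\<integral>\<^sup>+y. ennreal \<bar>\<mu> y\<bar> * ennreal (D (x - y)) \<partial>lborel) \<partial>lborel) < \<infinity>"
    and Q: "\<And>t. 1 \<le> t \<Longrightarrow> t \<le> 2 \<Longrightarrow> Q \<le> full_energy t" "0 \<le> Q"
  shows "2 * modulated_energy g N X \<mu>
    \<ge> c * (Q / (2 * K) - 2 * H * K * (lam powr q / q) - \<phi> 0 * R / real N + b / real N)"
proof -
  note Si = S_energy(1) and Pi = P_energy(1) 
  note D = D_energy[OF D_cross D_double Q]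
  note i1 = offdiag_bounded(2)[of "\<lambda>_. 1" 1, simplified]
  have eq: "offdiag g = (\<lambda>z. c *\<^sub>R (((offdiag S z + offdiag P z) - offdiag D z) - b *\<^sub>R offdiag (\<lambda>_. 1) z))"
    using potential_decomposition by (auto simp: offdiag_def fun_eq_iff)
  have "2 * modulated_energy g N X \<mu> = sm_integral \<kappa> (offdiag g)"
    by (simp add: modulated_energy_def offdiag_def)
  also have "\<dots> = c * (sm_integral \<kappa> (offdiag S) + sm_integral \<kappa> (offdiag P) - sm_integral \<kappa> (offdiag D)
      - b * sm_integral \<kappa> (offdiag (\<lambda>_. 1)))"
  proof -
    note SP = sm_integrable_add[OF \<kappa>_borel Si Pi]
    note SPi = sm_integral_add[OF \<kappa>_borel Si Pi]
    note SPD = sm_integrable_add[OF \<kappa>_borel SP sm_integrable_scaleR[OF \<kappa>_borel D(1), of "- 1"]]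
    note SPDi = sm_integral_diff[OF \<kappa>_borel SP D(1)]
    have "sm_integrable \<kappa> (\<lambda>z. (offdiag S z + offdiag P z) - offdiag D z)" using SPD by simp
    from sm_integral_diff[OF \<kappa>_borel this sm_integrable_scaleR[OF \<kappa>_borel i1, of b]]
    show ?thesis unfolding eq sm_integral_scaleR by (simp add: SPDi SPi sm_integral_scaleR[where 'b=real, simplified])
  qed
  also have "\<dots> \<ge> c * (Q / (2 * K) - 2 * H * K * (lam powr q / q) - \<phi> 0 * R / real N + b / real N)"
    using S_energy(2) P_energy(2) D(2) c by (intro mult_left_mono) (auto simp: offdiag_one)
  finally show ?thesis .
qed

end

lemma jbracket_pos: "0 < jbracket x" "1 \<le> jbracket x"
  by (auto simp: jbracket_def add_pos_nonneg)

lemma jbracket_measurable [measurable]: "(jbracket :: 'a::real_normed_vector \<Rightarrow> real) \<in> borel_measurable borel"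
  unfolding jbracket_def[abs_def] by (intro borel_measurable_continuous_onI continuous_intros)

lemma jbracket_scaleR_le:
  assumes "1 \<le> t" "t \<le> 2" shows "jbracket (t *\<^sub>R x) \<le> 2 * jbracket x"
proof -
  have "(t * norm x)\<^sup>2 \<le> (2 * norm x)\<^sup>2"
    using assms by (intro power_mono mult_right_mono) auto
  then have "1 + (t * norm x)\<^sup>2 \<le> 2\<^sup>2 * (1 + (norm x)\<^sup>2)" by (simp add: power_mult_distrib)
  then have "sqrt (1 + (t * norm x)\<^sup>2) \<le> sqrt (2\<^sup>2 * (1 + (norm x)\<^sup>2))" by (rule real_sqrt_le_mono)
  also have "\<dots> = 2 * sqrt (1 + (norm x)\<^sup>2)" by (subst real_sqrt_mult) simp
  finally show ?thesis using assms by (simp add: jbracket_def)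
qed

lemma sobolev_norm_sq_nonneg: "0 \<le> sobolev_norm_sq \<sigma> \<nu>"
  unfolding sobolev_norm_sq_def by (intro Bochner_Integration.integral_nonneg) simp

context mixture_configuration begin

text \<open>For scales between 1 and 2 the weight \<open>jbracket (t *\<^sub>R \<xi>) powr (- r)\<close> is comparable to the one
at scale 1.\<close>

lemma spectral_lower:
  assumes C: "C\<^sub>\<phi> > 0" "r \<ge> 0" and f: "\<And>\<xi>. C\<^sub>\<phi> * jbracket \<xi> powr (- r) \<le> Re (fourier \<phi> \<xi>)"
    and t: "1 \<le> t" "t \<le> 2"
  shows "C\<^sub>\<phi> * 2 powr (- r) * sobolev_norm_sq (- r / 2) \<nu> \<le> full_energy t"
proof -
  let ?a = "C\<^sub>\<phi> * 2 powr (- r)"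
  define m where "m \<xi> = ?a * jbracket \<xi> powr (- r)" for \<xi> :: 'a
  have t0: "t > 0" using t by simp
  have m1: "m \<xi> \<le> Re (fourier (dilate t \<phi>) \<xi>)" for \<xi>
  proof -
    have "(2 * jbracket \<xi>) powr (- r) \<le> jbracket (t *\<^sub>R \<xi>) powr (- r)"
      using C jbracket_scaleR_le[OF t] jbracket_pos by (intro powr_mono2') auto
    then have "m \<xi> \<le> C\<^sub>\<phi> * jbracket (t *\<^sub>R \<xi>) powr (- r)"
      using C jbracket_pos(1)[of \<xi>] by (simp add: m_def powr_mult)
    also have "\<dots> \<le> Re (fourier (dilate t \<phi>) \<xi>)" using f[of "t *\<^sub>R \<xi>"] t0 by (simp add: dilate_fourier)
    finally show ?thesis .
  qed
  have mm: "m \<in> borel_measurable borel" unfolding m_def[abs_def] by measurable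
  have m0: "0 \<le> m \<xi>" for \<xi> using C by (simp add: m_def)
  note [measurable] = mm sm_fourier_measurable[OF \<nu>_borel]
  have le: "(\<integral>\<^sup>+\<xi>. ennreal (m \<xi> * (cmod (sm_fourier \<nu> \<xi>))\<^sup>2) \<partial>lborel) \<le> ennreal (full_energy t)"
    unfolding full_energy_def
    by (rule energy_ge_spectral(1)[OF \<nu>_borel \<nu>_finite dilate_continuous[OF t0 cont] dilate_abs[OF t0]
        dilate_integrable[OF t0 int] mm m0 m1])
  have "?a * sobolev_norm_sq (- r / 2) \<nu> = (LINT \<xi>|lborel. m \<xi> * (cmod (sm_fourier \<nu> \<xi>))\<^sup>2)"
    unfolding sobolev_norm_sq_def m_def by (subst integral_mult_right_zero[symmetric]) (simp add: mult_ac)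
  also have "\<dots> = enn2real (\<integral>\<^sup>+\<xi>. ennreal (m \<xi> * (cmod (sm_fourier \<nu> \<xi>))\<^sup>2) \<partial>lborel)"
    using m0 by (intro integral_eq_nn_integral) auto
  also have "\<dots> \<le> full_energy t" using le full_energy_nonneg[OF t0] by (intro enn2real_leI) auto
  finally show ?thesis .
qed

end

section \<open>Integrability of the large-scale part\<close>

context mixture_configuration begin

lemma D_finite_if_bounded:
  assumes "\<And>x. D x \<le> M"
  shows "(\<integral>\<^sup>+y. ennreal \<bar>\<mu> y\<bar> * ennreal (D (z - y)) \<partial>lborel) < \<infinity>"
    and "(\<integral>\<^sup>+x. ennreal \<bar>\<mu> x\<bar> * (\<integral>\<^sup>+y. ennreal \<bar>\<mu> y\<bar> * ennreal (D (x - y)) \<partial>lborel) \<partial>lborel) < \<infinity>"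
proof -
  have le: "ennreal (D x) \<le> ennreal M" for x by (intro ennreal_leI assms)
  have M: "0 \<le> M" using SPD_nonneg(3)[of 0] assms[of 0] by linarith
  show "(\<integral>\<^sup>+y. ennreal \<bar>\<mu> y\<bar> * ennreal (D (z - y)) \<partial>lborel) < \<infinity>"
    by (rule cross_from_bounded(2)[of "\<lambda>x. ennreal (D x)", OF le M])
  show "(\<integral>\<^sup>+x. ennreal \<bar>\<mu> x\<bar> * (\<integral>\<^sup>+y. ennreal \<bar>\<mu> y\<bar> * ennreal (D (x - y)) \<partial>lborel) \<partial>lborel) < \<infinity>"
    by (rule double_from_cross[OF cross_from_bounded(1)[of "\<lambda>x. ennreal (D x)", OF le]])
qed

lemma potential_measurable [measurable]: "g \<in> borel_measurable borel"
proof -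
  have "(\<lambda>x. if x = 0 then g 0 else c * (S x + P x - D x - b)) \<in> borel_measurable borel"
    by measurable
  also have "(\<lambda>x. if x = 0 then g 0 else c * (S x + P x - D x - b)) = g"
    using potential_decomposition by auto
  finally show ?thesis .
qed

text \<open>The decomposition of the potential, read as a bound for \<open>D\<close>.\<close>

lemma D_le_potential:
  assumes "x \<noteq> 0"
  shows "ennreal (D x) \<le> (\<integral>\<^sup>+t. ennreal (Sk t x) \<partial>lborel) + ennreal (\<phi> 0 * R + \<bar>b\<bar>) + ennreal (\<bar>g x\<bar> / c)"
proof -
  have "g x / c = S x + P x - D x - b" using potential_decomposition[OF assms] c by simp
  then have "D x = S x + P x - b - g x / c" by linarith
  also have "\<dots> \<le> S x + (\<phi> 0 * R + \<bar>b\<bar>) + \<bar>g x\<bar> / c"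
  proof -
    have "- (g x / c) \<le> \<bar>g x\<bar> / c" using divide_right_mono[of "- g x" "\<bar>g x\<bar>" c] c by simp
    then show ?thesis using P_le[of x] by linarith
  qed
  finally have "ennreal (D x) \<le> ennreal (S x + (\<phi> 0 * R + \<bar>b\<bar>) + \<bar>g x\<bar> / c)" by (rule ennreal_leI)
  also have "\<dots> = ennreal (S x) + ennreal (\<phi> 0 * R + \<bar>b\<bar>) + ennreal (\<bar>g x\<bar> / c)"
    using SPD_nonneg[of x] P_le[of x] c by (simp add: ennreal_plus)
  also have "ennreal (S x) = (\<integral>\<^sup>+t. ennreal (Sk t x) \<partial>lborel)"
    unfolding S_def by (intro nn_integral_eq_integral[symmetric] Sk_integrable assms) (simp add: part_nonneg)
  finally show ?thesis .
qed

lemma D_convolution_le: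
  "(\<integral>\<^sup>+y. ennreal \<bar>\<mu> y\<bar> * ennreal (D (z - y)) \<partial>lborel)
    \<le> ennreal (H * K * (lam powr q / q)) + ennreal ((LINT y|lborel. \<bar>\<mu> y\<bar>) * (\<phi> 0 * R + \<bar>b\<bar>))
      + (\<integral>\<^sup>+y. ennreal \<bar>\<mu> y\<bar> * ennreal (\<bar>g (z - y)\<bar> / c) \<partial>lborel)"
proof -
  let ?M = "\<phi> 0 * R + \<bar>b\<bar>" and ?S = "\<lambda>x. \<integral>\<^sup>+t. ennreal (Sk t x) \<partial>lborel"
  have Sm: "?S \<in> borel_measurable borel"
  proof -
    have [measurable]: "(\<lambda>(t, x). Sk t x) \<in> borel_measurable (borel \<Otimes>\<^sub>M borel)" using part_measurable(1) by (simp add: borel_prod)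
    have [measurable]: "(\<lambda>(x, t). Sk t x) \<in> borel_measurable (borel \<Otimes>\<^sub>M lborel)"
      by (simp add: measurable_pair_swap_iff[of _ borel lborel] split_beta')
    show ?thesis by measurable
  qed
  have [measurable]: "(\<lambda>y. ?S (z - y)) \<in> borel_measurable borel" by (rule measurable_compose[OF _ Sm]) measurable
  have "(\<integral>\<^sup>+y. ennreal \<bar>\<mu> y\<bar> * ennreal (D (z - y)) \<partial>lborel)
      \<le> (\<integral>\<^sup>+y. ennreal \<bar>\<mu> y\<bar> * (?S (z - y) + ennreal ?M + ennreal (\<bar>g (z - y)\<bar> / c)) \<partial>lborel)"
  proof (rule nn_integral_mono_AE)
    show "AE y in lborel. ennreal \<bar>\<mu> y\<bar> * ennreal (D (z - y))
        \<le> ennreal \<bar>\<mu> y\<bar> * (?S (z - y) + ennreal ?M + ennreal (\<bar>g (z - y)\<bar> / c))"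
      using AE_lborel_singleton[of z] by eventually_elim (intro mult_left_mono D_le_potential, auto)
  qed
  also have "\<dots> = (\<integral>\<^sup>+y. ennreal \<bar>\<mu> y\<bar> * ?S (z - y) \<partial>lborel) + (\<integral>\<^sup>+y. ennreal \<bar>\<mu> y\<bar> * ennreal ?M \<partial>lborel)
      + (\<integral>\<^sup>+y. ennreal \<bar>\<mu> y\<bar> * ennreal (\<bar>g (z - y)\<bar> / c) \<partial>lborel)"
    by (simp add: distrib_left nn_integral_add)
  also have "\<dots> \<le> ennreal (H * K * (lam powr q / q)) + ennreal ((LINT y|lborel. \<bar>\<mu> y\<bar>) * ?M)
      + (\<integral>\<^sup>+y. ennreal \<bar>\<mu> y\<bar> * ennreal (\<bar>g (z - y)\<bar> / c) \<partial>lborel)"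
    using cross_from_bounded(1)[of "\<lambda>_. ennreal ?M" ?M z]
    by (intro add_mono S_cross order_refl) simp
  finally show ?thesis .
qed

end

text \<open>The case \<open>s = 0\<close>, in which the unperturbed density is exactly a power and therefore scale invariant.\<close>

locale log_mixture_configuration = mixture_configuration \<phi> s \<gamma> C\<^sub>\<gamma> \<zeta> \<rho> K c lam b B g N X \<mu> p
  for \<phi> :: "'a::euclidean_space \<Rightarrow> real" and s \<gamma> C\<^sub>\<gamma> :: real and \<zeta> \<rho> :: "real \<Rightarrow> real"
    and K c lam b :: real and B :: "real \<Rightarrow> real" and g :: "'a \<Rightarrow> real"
    and N :: nat and X :: "nat \<Rightarrow> 'a" and \<mu> :: "'a \<Rightarrow> real" and p :: ennreal +
  assumes \<zeta>_power: "\<And>t. t > 0 \<Longrightarrow> \<zeta> t = t ^ DIM('a)"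
    and g_double: "integrable (lborel \<Otimes>\<^sub>M lborel) (\<lambda>(x, y). \<bar>g (x - y)\<bar> * (\<bar>\<mu> x\<bar> * \<bar>\<mu> y\<bar>))"
begin

lemma Dk_log: "Dk t x = indicator {lam<..} t * ((\<phi> 0 - \<phi> (x /\<^sub>R t)) / t)"
proof (cases "t > lam")
  case True
  then have "t > 0" using lam by simp
  then show ?thesis using True by (simp add: Dk_def \<zeta>_power dilate_def field_simps)
qed (simp add: Dk_def)

text \<open>The density of \<open>D\<close> depends on \<open>v\<close> and \<open>t\<close> through the measure \<open>dt / t\<close> and the quotient of \<open>v\<close> by \<open>t\<close> only.
So doubling \<open>v\<close> amounts to starting the integral at \<open>lam / 2\<close> instead of \<open>lam\<close>, which adds at most the
integral of \<open>\<phi> 0 / t\<close>, and this is at most \<open>\<phi> 0\<close>.\<close>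

lemma D_doubling: "D (2 *\<^sub>R v) \<le> D v + \<phi> 0"
proof -
  let ?G = "\<lambda>u. (\<phi> 0 - \<phi> (v /\<^sub>R u)) / u"
  have "D (2 *\<^sub>R v) = \<bar>2\<bar> ^ DIM(real) *\<^sub>R (LINT u|lborel. Dk (0 + 2 *\<^sub>R u) (2 *\<^sub>R v))"
    unfolding D_def by (intro lborel_integral_affine) auto
  also have "\<dots> = (LINT u|lborel. 2 * Dk (2 * u) (2 *\<^sub>R v))" by simp
  also have "\<dots> = (LINT u|lborel. indicator {lam / 2<..} u * ?G u)"
    by (intro Bochner_Integration.integral_cong refl) (auto simp: Dk_log indicator_def)
  also have "\<dots> \<le> (LINT u|lborel. Dk u v + \<phi> 0 * (2 / lam) * indicator {lam / 2<..lam} u)"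
  proof (rule integral_mono')
    show "integrable lborel (\<lambda>u. Dk u v + \<phi> 0 * (2 / lam) * indicator {lam / 2<..lam} u)"
      using lam by (intro Bochner_Integration.integrable_add Dk_integrable integrable_mult_right) auto
    fix u
    have b: "0 \<le> \<phi> 0 * (2 / lam) * indicator {lam / 2<..lam} u" using pos lam by (simp add: indicator_def)
    then show "0 \<le> Dk u v + \<phi> 0 * (2 / lam) * indicator {lam / 2<..lam} u" using part_nonneg(3)[of u v] by simp
    show "indicator {lam / 2<..} u * ?G u \<le> Dk u v + \<phi> 0 * (2 / lam) * indicator {lam / 2<..lam} u"
    proof (cases "u \<in> {lam / 2<..lam}")
      case True
      then have u: "u > 0" "1 / u \<le> 2 / lam" using lam by (auto simp: field_simps)
      have "?G u \<le> \<phi> 0 * (1 / u)" using u nonneg by (simp add: divide_right_mono)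
      also have "\<dots> \<le> \<phi> 0 * (2 / lam)" using u pos by (intro mult_left_mono) auto
      finally show ?thesis using True part_nonneg(3)[of u v] by simp
    next
      case False
      then show ?thesis using lam by (auto simp: Dk_log indicator_def)
    qed
  qed
  also have "\<dots> = D v + \<phi> 0 * (2 / lam) * (lam / 2)"
    using lam unfolding D_def by (subst Bochner_Integration.integral_add) (auto intro!: Dk_integrable)
  finally show ?thesis using lam by simp
qed

text \<open>A point is moved to another one at the price of a constant: the distance at most doubles, or it is at
most twice the displacement.\<close>

lemma D_shift: "D (z - y) \<le> D (x - y) + (\<phi> 0 + D (2 *\<^sub>R (z - x)))"
proof (cases "norm (z - x) \<le> norm (x - y)")
  case True
  have "norm (z - y) \<le> norm (z - x) + norm (x - y)" by (rule norm_diff_triangle_ineq[of z x x y, simplified]) 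
  then have "norm (z - y) \<le> norm (2 *\<^sub>R (x - y))" using True by simp
  from D_mono[OF this] D_doubling[of "x - y"] SPD_nonneg(3)[of "2 *\<^sub>R (z - x)"] show ?thesis by linarith
next
  case False
  have "norm (z - y) \<le> norm (z - x) + norm (x - y)" by (rule norm_diff_triangle_ineq[of z x x y, simplified])
  then have "norm (z - y) \<le> norm (2 *\<^sub>R (z - x))" using False by simp
  from D_mono[OF this] SPD_nonneg(3)[of "x - y"] pos show ?thesis by linarith
qed

text \<open>Up to the factor \<open>1 / c\<close>, the potential that \<open>|\<mu>|\<close> generates through \<open>|g|\<close>.\<close>

definition G :: "'a \<Rightarrow> ennreal" where
  "G x = (\<integral>\<^sup>+y. ennreal \<bar>\<mu> y\<bar> * ennreal (\<bar>g (x - y)\<bar> / c) \<partial>lborel)"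

lemma G_measurable [measurable]: "G \<in> borel_measurable borel"
  unfolding G_def[abs_def] by measurable

lemma G_double: "(\<integral>\<^sup>+x. ennreal \<bar>\<mu> x\<bar> * G x \<partial>lborel) < \<infinity>"
proof -
  have "(\<integral>\<^sup>+x. ennreal \<bar>\<mu> x\<bar> * G x \<partial>lborel)
      = (\<integral>\<^sup>+x. \<integral>\<^sup>+y. ennreal (1 / c) * ennreal (\<bar>g (x - y)\<bar> * (\<bar>\<mu> x\<bar> * \<bar>\<mu> y\<bar>)) \<partial>lborel \<partial>lborel)"
  proof (rule nn_integral_cong)
    fix x
    have "ennreal \<bar>\<mu> x\<bar> * G x = (\<integral>\<^sup>+y. ennreal \<bar>\<mu> x\<bar> * (ennreal \<bar>\<mu> y\<bar> * ennreal (\<bar>g (x - y)\<bar> / c)) \<partial>lborel)"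
      unfolding G_def by (rule nn_integral_cmult[symmetric]) measurable
    also have "\<dots> = (\<integral>\<^sup>+y. ennreal (1 / c) * ennreal (\<bar>g (x - y)\<bar> * (\<bar>\<mu> x\<bar> * \<bar>\<mu> y\<bar>)) \<partial>lborel)"
      using c by (intro nn_integral_cong) (simp add: mult_ac flip: ennreal_mult')
    finally show "ennreal \<bar>\<mu> x\<bar> * G x = \<dots>" .
  qed
  also have "\<dots> = (\<integral>\<^sup>+z. ennreal (1 / c) * ennreal (case z of (x, y) \<Rightarrow> \<bar>g (x - y)\<bar> * (\<bar>\<mu> x\<bar> * \<bar>\<mu> y\<bar>)) \<partial>(lborel \<Otimes>\<^sub>M lborel))"
    by (subst lborel.nn_integral_fst[symmetric]) auto
  also have "\<dots> = ennreal (1 / c) * (\<integral>\<^sup>+z. ennreal (case z of (x, y) \<Rightarrow> \<bar>g (x - y)\<bar> * (\<bar>\<mu> x\<bar> * \<bar>\<mu> y\<bar>)) \<partial>(lborel \<Otimes>\<^sub>M lborel))"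
    by (rule nn_integral_cmult) measurable
  also have "\<dots> < \<infinity>"
  proof -
    have "(\<integral>\<^sup>+z. ennreal (case z of (x, y) \<Rightarrow> \<bar>g (x - y)\<bar> * (\<bar>\<mu> x\<bar> * \<bar>\<mu> y\<bar>)) \<partial>(lborel \<Otimes>\<^sub>M lborel))
        = (\<integral>\<^sup>+z. ennreal (norm (case z of (x, y) \<Rightarrow> \<bar>g (x - y)\<bar> * (\<bar>\<mu> x\<bar> * \<bar>\<mu> y\<bar>))) \<partial>(lborel \<Otimes>\<^sub>M lborel))"
      by (intro nn_integral_cong) (auto simp: split_beta')
    then show ?thesis using g_double by (simp add: integrable_iff_bounded ennreal_mult_less_top)
  qed
  finally show ?thesis .
qed

lemma D_double_finite:
  "(\<integral>\<^sup>+x. ennreal \<bar>\<mu> x\<bar> * (\<integral>\<^sup>+y. ennreal \<bar>\<mu> y\<bar> * ennreal (D (x - y)) \<partial>lborel) \<partial>lborel) < \<infinity>"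
proof -
  let ?M = "ennreal (H * K * (lam powr q / q)) + ennreal ((LINT y|lborel. \<bar>\<mu> y\<bar>) * (\<phi> 0 * R + \<bar>b\<bar>))"
  have "(\<integral>\<^sup>+x. ennreal \<bar>\<mu> x\<bar> * (\<integral>\<^sup>+y. ennreal \<bar>\<mu> y\<bar> * ennreal (D (x - y)) \<partial>lborel) \<partial>lborel)
      \<le> (\<integral>\<^sup>+x. ennreal \<bar>\<mu> x\<bar> * (?M + G x) \<partial>lborel)"
    unfolding G_def by (intro nn_integral_mono mult_left_mono D_convolution_le) auto
  also have "\<dots> = (\<integral>\<^sup>+x. ennreal \<bar>\<mu> x\<bar> \<partial>lborel) * ?M + (\<integral>\<^sup>+x. ennreal \<bar>\<mu> x\<bar> * G x \<partial>lborel)"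
    by (simp only: distrib_left[of _ ?M], subst nn_integral_add) (auto simp: nn_integral_multc)
  also have "\<dots> < \<infinity>" using G_double \<mu>_norm_finite by (simp add: ennreal_mult_less_top)
  finally show ?thesis .
qed

text \<open>The hypothesis on the potential concerns almost every point only, but the masses sit at given points.
The integral is finite at some point, and \<open>D_shift\<close> moves it to any other.\<close>

lemma D_cross_finite: "(\<integral>\<^sup>+y. ennreal \<bar>\<mu> y\<bar> * ennreal (D (z - y)) \<partial>lborel) < \<infinity>"
proof -
  \<comment> \<open>such a point exists because \<open>\<mu>\<close> has integral 1 and so does not vanish almost everywhere\<close>
  obtain x where x: "\<mu> x \<noteq> 0" "G x < \<infinity>"
  proof -
    have "AE x in lborel. ennreal \<bar>\<mu> x\<bar> * G x \<noteq> \<infinity>"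
      using G_double by (intro nn_integral_PInf_AE) auto
    moreover have "\<not> (AE x in lborel. \<mu> x = 0)"
      using mass integral_eq_zero_AE[of \<mu> lborel] by auto
    ultimately have "\<exists>x. \<mu> x \<noteq> 0 \<and> ennreal \<bar>\<mu> x\<bar> * G x \<noteq> \<infinity>"
      by (metis (mono_tags, lifting) AE_mp AE_I2)
    then show ?thesis using that by (auto simp: ennreal_mult_eq_top_iff less_top)
  qed
  have Dx: "(\<integral>\<^sup>+y. ennreal \<bar>\<mu> y\<bar> * ennreal (D (x - y)) \<partial>lborel) < \<infinity>"
    using x(2) by (intro le_less_trans[OF D_convolution_le]) (simp flip: G_def)
  let ?M = "\<phi> 0 + D (2 *\<^sub>R (z - x))"
  have "(\<integral>\<^sup>+y. ennreal \<bar>\<mu> y\<bar> * ennreal (D (z - y)) \<partial>lborel)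
      \<le> (\<integral>\<^sup>+y. ennreal \<bar>\<mu> y\<bar> * (ennreal (D (x - y)) + ennreal ?M) \<partial>lborel)"
  proof (intro nn_integral_mono mult_left_mono)
    fix y
    have "ennreal (D (z - y)) \<le> ennreal (D (x - y) + ?M)" by (intro ennreal_leI D_shift)
    also have "\<dots> = ennreal (D (x - y)) + ennreal ?M"
      using SPD_nonneg(3) pos by (intro ennreal_plus) (auto intro: add_nonneg_nonneg)
    finally show "ennreal (D (z - y)) \<le> ennreal (D (x - y)) + ennreal ?M" .
  qed auto
  also have "\<dots> = (\<integral>\<^sup>+y. ennreal \<bar>\<mu> y\<bar> * ennreal (D (x - y)) \<partial>lborel) + (\<integral>\<^sup>+y. ennreal \<bar>\<mu> y\<bar> \<partial>lborel) * ennreal ?M"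
    by (simp only: distrib_left, subst nn_integral_add) (auto simp: nn_integral_multc)
  also have "\<dots> < \<infinity>" using Dx \<mu>_norm_finite by (simp add: ennreal_mult_less_top)
  finally show ?thesis .
qed

end

section \<open>Coercivity for potentials given by a kernel\<close>

lemma set_integral_tendsto_nat:
  fixes f :: "real \<Rightarrow> real"
  assumes i: "set_integrable lborel {a<..} f"
  shows "(\<lambda>n. LINT t:{a<..<real n}|lborel. f t) \<longlonglongrightarrow> (LINT t:{a<..}|lborel. f t)"
  unfolding set_lebesgue_integral_def
proof (rule integral_dominated_convergence[where w="\<lambda>t. norm (indicator {a<..} t *\<^sub>R f t)"])
  have i': "integrable lborel (\<lambda>t. indicator {a<..} t *\<^sub>R f t)" using i by (simp add: set_integrable_def)
  then show "integrable lborel (\<lambda>t. norm (indicator {a<..} t *\<^sub>R f t))" by (rule integrable_norm)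
  have m: "(\<lambda>t. indicator {a<..} t *\<^sub>R f t) \<in> borel_measurable lborel" using i' by (rule borel_measurable_integrable)
  then show "(\<lambda>t. indicator {a<..} t *\<^sub>R f t) \<in> borel_measurable lborel" .
  show "(\<lambda>t. indicator {a<..<real n} t *\<^sub>R f t) \<in> borel_measurable lborel" for n :: nat
  proof -
    have "(\<lambda>t. indicator {..<real n} t *\<^sub>R (indicator {a<..} t *\<^sub>R f t)) \<in> borel_measurable lborel"
      using m by measurable
    also have "(\<lambda>t. indicator {..<real n} t *\<^sub>R (indicator {a<..} t *\<^sub>R f t)) = (\<lambda>t. indicator {a<..<real n} t *\<^sub>R f t)"
      by (auto simp: indicator_def fun_eq_iff)
    finally show ?thesis .
  qed
  show "AE t in lborel. (\<lambda>n. indicator {a<..<real n} t *\<^sub>R f t) \<longlonglongrightarrow> indicator {a<..} t *\<^sub>R f t"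
  proof (rule AE_I2)
    fix t
    have "\<forall>\<^sub>F n in sequentially. t < real n"
      using filterlim_real_sequentially unfolding filterlim_at_top_dense by blast
    then have "\<forall>\<^sub>F n in sequentially. indicator {a<..<real n} t *\<^sub>R f t = indicator {a<..} t *\<^sub>R f t"
      by eventually_elim (auto simp: indicator_def)
    then show "(\<lambda>n. indicator {a<..<real n} t *\<^sub>R f t) \<longlonglongrightarrow> indicator {a<..} t *\<^sub>R f t"
      by (rule tendsto_eventually)
  qed
qed (auto simp: indicator_def)

lemma log_integral:
  fixes a T :: real
  assumes "0 < a" "a \<le> T"
  shows "has_bochner_integral lborel (\<lambda>t. indicator {a<..<T} t * (1 / t)) (ln T - ln a)"
proof -
  have 1: "has_bochner_integral lborel (\<lambda>t. (1 / t) * indicator {a .. T} t) (ln T - ln a)"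
  proof (rule has_bochner_integral_FTC_Icc_real[OF assms(2)])
    show "(ln has_real_derivative 1 / x) (at x)" if "a \<le> x" "x \<le> T" for x
      using that assms by (intro DERIV_ln_divide) auto
    show "isCont (\<lambda>t. 1 / t) x" if "a \<le> x" "x \<le> T" for x
      using that assms by (intro continuous_intros) auto
  qed
  have ae: "AE t in lborel. indicator {a<..<T} t * (1 / t) = (1 / t) * indicator {a .. T} t"
    using AE_lborel_singleton[of a] AE_lborel_singleton[of T]
    by eventually_elim (auto simp: indicator_def)
  show ?thesis
    using 1 integrable_cong_AE[OF _ _ ae] integral_cong_AE[OF _ _ ae] by (auto simp: has_bochner_integral_iff)
qed

text \<open>The total cost of restoring the diagonal at large scales, for \<open>s > 0\<close>. It is a multiple of the Riesz
potential at \<open>lam\<close>.\<close>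

lemma power_tail_integrable:
  fixes z :: "real \<Rightarrow> real"
  assumes s: "0 < s" and lam: "0 < lam" and [measurable]: "z \<in> borel_measurable borel"
    and z0: "\<And>t. t > 0 \<Longrightarrow> 0 \<le> z t" and z: "\<And>t. t > 0 \<Longrightarrow> z t \<le> K * t powr (real d - s)"
  shows "set_integrable lborel {lam<..} (\<lambda>t. z t / t ^ d / t)"
    and "(LINT t:{lam<..}|lborel. z t / t ^ d / t) \<le> K * (lam powr (- s) / s)"
proof -
  have i: "has_bochner_integral lborel (\<lambda>t. K * (indicator {lam..} t * t powr (- s - 1))) (K * (lam powr (- s) / s))"
    using powr_integral_near_infinity[OF s lam] by (rule has_bochner_integral_mult_right)
  have le: "indicator {lam<..} t *\<^sub>R (z t / t ^ d / t) \<le> K * (indicator {lam..} t * t powr (- s - 1))"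
    and nn: "0 \<le> indicator {lam<..} t *\<^sub>R (z t / t ^ d / t)" for t
  proof -
    show "0 \<le> indicator {lam<..} t *\<^sub>R (z t / t ^ d / t)" using lam z0 by (auto simp: indicator_def)
    have "0 \<le> K"
    proof -
      have "0 \<le> K * lam powr (real d - s)" using z0[OF lam] z[OF lam] by linarith
      then show ?thesis using lam by (simp add: zero_le_mult_iff)
    qed
    then show "indicator {lam<..} t *\<^sub>R (z t / t ^ d / t) \<le> K * (indicator {lam..} t * t powr (- s - 1))"
      using density_tail_le[OF _ z, of t] lam by (auto simp: indicator_def)
  qed
  show int: "set_integrable lborel {lam<..} (\<lambda>t. z t / t ^ d / t)"
    unfolding set_integrable_def
  proof (rule Bochner_Integration.integrable_bound)
    show "integrable lborel (\<lambda>t. K * (indicator {lam..} t * t powr (- s - 1)))"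
      using i by (simp add: has_bochner_integral_iff)
    show "AE t in lborel. norm (indicator {lam<..} t *\<^sub>R (z t / t ^ d / t)) \<le> norm (K * (indicator {lam..} t * t powr (- s - 1)))"
    proof (rule AE_I2)
      fix t show "norm (indicator {lam<..} t *\<^sub>R (z t / t ^ d / t)) \<le> norm (K * (indicator {lam..} t * t powr (- s - 1)))"
        using le[of t] nn[of t] unfolding real_norm_def by linarith
    qed
  qed measurable
  have "(LINT t:{lam<..}|lborel. z t / t ^ d / t) \<le> (LINT t|lborel. K * (indicator {lam..} t * t powr (- s - 1)))"
    unfolding set_lebesgue_integral_def
    by (rule integral_mono[OF int[unfolded set_integrable_def] _ le]) (use i in \<open>simp add: has_bochner_integral_iff\<close>)
  then show "(LINT t:{lam<..}|lborel. z t / t ^ d / t) \<le> K * (lam powr (- s) / s)"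
    using i by (simp add: has_bochner_integral_iff)
qed

lemma coercivity_arithmetic:
  fixes a :: real
  assumes "a > 0" "K > 0" "C \<ge> 1 / a" "0 \<le> w" "a * w / K \<le> y"
  shows "w \<le> C * K * y"
proof -
  have "0 \<le> y" using assms by (meson divide_nonneg_pos mult_nonneg_nonneg order_trans less_imp_le)
  have "w \<le> (1 / a) * K * y" using assms by (simp add: field_simps)
  also have "\<dots> \<le> C * K * y" using assms \<open>0 \<le> y\<close> by (intro mult_right_mono) auto
  finally show ?thesis .
qed

text \<open>Here \<open>b\<close> is the negative of \<open>\<phi> 0\<close> times the tail of the density, and \<open>D\<close> is bounded by the same
quantity.\<close>

theorem power_coercivity:
  fixes \<phi> :: "'a::euclidean_space \<Rightarrow> real" and s :: real
  assumes kernel: "radial_kernel \<phi> s \<gamma> C\<^sub>\<gamma>" and s0: "s > 0"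
    and p: "ennreal (DIM('a) / (DIM('a) - s)) < p" and c: "c > 0"
    and C\<phi>: "C\<^sub>\<phi> > 0" "r \<ge> 0" "\<And>\<xi>. C\<^sub>\<phi> * jbracket \<xi> powr (- r) \<le> Re (fourier \<phi> \<xi>)"
  shows "\<exists>C>0. \<forall>\<zeta> K R g. \<zeta> \<in> borel_measurable borel \<longrightarrow> K > 0 \<longrightarrow>
    (\<forall>t>0. t powr (DIM('a) - s) / K \<le> \<zeta> t \<and> \<zeta> t \<le> K * t powr (DIM('a) - s)) \<longrightarrow>
    (\<forall>x. x \<noteq> 0 \<longrightarrow> (\<lambda>n. c * (LINT t:{0<..<real n}|lborel. \<zeta> t * dilate t \<phi> x / t)) \<longlonglongrightarrow> g x) \<longrightarrow>
    coercivity_estimate s r p C K R g"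
proof -
  interpret radial_kernel \<phi> s \<gamma> C\<^sub>\<gamma> by (rule kernel)
  define q where "q = DIM('a) * conj_ratio p - s"
  define A where "A = (LINT y|lborel. \<phi> y powr (1 / conj_ratio p)) powr conj_ratio p"
  define a where "a = c * C\<^sub>\<phi> * 2 powr (- r) / 4"
  \<comment> \<open>one entry for each of the three uses of the constant: diagonal, mixed terms, and prefactor\<close>
  define C where "C = max (c * \<phi> 0) (max (c * A / q) (1 / a))"
  have a: "a > 0" using c C\<phi> by (simp add: a_def)
  have C: "c * \<phi> 0 \<le> C" "c * A / q \<le> C" "1 / a \<le> C" by (auto simp: C_def)
  have C0: "C > 0" using C(3) a by (meson divide_pos_pos less_le_trans zero_less_one)
  show ?thesis
  proof (intro exI[of _ C] conjI C0 allI impI)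
    fix \<zeta> K R and g :: "'a \<Rightarrow> real"
    assume \<zeta>: "\<zeta> \<in> borel_measurable borel" and K: "K > 0"
      and \<zeta>b: "\<forall>t>0. t powr (DIM('a) - s) / K \<le> \<zeta> t \<and> \<zeta> t \<le> K * t powr (DIM('a) - s)"
      and g: "\<forall>x. x \<noteq> 0 \<longrightarrow> (\<lambda>n. c * (LINT t:{0<..<real n}|lborel. \<zeta> t * dilate t \<phi> x / t)) \<longlonglongrightarrow> g x"
    show "coercivity_estimate s r p C K R g"
      unfolding coercivity_estimate_def
    proof (intro allI impI)
      fix \<mu> :: "'a \<Rightarrow> real" and lam :: real and N :: nat and X :: "nat \<Rightarrow> 'a"
      assume \<mu>: "integrable lborel \<mu>" "in_Lp p \<mu>" "(LINT x|lborel. \<mu> x) = 1"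
        and lam: "0 < lam" "lam \<le> 1" and N: "N \<ge> 1" and X: "inj_on X {..<N}"
      have \<zeta>0: "0 \<le> \<zeta> t" if "t > 0" for t
        using \<zeta>b that K by (meson divide_nonneg_pos order_trans powr_ge_zero)
      note tail = power_tail_integrable[OF s0 lam(1) \<zeta> \<zeta>0, of K "DIM('a)"]
      define I where "I = (LINT t:{lam<..}|lborel. \<zeta> t / t ^ DIM('a) / t)"
      interpret M: mixture_configuration \<phi> s \<gamma> C\<^sub>\<gamma> \<zeta> "\<lambda>_. 0" K c lam "- (\<phi> 0 * I)" "\<lambda>_. 0" g N X \<mu> p
      proof
        show "(\<lambda>n. 0 - \<phi> 0 * (LINT t:{lam<..<real n}|lborel. \<zeta> t / t ^ DIM('a) / t)) \<longlonglongrightarrow> - (\<phi> 0 * I)"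
          using tendsto_minus[OF tendsto_mult_left[OF set_integral_tendsto_nat[OF tail(1)], of "\<phi> 0"]] \<zeta>b
          by (simp add: I_def)
        show "(\<lambda>n. c * ((LINT t:{0<..<real n}|lborel. (\<zeta> t + 0) * dilate t \<phi> x / t) - 0)) \<longlonglongrightarrow> g x" if "x \<noteq> 0" for x
          using g that by simp
      qed (use \<zeta> K \<zeta>b lam c N X \<mu> p in \<open>auto simp: set_integrable_def\<close>)
      have q: "q > 0" using M.q_pos by (simp add: M.q_def q_def)
      have D: "M.D x \<le> \<phi> 0 * I" for x
      proof -
        have "M.D x \<le> (LINT t|lborel. \<phi> 0 * (indicator {lam<..} t *\<^sub>R (\<zeta> t / t ^ DIM('a) / t)))"
          unfolding M.D_def
        proof (rule integral_mono[OF M.Dk_integrable])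
          show "integrable lborel (\<lambda>t. \<phi> 0 * (indicator {lam<..} t *\<^sub>R (\<zeta> t / t ^ DIM('a) / t)))"
            using tail(1) \<zeta>b by (intro integrable_mult_right) (simp add: set_integrable_def)
          fix t
          show "M.Dk t x \<le> \<phi> 0 * (indicator {lam<..} t *\<^sub>R (\<zeta> t / t ^ DIM('a) / t))"
          proof (cases "t > lam")
            case True
            then have t: "t > 0" using lam by simp
            have "\<zeta> t * (\<phi> 0 / t ^ DIM('a) - dilate t \<phi> x) / t \<le> \<zeta> t * (\<phi> 0 / t ^ DIM('a)) / t"
              using t \<zeta>0[OF t] dilate_bounds[OF t, of x] by (intro divide_right_mono mult_left_mono) auto
            then show ?thesis using True by (simp add: M.Dk_def mult_ac)
          qed (simp add: M.Dk_def)
        qed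
        also have "\<dots> = \<phi> 0 * I" unfolding I_def set_lebesgue_integral_def by (rule integral_mult_right_zero)
        finally show ?thesis .
      qed
      define w where "w = sobolev_norm_sq (- r / 2) (fluctuation N X \<mu>)"
      define L where "L = Lp_norm p \<mu>"
      define G where "G = g_Riesz s lam"
      have w0: "0 \<le> w" by (simp add: w_def sobolev_norm_sq_nonneg)
      have L0: "0 \<le> L" by (simp add: L_def Lp_norm_nonneg)
      have G: "G = lam powr (- s) / s" "0 \<le> G" using lam s0 by (auto simp: G_def g_Riesz_def)
      have "2 * modulated_energy g N X \<mu>
        \<ge> c * (C\<^sub>\<phi> * 2 powr (- r) * w / (2 * K) - 2 * M.H * K * (lam powr M.q / M.q) - \<phi> 0 * M.R / real N + (- (\<phi> 0 * I)) / real N)"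
      proof (rule M.modulated_energy_ge[OF M.D_finite_if_bounded(1)[OF D] M.D_finite_if_bounded(2)[OF D]])
        show "0 \<le> C\<^sub>\<phi> * 2 powr (- r) * w" using w0 C\<phi> by simp
        show "C\<^sub>\<phi> * 2 powr (- r) * w \<le> M.full_energy t" if "1 \<le> t" "t \<le> 2" for t
          unfolding w_def by (rule M.spectral_lower[OF C\<phi> that])
      qed
      also have "M.R = 0" by (simp add: M.R_def set_lebesgue_integral_def)
      also have "M.H = L * A" by (simp add: M.H_def M.A_def L_def A_def)
      also have "M.q = q" by (simp add: M.q_def q_def)
      finally have main: "2 * modulated_energy g N X \<mu>
        \<ge> c * (C\<^sub>\<phi> * 2 powr (- r) * w / (2 * K) - 2 * (L * A) * K * (lam powr q / q) - \<phi> 0 * I / real N)"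
        by simp
      have I: "I \<le> K * G" unfolding I_def G(1) using tail(2) \<zeta>b by simp
      have "a * w / K \<le> modulated_energy g N X \<mu> + c * \<phi> 0 * I / (2 * real N) + (c * A / q) * K * L * lam powr q"
        using main by (simp add: a_def field_simps)
      also have "\<dots> \<le> modulated_energy g N X \<mu> + C * K * (G / (2 * real N)) + C * K * L * lam powr q"
      proof (intro add_mono order_refl)
        have "c * \<phi> 0 * I \<le> c * \<phi> 0 * (K * G)" using c pos I by (intro mult_left_mono) auto
        also have "\<dots> \<le> C * (K * G)" using C(1) K G(2) by (intro mult_right_mono mult_nonneg_nonneg) auto
        finally have "c * \<phi> 0 * I / (2 * real N) \<le> C * (K * G) / (2 * real N)" by (intro divide_right_mono) auto
        then show "c * \<phi> 0 * I / (2 * real N) \<le> C * K * (G / (2 * real N))" by (simp add: mult.assoc)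
        show "(c * A / q) * K * L * lam powr q \<le> C * K * L * lam powr q"
          using C(2) K L0 by (intro mult_right_mono) auto
      qed
      finally have "w \<le> C * K * (modulated_energy g N X \<mu> + C * K * (G / (2 * real N)) + C * K * L * lam powr q)"
        by (rule coercivity_arithmetic[OF a K C(3) w0])
      then show "sobolev_norm_sq (- r / 2) (fluctuation N X \<mu>)
          \<le> C * K * (modulated_energy g N X \<mu>
              + (g_Riesz s lam + C + R) / (2 * real N) * of_bool (s = 0)
              + C * K * (g_Riesz s lam / (2 * real N)) * of_bool (s > 0)
              + C * K * Lp_norm p \<mu> * lam powr (real DIM('a) * conj_ratio p - s))"
        using s0 by (simp add: w_def G_def L_def q_def)
    qed
  qed
qed

text \<open>With the constant \<open>\<phi> 0 * ln T - k\<close> subtracted at truncation \<open>T\<close>, the constant \<open>b\<close> is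
\<open>\<phi> 0 * ln lam - k\<close>. After the normalisation \<open>c = 1 / \<phi> 0\<close>, the coefficient of the logarithm is
exactly 1, as the estimate requires.\<close>

theorem log_coercivity:
  fixes \<phi> :: "'a::euclidean_space \<Rightarrow> real" and k :: real
  assumes kernel: "radial_kernel \<phi> 0 \<gamma> C\<^sub>\<gamma>"
    and p: "ennreal (real DIM('a) / (real DIM('a) - 0)) < p"
    and C\<phi>: "C\<^sub>\<phi> > 0" "r \<ge> 0" "\<And>\<xi>. C\<^sub>\<phi> * jbracket \<xi> powr (- r) \<le> Re (fourier \<phi> \<xi>)"
  shows "\<exists>C>0. \<forall>\<rho> g. \<rho> \<in> borel_measurable borel \<longrightarrow> (\<forall>t>0. 0 \<le> \<rho> t) \<longrightarrow>
    set_integrable lborel {0<..} (\<lambda>t. \<rho> t / t ^ DIM('a) / t) \<longrightarrow>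
    (\<forall>x. x \<noteq> 0 \<longrightarrow> (\<lambda>n. 1 / \<phi> 0 * ((LINT t:{0<..<real n}|lborel. (t ^ DIM('a) + \<rho> t) * dilate t \<phi> x / t)
        - (\<phi> 0 * ln (real n) - k))) \<longlonglongrightarrow> g x) \<longrightarrow>
    coercivity_estimate 0 r p C 1 (LINT t:{0<..}|lborel. \<rho> t / t ^ DIM('a) / t) g"
proof -
  interpret radial_kernel \<phi> 0 \<gamma> C\<^sub>\<gamma> by (rule kernel)
  define q where "q = DIM('a) * conj_ratio p - 0"
  define A where "A = (LINT y|lborel. \<phi> y powr (1 / conj_ratio p)) powr conj_ratio p"
  define c where "c = 1 / \<phi> 0"
  define a where "a = c * C\<^sub>\<phi> * 2 powr (- r) / 4"
  \<comment> \<open>as in the case of a power, with the truncation constant \<open>k\<close> in place of the diagonal\<close>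
  define C where "C = max (c * k) (max (c * A / q) (1 / a))"
  have c: "c > 0" "c * \<phi> 0 = 1" using pos by (auto simp: c_def)
  have a: "a > 0" using c C\<phi> by (simp add: a_def)
  have C: "c * k \<le> C" "c * A / q \<le> C" "1 / a \<le> C" by (auto simp: C_def)
  have C0: "C > 0" using C(3) a by (meson divide_pos_pos less_le_trans zero_less_one)
  show ?thesis
  proof (intro exI[of _ C] conjI C0 allI impI)
    fix \<rho> and g :: "'a \<Rightarrow> real"
    assume \<rho>: "\<rho> \<in> borel_measurable borel" "\<forall>t>0. 0 \<le> \<rho> t" "set_integrable lborel {0<..} (\<lambda>t. \<rho> t / t ^ DIM('a) / t)"
      and g: "\<forall>x. x \<noteq> 0 \<longrightarrow> (\<lambda>n. 1 / \<phi> 0 * ((LINT t:{0<..<real n}|lborel. (t ^ DIM('a) + \<rho> t) * dilate t \<phi> x / t)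
        - (\<phi> 0 * ln (real n) - k))) \<longlonglongrightarrow> g x"
    define R where "R = (LINT t:{0<..}|lborel. \<rho> t / t ^ DIM('a) / t)"
    show "coercivity_estimate 0 r p C 1 (LINT t:{0<..}|lborel. \<rho> t / t ^ DIM('a) / t) g"
      unfolding coercivity_estimate_def R_def[symmetric]
    proof (intro allI impI)
      fix \<mu> :: "'a \<Rightarrow> real" and lam :: real and N :: nat and X :: "nat \<Rightarrow> 'a"
      assume \<mu>: "integrable lborel \<mu>" "in_Lp p \<mu>" "(LINT x|lborel. \<mu> x) = 1"
        and gi: "(0::real) = 0 \<longrightarrow> integrable (lborel \<Otimes>\<^sub>M lborel) (\<lambda>(x, y). \<bar>g (x - y)\<bar> * (\<bar>\<mu> x\<bar> * \<bar>\<mu> y\<bar>))"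
        and lam: "0 < lam" "lam \<le> 1" and N: "N \<ge> 1" and X: "inj_on X {..<N}"
      interpret M: log_mixture_configuration \<phi> 0 \<gamma> C\<^sub>\<gamma> "\<lambda>t. t ^ DIM('a)" \<rho> 1 c lam "\<phi> 0 * ln lam - k"
          "\<lambda>T. \<phi> 0 * ln T - k" g N X \<mu> p
      proof
        show "(\<lambda>n. \<phi> 0 * ln (real n) - k - \<phi> 0 * (LINT t:{lam<..<real n}|lborel. t ^ DIM('a) / t ^ DIM('a) / t))
            \<longlonglongrightarrow> \<phi> 0 * ln lam - k"
        proof (rule tendsto_eventually)
          have "\<forall>\<^sub>F n in sequentially. lam < real n"
            using filterlim_real_sequentially unfolding filterlim_at_top_dense by blast
          then show "\<forall>\<^sub>F n in sequentially. \<phi> 0 * ln (real n) - k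
              - \<phi> 0 * (LINT t:{lam<..<real n}|lborel. t ^ DIM('a) / t ^ DIM('a) / t) = \<phi> 0 * ln lam - k"
          proof eventually_elim
            case (elim n)
            have "(LINT t:{lam<..<real n}|lborel. t ^ DIM('a) / t ^ DIM('a) / t) = (LINT t|lborel. indicator {lam<..<real n} t * (1 / t))"
              unfolding set_lebesgue_integral_def
              using lam by (intro Bochner_Integration.integral_cong) (auto simp: indicator_def)
            also have "\<dots> = ln (real n) - ln lam"
              using log_integral[of lam "real n"] elim lam by (simp add: has_bochner_integral_iff)
            finally have e: "(LINT t:{lam<..<real n}|lborel. t ^ DIM('a) / t ^ DIM('a) / t) = ln (real n) - ln lam" .
            show ?case unfolding e by (simp add: algebra_simps)
          qed
        qed
        show "(\<lambda>n. c * ((LINT t:{0<..<real n}|lborel. (t ^ DIM('a) + \<rho> t) * dilate t \<phi> x / t)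
            - (\<phi> 0 * ln (real n) - k))) \<longlonglongrightarrow> g x" if "x \<noteq> 0" for x
          using g that by (simp add: c_def)
      qed (use \<rho> lam c N X \<mu> p gi in \<open>auto simp: powr_realpow\<close>)
      have q: "q > 0" using M.q_pos by (simp add: M.q_def q_def)
      define w where "w = sobolev_norm_sq (- r / 2) (fluctuation N X \<mu>)"
      define L where "L = Lp_norm p \<mu>"
      have w0: "0 \<le> w" by (simp add: w_def sobolev_norm_sq_nonneg)
      have L0: "0 \<le> L" by (simp add: L_def Lp_norm_nonneg)
      have "2 * modulated_energy g N X \<mu>
        \<ge> c * (C\<^sub>\<phi> * 2 powr (- r) * w / (2 * 1) - 2 * M.H * 1 * (lam powr M.q / M.q) - \<phi> 0 * M.R / real N + (\<phi> 0 * ln lam - k) / real N)"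
      proof (rule M.modulated_energy_ge[OF M.D_cross_finite M.D_double_finite])
        show "0 \<le> C\<^sub>\<phi> * 2 powr (- r) * w" using w0 C\<phi> by simp
        show "C\<^sub>\<phi> * 2 powr (- r) * w \<le> M.full_energy t" if "1 \<le> t" "t \<le> 2" for t
          unfolding w_def by (rule M.spectral_lower[OF C\<phi> that])
      qed
      also have "M.R = R" by (simp add: M.R_def R_def)
      also have "M.H = L * A" by (simp add: M.H_def M.A_def L_def A_def)
      also have "M.q = q" by (simp add: M.q_def q_def)
      also have "c * (C\<^sub>\<phi> * 2 powr (- r) * w / (2 * 1) - 2 * (L * A) * 1 * (lam powr q / q) - \<phi> 0 * R / real N + (\<phi> 0 * ln lam - k) / real N)
          = 2 * a * w - 2 * (c * A / q) * L * lam powr q - (c * \<phi> 0) * R / real N + ((c * \<phi> 0) * ln lam - c * k) / real N"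
        by (simp add: a_def algebra_simps diff_divide_distrib)
      finally have main: "2 * modulated_energy g N X \<mu> \<ge> 2 * a * w - 2 * (c * A / q) * L * lam powr q - R / real N + (ln lam - c * k) / real N"
        unfolding c(2) by simp
      have "a * w / 1 \<le> modulated_energy g N X \<mu> + (- ln lam + c * k + R) / (2 * real N) + (c * A / q) * L * lam powr q"
      proof -
        define x y z u where "x = (- ln lam + c * k + R) / (2 * real N)" and "y = R / real N"
          and "z = (ln lam - c * k) / real N" and "u = c * A / q * L * lam powr q"
        have "x = (y - z) / 2"
          by (simp add: x_def y_def z_def add_divide_distrib diff_divide_distrib)
        moreover have "2 * (a * w) - 2 * u - y + z \<le> 2 * modulated_energy g N X \<mu>"
          using main by (simp only: mult.assoc y_def z_def u_def)
        ultimately have "a * w \<le> modulated_energy g N X \<mu> + x + u" by simp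
        then show ?thesis by (simp only: x_def u_def div_by_1)
      qed
      also have "\<dots> \<le> modulated_energy g N X \<mu> + (- ln lam + C + R) / (2 * real N) + C * L * lam powr q"
        using C L0 by (intro add_mono order_refl mult_right_mono divide_right_mono) auto
      finally have "w \<le> C * 1 * (modulated_energy g N X \<mu> + (- ln lam + C + R) / (2 * real N) + C * L * lam powr q)"
        by (rule coercivity_arithmetic[OF a zero_less_one C(3) w0])
      then show "sobolev_norm_sq (- r / 2) (fluctuation N X \<mu>)
          \<le> C * 1 * (modulated_energy g N X \<mu>
              + (g_Riesz 0 lam + C + R) / (2 * real N) * of_bool ((0::real) = 0)
              + C * 1 * (g_Riesz 0 lam / (2 * real N)) * of_bool ((0::real) > 0)
              + C * 1 * Lp_norm p \<mu> * lam powr (real DIM('a) * conj_ratio p - 0))"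
        using lam by (simp add: w_def L_def q_def g_Riesz_def)
    qed
  qed
qed

section \<open>Coercivity for admissible potentials\<close>

lemma profile_norm:
  fixes \<phi> :: "'a::euclidean_space \<Rightarrow> real"
  assumes "\<And>x y. norm x = norm y \<Longrightarrow> \<phi> x = \<phi> y"
  shows "\<phi> x = profile \<phi> (norm x)"
proof -
  have "(SOME b. b \<in> (Basis :: 'a set)) \<in> Basis" by (rule SOME_Basis)
  then have "norm x = norm (norm x *\<^sub>R (SOME b. b \<in> (Basis :: 'a set)))" by simp
  then show ?thesis unfolding profile_def by (rule assms)
qed

text \<open>Monotonicity of the profile gives monotonicity in the norm, and a kernel that is not identically zero is
then positive at the origin.\<close>

lemma admissible_radial_kernel:
  fixes \<phi> :: "'a::euclidean_space \<Rightarrow> real"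
  assumes ad: "admissible_kernel s \<phi>" and s: "0 \<le> s" "s < DIM('a)"
  shows "\<exists>\<gamma> C\<^sub>\<gamma>. radial_kernel \<phi> s \<gamma> C\<^sub>\<gamma>"
proof -
  have nn: "\<forall>x. 0 \<le> \<phi> x" and rad: "\<forall>x y. norm x = norm y \<longrightarrow> \<phi> x = \<phi> y"
    and dec: "\<forall>r r'. 0 \<le> r \<and> r \<le> r' \<longrightarrow> profile \<phi> r' \<le> profile \<phi> r"
    and nz: "\<exists>x. \<phi> x \<noteq> 0" and ft: "\<forall>\<xi>. fourier \<phi> \<xi> \<in> \<real> \<and> 0 \<le> Re (fourier \<phi> \<xi>)"
    and ci: "continuous_on UNIV \<phi>" "integrable lborel \<phi>"
    and gC: "\<exists>\<gamma> C. \<gamma> > s \<and> (\<forall>x. \<phi> x \<le> C * jbracket x powr (- \<gamma>))"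
    using ad unfolding admissible_kernel_def by - (elim conjE, assumption)+
  obtain \<gamma> C where \<gamma>: "\<gamma> > s" "\<forall>x. \<phi> x \<le> C * jbracket x powr (- \<gamma>)"
    using gC by blast
  have dec': "\<phi> y \<le> \<phi> x" if "norm x \<le> norm y" for x y
  proof -
    have "profile \<phi> (norm y) \<le> profile \<phi> (norm x)" using dec that by simp
    moreover have "\<phi> z = profile \<phi> (norm z)" for z by (rule profile_norm) (use rad in blast)
    ultimately show ?thesis by metis
  qed
  have "0 < \<phi> 0"
  proof -
    obtain x where "\<phi> x \<noteq> 0" using nz by blast
    then have "0 < \<phi> x" using nn by (simp add: order_less_le)
    also have "\<phi> x \<le> \<phi> 0" by (rule dec') simp
    finally show ?thesis .
  qed
  then have "radial_kernel \<phi> s \<gamma> C"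
    by unfold_locales (use s nn dec' \<gamma> ci ft in blast)+
  then show ?thesis by blast
qed

text \<open>The normalising integral is bounded below by the part near the origin, where continuity keeps the profile
above \<open>\<phi> 0 / 2\<close>.\<close>

lemma c_norm_pos:
  fixes \<phi> :: "'a::euclidean_space \<Rightarrow> real"
  assumes ad: "admissible_kernel s \<phi>" and k: "radial_kernel \<phi> s \<gamma> C\<^sub>\<gamma>"
  shows "c_norm s \<phi> > 0"
proof -
  interpret radial_kernel \<phi> s \<gamma> C\<^sub>\<gamma> by (rule k)
  show ?thesis
  proof (cases "s = 0")
    case True
    then show ?thesis using pos by (simp add: c_norm_def)
  next
    case False
    then have s0: "s > 0" using s by simp
    let ?b = "SOME b. b \<in> (Basis :: 'a set)"
    have b: "norm ?b = 1"
    proof -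
      have "?b \<in> Basis" by (rule SOME_Basis)
      then show ?thesis by simp
    qed
    have int: "set_integrable lborel {0<..} (\<lambda>r. r powr (s - 1) * profile \<phi> r)"
    proof -
      have "s > 0 \<longrightarrow> set_integrable lborel {0<..} (\<lambda>r. r powr (s - 1) * profile \<phi> r)"
        using ad unfolding admissible_kernel_def by - (elim conjE, assumption)
      then show ?thesis using s0 by simp
    qed
    obtain \<delta> where \<delta>: "\<delta> > 0" "\<And>x. dist x 0 < \<delta> \<Longrightarrow> dist (\<phi> x) (\<phi> 0) < \<phi> 0 / 2"
    proof -
      have "isCont \<phi> 0" using cont by (simp add: continuous_on_eq_continuous_at)
      then have "\<exists>d>0. \<forall>x. dist x 0 < d \<longrightarrow> dist (\<phi> x) (\<phi> 0) < \<phi> 0 / 2"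
        unfolding continuous_at_eps_delta using half_gt_zero[OF pos] by blast
      then show ?thesis using that by blast
    qed
    have low: "\<phi> 0 / 2 \<le> profile \<phi> r" if "0 < r" "r \<le> \<delta> / 2" for r
    proof -
      have "norm (r *\<^sub>R ?b) = r" using that b by simp
      then have "dist (\<phi> (r *\<^sub>R ?b)) (\<phi> 0) < \<phi> 0 / 2" using that \<delta>(1) by (intro \<delta>(2)) (simp add: dist_norm)
      then show ?thesis unfolding profile_def dist_real_def by linarith
    qed
    have p0: "0 \<le> profile \<phi> r" for r using nonneg by (simp add: profile_def)
    have i: "has_bochner_integral lborel (\<lambda>t. \<phi> 0 / 2 * (indicator {0<..\<delta> / 2} t * t powr (s - 1))) (\<phi> 0 / 2 * ((\<delta> / 2) powr s / s))"
      using powr_integral_near_0[OF s0, of "\<delta> / 2"] \<delta>(1) by (intro has_bochner_integral_mult_right) auto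
    have "0 < \<phi> 0 / 2 * ((\<delta> / 2) powr s / s)" using pos \<delta>(1) s0 by simp
    also have "\<dots> = (LINT t|lborel. \<phi> 0 / 2 * (indicator {0<..\<delta> / 2} t * t powr (s - 1)))"
      using i by (simp add: has_bochner_integral_iff)
    also have "\<dots> \<le> (LINT r:{0<..}|lborel. r powr (s - 1) * profile \<phi> r)"
      unfolding set_lebesgue_integral_def
    proof (rule integral_mono)
      show "integrable lborel (\<lambda>t. \<phi> 0 / 2 * (indicator {0<..\<delta> / 2} t * t powr (s - 1)))"
        using i by (simp add: has_bochner_integral_iff)
      show "integrable lborel (\<lambda>r. indicator {0<..} r *\<^sub>R (r powr (s - 1) * profile \<phi> r))"
        using int by (simp add: set_integrable_def)
      fix t
      show "\<phi> 0 / 2 * (indicator {0<..\<delta> / 2} t * t powr (s - 1)) \<le> indicator {0<..} t *\<^sub>R (t powr (s - 1) * profile \<phi> t)"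
      proof (cases "t \<in> {0<..\<delta> / 2}")
        case True
        then have "t powr (s - 1) * (\<phi> 0 / 2) \<le> t powr (s - 1) * profile \<phi> t"
          using low by (intro mult_left_mono) auto
        then show ?thesis using True by (simp add: mult.commute)
      qed (use p0 in \<open>auto simp: indicator_def\<close>)
    qed
    finally show ?thesis using s0 by (simp add: c_norm_def)
  qed
qed

text \<open>The density is constrained on the positive half-line only; cutting it off there makes it measurable on
the whole line without changing any of the integrals.\<close>

lemma locally_integrable_pos_measurable:
  assumes "locally_integrable_pos f"
  shows "(\<lambda>t. indicator {0<..} t * f t) \<in> borel_measurable borel"
proof (rule borel_measurable_LIMSEQ_real)
  \<comment> \<open>local integrability speaks about compact intervals of positive numbers, which exhaust the half-line\<close>
  let ?F = "\<lambda>n t. indicator {1 / real (Suc n)..real (Suc n)} t * f t"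
  show "?F n \<in> borel_measurable borel" for n
  proof -
    have "set_integrable lborel {1 / real (Suc n)..real (Suc n)} f"
      using assms by (simp add: locally_integrable_pos_def)
    then show ?thesis
      unfolding set_integrable_def real_scaleR_def using borel_measurable_integrable measurable_lborel2 by blast
  qed
  show "(\<lambda>n. ?F n t) \<longlonglongrightarrow> indicator {0<..} t * f t" for t
  proof (cases "t > 0")
    case True
    have "\<forall>\<^sub>F n in sequentially. 1 / real (Suc n) < t"
      using LIMSEQ_Suc[OF lim_1_over_n] True by (rule order_tendstoD)
    moreover have "\<forall>\<^sub>F n in sequentially. t < real n"
      using filterlim_real_sequentially unfolding filterlim_at_top_dense by blast
    ultimately have "\<forall>\<^sub>F n in sequentially. ?F n t = indicator {0<..} t * f t"
      by eventually_elim (use True in auto)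
    then show ?thesis by (rule tendsto_eventually)
  next
    case False
    have "(\<lambda>n. ?F n t) = (\<lambda>n. 0)"
    proof
      fix n
      have "0 < 1 / real (Suc n)" by simp
      then have "t < 1 / real (Suc n)" using False by linarith
      then show "?F n t = 0" by (simp add: indicator_def)
    qed
    moreover have "indicator {0<..} t * f t = 0" using False by simp
    ultimately show ?thesis by (simp only: tendsto_const)
  qed
qed

lemma set_integral_pos_cong:
  assumes "\<And>t. t > 0 \<Longrightarrow> f t = h t" "A \<subseteq> {0<..}"
  shows "(LINT t:A|lborel. f t) = (LINT t:A|lborel. h t)"
  unfolding set_lebesgue_integral_def
  by (intro Bochner_Integration.integral_cong refl) (use assms in \<open>auto simp: indicator_def\<close>)

text \<open>The constant \<open>C\<^sub>\<rho>\<close>. The absolute value makes it nonnegative for an arbitrary function \<open>\<rho>\<close>.\<close>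

definition log_remainder :: "nat \<Rightarrow> (real \<Rightarrow> real) \<Rightarrow> real" where
  "log_remainder d \<rho> = (LINT t:{0<..}|lborel. \<bar>\<rho> t\<bar> / t ^ d / t)"

lemma log_remainder_nonneg: "0 \<le> log_remainder d \<rho>"
  unfolding log_remainder_def set_lebesgue_integral_def
  by (intro Bochner_Integration.integral_nonneg) (auto simp: indicator_def)

lemma log_remainder_0: "(\<forall>t>0. \<rho> t = 0) \<Longrightarrow> log_remainder d \<rho> = 0"
  unfolding log_remainder_def by (subst set_integral_pos_cong[where h="\<lambda>_. 0"]) auto

text \<open>The constant may depend on the kernel only, so it has to be chosen before the potential. If the kernel
is not admissible there is no potential to treat, and any constant will do.\<close>

theorem admissible_coercivity:
  fixes \<phi> :: "'a::euclidean_space \<Rightarrow> real" and s :: real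
  assumes s: "0 \<le> s" "s < DIM('a)" and p: "ennreal (DIM('a) / (DIM('a) - s)) < p"
    and C\<phi>: "C\<^sub>\<phi> > 0" "r \<ge> 0" "\<And>\<xi>. C\<^sub>\<phi> * jbracket \<xi> powr (- r) \<le> Re (fourier \<phi> \<xi>)"
  shows "\<exists>C>0. \<forall>\<zeta> C\<^sub>\<zeta> \<rho> g. admissible_potential s \<phi> \<zeta> C\<^sub>\<zeta> \<rho> g \<longrightarrow>
             coercivity_estimate s r p C (if s = 0 then 1 else C\<^sub>\<zeta>) (log_remainder DIM('a) \<rho>) g"
proof (cases "admissible_kernel s \<phi>")
  case False
  then show ?thesis by (intro exI[of _ 1]) (auto simp: admissible_potential_def)
next
  case ad: True
  obtain \<gamma> C\<^sub>\<gamma> where k: "radial_kernel \<phi> s \<gamma> C\<^sub>\<gamma>" using admissible_radial_kernel[OF ad s] by blast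
  have c: "c_norm s \<phi> > 0" by (rule c_norm_pos[OF ad k])
  show ?thesis
  proof (cases "s = 0")
    case s0: False
    then have "s > 0" using s by simp
    from power_coercivity[OF k this p c C\<phi>] show ?thesis
    proof (elim exE conjE)
      fix C :: real
      assume C: "C > 0" and est: "\<forall>\<zeta> K R g. \<zeta> \<in> borel_measurable borel \<longrightarrow> K > 0 \<longrightarrow>
        (\<forall>t>0. t powr (DIM('a) - s) / K \<le> \<zeta> t \<and> \<zeta> t \<le> K * t powr (DIM('a) - s)) \<longrightarrow>
        (\<forall>x. x \<noteq> 0 \<longrightarrow> (\<lambda>n. c_norm s \<phi> * (LINT t:{0<..<real n}|lborel. \<zeta> t * dilate t \<phi> x / t)) \<longlonglongrightarrow> g x) \<longrightarrow>
        coercivity_estimate s r p C K R g"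
      show ?thesis
      proof (intro exI[of _ C] conjI C allI impI)
        fix \<zeta> C\<^sub>\<zeta> \<rho> and g :: "'a \<Rightarrow> real"
        assume A: "admissible_potential s \<phi> \<zeta> C\<^sub>\<zeta> \<rho> g"
        show "coercivity_estimate s r p C (if s = 0 then 1 else C\<^sub>\<zeta>) (log_remainder DIM('a) \<rho>) g"
          unfolding if_not_P[OF s0]
        proof (rule est[rule_format])
          show "(\<lambda>t. indicator {0<..} t * \<zeta> t) \<in> borel_measurable borel"
            using A by (intro locally_integrable_pos_measurable) (simp add: admissible_potential_def)
          show "C\<^sub>\<zeta> > 0" using A by (simp add: admissible_potential_def)
          show "t powr (DIM('a) - s) / C\<^sub>\<zeta> \<le> indicator {0<..} t * \<zeta> t \<and> indicator {0<..} t * \<zeta> t \<le> C\<^sub>\<zeta> * t powr (DIM('a) - s)" if "t > 0" for t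
            using A that by (simp add: admissible_potential_def)
          fix x :: 'a assume "x \<noteq> 0"
          then have "((\<lambda>T. c_norm s \<phi> * (LINT t:{0<..<T}|lborel. \<zeta> t * dilate t \<phi> x / t)) \<longlongrightarrow> g x) at_top"
            using A s0 by (simp add: admissible_potential_def)
          from filterlim_compose[OF this filterlim_real_sequentially]
          have "(\<lambda>n. c_norm s \<phi> * (LINT t:{0<..<real n}|lborel. \<zeta> t * dilate t \<phi> x / t)) \<longlonglongrightarrow> g x" .
          also have "(\<lambda>n. c_norm s \<phi> * (LINT t:{0<..<real n}|lborel. \<zeta> t * dilate t \<phi> x / t))
              = (\<lambda>n. c_norm s \<phi> * (LINT t:{0<..<real n}|lborel. (indicator {0<..} t * \<zeta> t) * dilate t \<phi> x / t))"
            by (intro ext arg_cong[where f="\<lambda>u. c_norm s \<phi> * u"] set_integral_pos_cong) auto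
          finally show "(\<lambda>n. c_norm s \<phi> * (LINT t:{0<..<real n}|lborel. (indicator {0<..} t * \<zeta> t) * dilate t \<phi> x / t)) \<longlonglongrightarrow> g x" .
        qed
      qed
    qed
  next
    case s0: True
    let ?k = "LINT r:{0<..}|lborel. ln r * deriv (profile \<phi>) r"
    from log_coercivity[OF k[unfolded s0] p[unfolded s0] C\<phi>, of ?k] show ?thesis
    proof (elim exE conjE)
      fix C :: real
      assume C: "C > 0" and est: "\<forall>\<rho> g. \<rho> \<in> borel_measurable borel \<longrightarrow> (\<forall>t>0. 0 \<le> \<rho> t) \<longrightarrow>
        set_integrable lborel {0<..} (\<lambda>t. \<rho> t / t ^ DIM('a) / t) \<longrightarrow>
        (\<forall>x. x \<noteq> 0 \<longrightarrow> (\<lambda>n. 1 / \<phi> 0 * ((LINT t:{0<..<real n}|lborel. (t ^ DIM('a) + \<rho> t) * dilate t \<phi> x / t)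
            - (\<phi> 0 * ln (real n) - ?k))) \<longlonglongrightarrow> g x) \<longrightarrow>
        coercivity_estimate 0 r p C 1 (LINT t:{0<..}|lborel. \<rho> t / t ^ DIM('a) / t) g"
      show ?thesis
      proof (intro exI[of _ C] conjI C allI impI)
        fix \<zeta> C\<^sub>\<zeta> \<rho> and g :: "'a \<Rightarrow> real"
        assume A: "admissible_potential s \<phi> \<zeta> C\<^sub>\<zeta> \<rho> g"
        let ?\<rho> = "\<lambda>t. indicator {0<..} t * \<rho> t"
        have \<rho>: "\<And>t. t > 0 \<Longrightarrow> \<zeta> t = t ^ DIM('a) + \<rho> t" "\<And>t. t > 0 \<Longrightarrow> 0 \<le> \<rho> t" "locally_integrable_pos \<rho>"
          "set_integrable lborel {0<..} (\<lambda>t. \<rho> t / t ^ DIM('a) / t)"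
        proof -
          have "s = 0 \<longrightarrow> (\<forall>t>0. \<zeta> t = t ^ DIM('a) + \<rho> t \<and> 0 \<le> \<rho> t) \<and> locally_integrable_pos \<rho> \<and>
              set_integrable lborel {0<..} (\<lambda>t. \<rho> t / t ^ DIM('a) / t)"
            using A unfolding admissible_potential_def by - (elim conjE, assumption)
          then show "\<And>t. t > 0 \<Longrightarrow> \<zeta> t = t ^ DIM('a) + \<rho> t" "\<And>t. t > 0 \<Longrightarrow> 0 \<le> \<rho> t" "locally_integrable_pos \<rho>"
            "set_integrable lborel {0<..} (\<lambda>t. \<rho> t / t ^ DIM('a) / t)"
            using s0 by simp_all
        qed
        have "coercivity_estimate 0 r p C 1 (LINT t:{0<..}|lborel. ?\<rho> t / t ^ DIM('a) / t) g"
        proof (rule est[rule_format])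
          show "?\<rho> \<in> borel_measurable borel" by (rule locally_integrable_pos_measurable) fact
          show "0 \<le> ?\<rho> t" if "t > 0" for t using that \<rho>(2) by simp
          have "(\<lambda>t. indicator {0<..} t *\<^sub>R (?\<rho> t / t ^ DIM('a) / t)) = (\<lambda>t. indicator {0<..} t *\<^sub>R (\<rho> t / t ^ DIM('a) / t))"
            by (auto simp: indicator_def)
          then show "set_integrable lborel {0<..} (\<lambda>t. ?\<rho> t / t ^ DIM('a) / t)"
            using \<rho>(4) unfolding set_integrable_def by (simp only:)
          fix x :: 'a assume "x \<noteq> 0"
          then have "((\<lambda>T. c_norm s \<phi> * ((LINT t:{0<..<T}|lborel. \<zeta> t * dilate t \<phi> x / t) - C_trunc \<phi> T)) \<longlongrightarrow> g x) at_top"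
            using A s0 by (simp add: admissible_potential_def)
          from filterlim_compose[OF this filterlim_real_sequentially]
          have "(\<lambda>n. c_norm s \<phi> * ((LINT t:{0<..<real n}|lborel. \<zeta> t * dilate t \<phi> x / t) - C_trunc \<phi> (real n))) \<longlonglongrightarrow> g x" .
          also have "(\<lambda>n. c_norm s \<phi> * ((LINT t:{0<..<real n}|lborel. \<zeta> t * dilate t \<phi> x / t) - C_trunc \<phi> (real n)))
              = (\<lambda>n. 1 / \<phi> 0 * ((LINT t:{0<..<real n}|lborel. (t ^ DIM('a) + ?\<rho> t) * dilate t \<phi> x / t) - (\<phi> 0 * ln (real n) - ?k)))"
          proof
            fix n
            have "(LINT t:{0<..<real n}|lborel. \<zeta> t * dilate t \<phi> x / t)
                = (LINT t:{0<..<real n}|lborel. (t ^ DIM('a) + ?\<rho> t) * dilate t \<phi> x / t)"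
              by (rule set_integral_pos_cong) (auto simp: \<rho>(1))
            then show "c_norm s \<phi> * ((LINT t:{0<..<real n}|lborel. \<zeta> t * dilate t \<phi> x / t) - C_trunc \<phi> (real n))
                = 1 / \<phi> 0 * ((LINT t:{0<..<real n}|lborel. (t ^ DIM('a) + ?\<rho> t) * dilate t \<phi> x / t) - (\<phi> 0 * ln (real n) - ?k))"
              using s0 by (simp only: c_norm_def C_trunc_def) simp
          qed
          finally show "(\<lambda>n. 1 / \<phi> 0 * ((LINT t:{0<..<real n}|lborel. (t ^ DIM('a) + ?\<rho> t) * dilate t \<phi> x / t) - (\<phi> 0 * ln (real n) - ?k))) \<longlonglongrightarrow> g x" .
        qed
        also have "(LINT t:{0<..}|lborel. ?\<rho> t / t ^ DIM('a) / t) = log_remainder DIM('a) \<rho>"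
          unfolding log_remainder_def by (rule set_integral_pos_cong) (auto simp: \<rho>(2))
        finally show "coercivity_estimate s r p C (if s = 0 then 1 else C\<^sub>\<zeta>) (log_remainder DIM('a) \<rho>) g"
          using s0 by simp
      qed
    qed
  qed
qed

text \<open>Because \<open>1 + 4 \<pi>\<^sup>2 |\<xi>|\<^sup>2 \<le> 4 \<pi>\<^sup>2 (1 + |\<xi>|\<^sup>2)\<close>.\<close>

lemma bessel_lower_bound:
  fixes G :: "'a::euclidean_space \<Rightarrow> real"
  assumes "is_bessel_potential a G" "a \<ge> 0"
  shows "(4 * pi\<^sup>2) powr (- a / 2) * jbracket \<xi> powr (- a) \<le> Re (fourier G \<xi>)"
proof -
  have pi2: "1 \<le> 4 * pi\<^sup>2"
  proof -
    have "1 \<le> pi\<^sup>2" using pi_gt3 by (intro one_le_power) simp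
    then show ?thesis by simp
  qed
  have j: "jbracket \<xi> powr (- a) = (1 + (norm \<xi>)\<^sup>2) powr (- a / 2)"
  proof -
    have "jbracket \<xi> = (1 + (norm \<xi>)\<^sup>2) powr (1 / 2)"
      by (simp add: jbracket_def powr_half_sqrt)
    then show ?thesis by (simp only: powr_powr) simp
  qed
  have "(4 * pi\<^sup>2) powr (- a / 2) * jbracket \<xi> powr (- a) = ((4 * pi\<^sup>2) * (1 + (norm \<xi>)\<^sup>2)) powr (- a / 2)"
    unfolding j by (subst powr_mult) auto
  also have "\<dots> \<le> (1 + 4 * pi\<^sup>2 * (norm \<xi>)\<^sup>2) powr (- a / 2)"
    using assms(2) pi2 by (intro powr_mono2') (auto simp: distrib_left intro: add_pos_nonneg)
  also have "\<dots> = Re (fourier G \<xi>)" using assms(1) by (simp add: is_bessel_potential_def)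
  finally show ?thesis .
qed

section \<open>Riesz potentials as superpositions of dilates\<close>

context radial_kernel begin

lemma radial: "norm x = norm y \<Longrightarrow> \<phi> x = \<phi> y"
  by (intro antisym decr) auto

lemma power_dilate:
  assumes "t > 0"
  shows "t powr (DIM('a) - s) * dilate t \<phi> x / t = t powr (- s - 1) * \<phi> (x /\<^sub>R t)"
proof -
  have "t powr (DIM('a) - s) * dilate t \<phi> x / t = (t powr (DIM('a) - s) / t powr DIM('a) / t powr 1) * \<phi> (x /\<^sub>R t)"
    using assms by (simp add: dilate_def powr_realpow)
  also have "t powr (DIM('a) - s) / t powr DIM('a) / t powr 1 = t powr (- s - 1)"
    by (simp only: powr_diff[symmetric]) simp
  finally show ?thesis .
qed

lemma kernel_scaling:
  assumes "x \<noteq> 0" "norm e = 1" "u > 0"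
  shows "\<phi> (x /\<^sub>R (norm x * u)) = \<phi> (e /\<^sub>R u)"
  by (rule radial) (use assms in \<open>simp add: field_simps\<close>)

text \<open>The integrand whose integral over all scales is, by scaling, proportional to the Riesz potential.\<close>

definition mellin :: "'a \<Rightarrow> real \<Rightarrow> real" where
  "mellin x t = indicator {0<..} t * (t powr (- s - 1) * \<phi> (x /\<^sub>R t))"

lemma mellin_nonneg: "0 \<le> mellin x t"
  using nonneg by (simp add: mellin_def indicator_def)

lemma mellin_integrable:
  assumes s0: "s > 0" and x: "x \<noteq> 0"
  shows "integrable lborel (mellin x)"
proof (rule Bochner_Integration.integrable_bound)
  let ?a = "\<lambda>t. C\<^sub>\<gamma> * norm x powr (- \<gamma>) * (indicator {0<..1} t * t powr ((\<gamma> - s) - 1))"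
  let ?b = "\<lambda>t. \<phi> 0 * (indicator {1..} t * t powr (- s - 1))"
  show "integrable lborel (\<lambda>t. ?a t + ?b t)"
    using powr_integral_near_0[of "\<gamma> - s" 1] powr_integral_near_infinity[OF s0, of 1] decay(1)
    by (intro Bochner_Integration.integrable_add integrable_mult_right) (auto simp: has_bochner_integral_iff)
  show "mellin x \<in> borel_measurable lborel" unfolding mellin_def[abs_def] by measurable
  show "AE t in lborel. norm (mellin x t) \<le> norm (?a t + ?b t)"
  proof (rule AE_I2)
    fix t
    have nn: "0 \<le> ?a t" "0 \<le> ?b t" using C_decay_nonneg pos by (auto simp: indicator_def)
    have "mellin x t \<le> ?a t + ?b t"
    proof (cases "t > 0")
      case t: True
      show ?thesis
      proof (cases "t \<le> 1")
        case True
        then have "mellin x t \<le> ?a t"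
          using t dilate_decay[OF t x] power_dilate[OF t, of x] by (simp add: mellin_def)
        then show ?thesis using nn by linarith
      next
        case False
        have "t powr (- s - 1) * \<phi> (x /\<^sub>R t) \<le> t powr (- s - 1) * \<phi> 0"
          using le_at_0 by (intro mult_left_mono) auto
        then have "mellin x t \<le> ?b t" using t False by (simp add: mellin_def mult.commute)
        then show ?thesis using nn by linarith
      qed
    next
      case False
      then have "mellin x t = 0" by (simp add: mellin_def)
      then show ?thesis using nn by linarith
    qed
    then show "norm (mellin x t) \<le> norm (?a t + ?b t)" using mellin_nonneg[of x t] unfolding real_norm_def by linarith
  qed
qed

lemma mellin_scaling:
  assumes x: "x \<noteq> 0" and e: "norm e = 1"
  shows "(LINT t|lborel. mellin x t) = norm x powr (- s) * (LINT t|lborel. mellin e t)"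
proof -
  have m: "mellin x \<in> borel_measurable borel" unfolding mellin_def[abs_def] by measurable
  have n: "norm x > 0" using x by simp
  have "(LINT t|lborel. mellin x t) = \<bar>norm x\<bar> ^ DIM(real) *\<^sub>R (LINT u|lborel. mellin x (0 + norm x *\<^sub>R u))"
    using n m by (intro lborel_integral_affine) auto
  also have "\<dots> = norm x * (LINT u|lborel. norm x powr (- s - 1) * mellin e u)"
  proof -
    have "mellin x (0 + norm x *\<^sub>R u) = norm x powr (- s - 1) * mellin e u" for u
    proof (cases "u > 0")
      case True
      then show ?thesis using n kernel_scaling[OF x e True] by (simp add: mellin_def powr_mult)
    next
      case False
      then have "\<not> 0 < norm x * u" using n by (simp add: zero_less_mult_iff)
      then show ?thesis using False by (simp add: mellin_def)
    qed
    then show ?thesis by simp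
  qed
  also have "\<dots> = (norm x powr 1 * norm x powr (- s - 1)) * (LINT u|lborel. mellin e u)"
    using n by simp
  also have "norm x powr 1 * norm x powr (- s - 1) = norm x powr (- s)"
    by (simp only: powr_add[symmetric]) simp
  finally show ?thesis .
qed

text \<open>The substitution \<open>t = |x| u\<close> takes \<open>|x| powr (- s)\<close> out of the integral. The remaining integral does not
depend on \<open>x\<close> and is positive.\<close>

theorem Riesz_limit:
  assumes s0: "s > 0" and p: "\<And>x. 0 < \<phi> x"
  shows "\<exists>c>0. \<forall>x::'a. x \<noteq> 0 \<longrightarrow> (\<lambda>n. c * (LINT t:{0<..<real n}|lborel. t powr (DIM('a) - s) * dilate t \<phi> x / t)) \<longlonglongrightarrow> g_Riesz s x"
proof -
  obtain e :: 'a where e: "norm e = 1" using norm_Basis nonempty_Basis by blast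
  then have e0: "e \<noteq> 0" by auto
  define J where "J = (LINT t|lborel. mellin e t)"
  have "0 < \<phi> e * (1 powr (- s) / s)" using p s0 by simp
  also have "\<dots> = (LINT t|lborel. \<phi> e * (indicator {1..} t * t powr (- s - 1)))"
    using has_bochner_integral_mult_right[OF powr_integral_near_infinity[OF s0, of 1], of "\<phi> e"]
    by (simp add: has_bochner_integral_iff)
  also have "\<dots> \<le> J"
    unfolding J_def
  proof (rule integral_mono[OF _ mellin_integrable[OF s0 e0]])
    show "integrable lborel (\<lambda>t. \<phi> e * (indicator {1..} t * t powr (- s - 1)))"
      using powr_integral_near_infinity[OF s0, of 1]
      by (intro integrable_mult_right) (simp add: has_bochner_integral_iff)
    fix t
    show "\<phi> e * (indicator {1..} t * t powr (- s - 1)) \<le> mellin e t"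
    proof (cases "t \<ge> 1")
      case True
      then have "\<phi> e \<le> \<phi> (e /\<^sub>R t)" using e by (intro decr) (simp add: field_simps)
      then have "t powr (- s - 1) * \<phi> e \<le> t powr (- s - 1) * \<phi> (e /\<^sub>R t)" by (intro mult_left_mono) auto
      then show ?thesis using True by (simp add: mellin_def mult.commute)
    qed (simp add: mellin_nonneg)
  qed
  finally have J: "J > 0" .
  show ?thesis
  proof (intro exI[of _ "1 / (s * J)"] conjI allI impI)
    show "0 < 1 / (s * J)" using s0 J by simp
    fix x :: 'a assume x: "x \<noteq> 0"
    let ?f = "\<lambda>t. t powr (DIM('a) - s) * dilate t \<phi> x / t"
    have f: "indicator {0<..} t *\<^sub>R ?f t = mellin x t" for t
      using power_dilate[of t x] by (simp add: mellin_def indicator_def)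
    have "set_integrable lborel {0<..} ?f"
      unfolding set_integrable_def f by (rule mellin_integrable[OF s0 x])
    from set_integral_tendsto_nat[OF this]
    have "(\<lambda>n. LINT t:{0<..<real n}|lborel. ?f t) \<longlonglongrightarrow> norm x powr (- s) * J"
      unfolding J_def mellin_scaling[OF x e, symmetric] by (simp only: set_lebesgue_integral_def[of _ "{0<..}"] f)
    from tendsto_mult_left[OF this, of "1 / (s * J)"]
    show "(\<lambda>n. 1 / (s * J) * (LINT t:{0<..<real n}|lborel. ?f t)) \<longlonglongrightarrow> g_Riesz s x"
      using s0 J by (simp add: g_Riesz_def)
  qed
qed

text \<open>For \<open>s = 0\<close> the integral of \<open>\<phi> (x / t) / t\<close> diverges logarithmically at large \<open>t\<close>. Subtracting \<open>\<phi> 0 / t\<close> for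
\<open>t > |x|\<close> leaves a convergent integral, which is scale invariant because the cut-off scales with \<open>x\<close>.\<close>

definition log_mellin :: "'a \<Rightarrow> real \<Rightarrow> real" where
  "log_mellin x t = indicator {0<..norm x} t * (\<phi> (x /\<^sub>R t) / t)
     - indicator {norm x<..} t * ((\<phi> 0 - \<phi> (x /\<^sub>R t)) / t)"

lemma log_mellin_nonpos: "t \<le> 0 \<Longrightarrow> log_mellin x t = 0"
proof -
  assume "t \<le> 0"
  then have "\<not> norm x < t" using norm_ge_zero[of x] by linarith
  then show ?thesis using \<open>t \<le> 0\<close> by (simp add: log_mellin_def)
qed

lemma log_mellin_integrable:
  assumes s0: "s = 0" and \<alpha>: "\<alpha> > 0" and M: "\<And>x. \<phi> 0 - \<phi> x \<le> M * norm x powr \<alpha>" and x: "x \<noteq> 0"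
  shows "integrable lborel (log_mellin x)"
  unfolding log_mellin_def[abs_def]
proof (rule Bochner_Integration.integrable_diff)
  have n: "norm x > 0" using x by simp
  show "integrable lborel (\<lambda>t. indicator {0<..norm x} t * (\<phi> (x /\<^sub>R t) / t))"
  proof (rule Bochner_Integration.integrable_bound)
    let ?C = "C\<^sub>\<gamma> * norm x powr (- \<gamma>)"
    show "integrable lborel (\<lambda>t. ?C * (indicator {0<..norm x} t * t powr (\<gamma> - 1)))"
      using powr_integral_near_0[of \<gamma> "norm x"] decay(1) s0
      by (intro integrable_mult_right) (auto simp: has_bochner_integral_iff)
    show "AE t in lborel. norm (indicator {0<..norm x} t * (\<phi> (x /\<^sub>R t) / t)) \<le> norm (?C * (indicator {0<..norm x} t * t powr (\<gamma> - 1)))"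
    proof (rule AE_I2)
      fix t
      have "\<phi> (x /\<^sub>R t) / t \<le> ?C * t powr (\<gamma> - 1)" if "t > 0"
      proof -
        have "\<phi> (x /\<^sub>R t) / t = t powr (- s - 1) * \<phi> (x /\<^sub>R t)" using s0 that by (simp add: powr_minus divide_inverse)
        then show ?thesis using dilate_decay[OF that x] power_dilate[OF that, of x] s0 that by simp
      qed
      then show "norm (indicator {0<..norm x} t * (\<phi> (x /\<^sub>R t) / t)) \<le> norm (?C * (indicator {0<..norm x} t * t powr (\<gamma> - 1)))"
        using nonneg[of "x /\<^sub>R t"] C_decay_nonneg by (simp add: indicator_def abs_mult)
    qed
  qed measurable
  show "integrable lborel (\<lambda>t. indicator {norm x<..} t * ((\<phi> 0 - \<phi> (x /\<^sub>R t)) / t))"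
  proof (rule Bochner_Integration.integrable_bound)
    let ?C = "M * norm x powr \<alpha>"
    show "integrable lborel (\<lambda>t. ?C * (indicator {norm x..} t * t powr (- \<alpha> - 1)))"
      using powr_integral_near_infinity[OF \<alpha> n]
      by (intro integrable_mult_right) (auto simp: has_bochner_integral_iff)
    show "AE t in lborel. norm (indicator {norm x<..} t * ((\<phi> 0 - \<phi> (x /\<^sub>R t)) / t)) \<le> norm (?C * (indicator {norm x..} t * t powr (- \<alpha> - 1)))"
    proof (rule AE_I2)
      fix t
      have b: "(\<phi> 0 - \<phi> (x /\<^sub>R t)) / t \<le> ?C * t powr (- \<alpha> - 1)" and b0: "0 \<le> (\<phi> 0 - \<phi> (x /\<^sub>R t)) / t" if t: "t > 0"
      proof -
        show "0 \<le> (\<phi> 0 - \<phi> (x /\<^sub>R t)) / t" using le_at_0 t by simp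
        have "(\<phi> 0 - \<phi> (x /\<^sub>R t)) / t \<le> M * norm (x /\<^sub>R t) powr \<alpha> / t" using t by (intro divide_right_mono M) simp
        also have "\<dots> = ?C * (1 / t powr \<alpha> / t powr 1)" using t by (simp add: powr_divide divide_inverse mult.commute powr_mult inverse_powr)
        also have "1 / t powr \<alpha> / t powr 1 = t powr (- \<alpha> - 1)" by (simp only: powr_diff powr_minus_divide)
        finally show "(\<phi> 0 - \<phi> (x /\<^sub>R t)) / t \<le> ?C * t powr (- \<alpha> - 1)" .
      qed
      show "norm (indicator {norm x<..} t * ((\<phi> 0 - \<phi> (x /\<^sub>R t)) / t)) \<le> norm (?C * (indicator {norm x..} t * t powr (- \<alpha> - 1)))"
      proof (cases "t > norm x")
        case True
        then have t: "t > 0" using n by linarith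
        show ?thesis using True b[OF t] b0[OF t] unfolding real_norm_def by (simp add: order_trans[OF _ abs_ge_self])
      qed simp
    qed
  qed measurable
qed

lemma log_mellin_scaling:
  assumes x: "x \<noteq> 0" and e: "norm e = 1"
  shows "(LINT t|lborel. log_mellin x t) = (LINT t|lborel. log_mellin e t)"
proof -
  have m: "log_mellin x \<in> borel_measurable borel" unfolding log_mellin_def[abs_def] by measurable
  have n: "norm x > 0" using x by simp
  have "(LINT t|lborel. log_mellin x t) = \<bar>norm x\<bar> ^ DIM(real) *\<^sub>R (LINT u|lborel. log_mellin x (0 + norm x *\<^sub>R u))"
    using n m by (intro lborel_integral_affine) auto
  also have "\<dots> = (LINT u|lborel. norm x * log_mellin x (norm x * u))" by simp
  also have "\<dots> = (LINT u|lborel. log_mellin e u)"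
  proof (intro Bochner_Integration.integral_cong refl)
    fix u :: real
    show "norm x * log_mellin x (norm x * u) = log_mellin e u"
    proof (cases "u > 0")
      case True
      have "(norm x * u \<le> norm x) = (u \<le> 1)" using n by simp
      moreover have "(norm x < norm x * u) = (1 < u)" using n by simp
      ultimately show ?thesis
        using True n kernel_scaling[OF x e True] e by (auto simp: log_mellin_def indicator_def)
    next
      case False
      then have "\<not> 0 < norm x * u" using n by (simp add: zero_less_mult_iff)
      moreover from this have "\<not> norm x < norm x * u" using n by linarith
      ultimately show ?thesis using False e by (simp add: log_mellin_def)
    qed
  qed
  finally show ?thesis .
qed

text \<open>The subtracted part contributes \<open>\<phi> 0 * (ln T - ln |x|)\<close>, that is, the truncation constant and the
logarithmic potential. Hoelder continuity of the kernel at the origin makes the rest converge.\<close>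

theorem log_limit:
  assumes s0: "s = 0" and \<alpha>: "\<alpha> > 0" and M: "\<And>x. \<phi> 0 - \<phi> x \<le> M * norm x powr \<alpha>"
  shows "\<exists>k. \<forall>x::'a. x \<noteq> 0 \<longrightarrow> (\<lambda>n. 1 / \<phi> 0 * ((LINT t:{0<..<real n}|lborel. (t ^ DIM('a) + 0) * dilate t \<phi> x / t)
        - (\<phi> 0 * ln (real n) - k))) \<longlonglongrightarrow> g_Riesz 0 x"
proof -
  obtain e :: 'a where e: "norm e = 1" using norm_Basis nonempty_Basis by blast
  define L where "L = (LINT t|lborel. log_mellin e t)"
  show ?thesis
  proof (intro exI[of _ "- L"] allI impI)
    fix x :: 'a assume x: "x \<noteq> 0"
    have n: "norm x > 0" using x by simp
    note int = log_mellin_integrable[OF s0 \<alpha> M x]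
    have "set_integrable lborel {0<..} (log_mellin x)"
    proof -
      have "(\<lambda>t. indicator {0<..} t *\<^sub>R log_mellin x t) = log_mellin x"
        using log_mellin_nonpos[of _ x] by (auto simp: fun_eq_iff indicator_def not_less)
      then show ?thesis using int by (simp add: set_integrable_def)
    qed
    from set_integral_tendsto_nat[OF this]
    have "(\<lambda>m. LINT t:{0<..<real m}|lborel. log_mellin x t) \<longlonglongrightarrow> (LINT t:{0<..}|lborel. log_mellin x t)" .
    also have "(LINT t:{0<..}|lborel. log_mellin x t) = (LINT t|lborel. log_mellin x t)"
      unfolding set_lebesgue_integral_def using log_mellin_nonpos[of _ x]
      by (intro Bochner_Integration.integral_cong) (auto simp: indicator_def not_less)
    also have "\<dots> = L" unfolding L_def by (rule log_mellin_scaling[OF x e])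
    finally have "(\<lambda>m. 1 / \<phi> 0 * ((LINT t:{0<..<real m}|lborel. log_mellin x t) - L) - ln (norm x)) \<longlonglongrightarrow> 1 / \<phi> 0 * (L - L) - ln (norm x)"
      by (intro tendsto_intros)
    then have lim: "(\<lambda>m. 1 / \<phi> 0 * ((LINT t:{0<..<real m}|lborel. log_mellin x t) - L) - ln (norm x)) \<longlonglongrightarrow> g_Riesz 0 x"
      by (simp add: g_Riesz_def)
    show "(\<lambda>n. 1 / \<phi> 0 * ((LINT t:{0<..<real n}|lborel. (t ^ DIM('a) + 0) * dilate t \<phi> x / t)
        - (\<phi> 0 * ln (real n) - - L))) \<longlonglongrightarrow> g_Riesz 0 x"
    proof (rule Lim_transform_eventually[OF lim])
      have "\<forall>\<^sub>F m in sequentially. norm x < real m"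
        using filterlim_real_sequentially unfolding filterlim_at_top_dense by blast
      then show "\<forall>\<^sub>F m in sequentially. 1 / \<phi> 0 * ((LINT t:{0<..<real m}|lborel. log_mellin x t) - L) - ln (norm x)
          = 1 / \<phi> 0 * ((LINT t:{0<..<real m}|lborel. (t ^ DIM('a) + 0) * dilate t \<phi> x / t) - (\<phi> 0 * ln (real m) - - L))"
      proof eventually_elim
        case (elim m)
        have "(LINT t:{0<..<real m}|lborel. (t ^ DIM('a) + 0) * dilate t \<phi> x / t)
            = (LINT t|lborel. indicator {0<..<real m} t *\<^sub>R log_mellin x t + \<phi> 0 * (indicator {norm x<..<real m} t * (1 / t)))"
          unfolding set_lebesgue_integral_def
        proof (intro Bochner_Integration.integral_cong refl)
          fix t
          show "indicator {0<..<real m} t *\<^sub>R ((t ^ DIM('a) + 0) * dilate t \<phi> x / t)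
              = indicator {0<..<real m} t *\<^sub>R log_mellin x t + \<phi> 0 * (indicator {norm x<..<real m} t * (1 / t))"
          proof (cases "0 < t \<and> t < real m")
            case True
            then show ?thesis
              by (cases "t \<le> norm x") (simp_all add: log_mellin_def dilate_def diff_divide_distrib)
          next
            case False
            then have "t \<notin> {0<..<real m}" "t \<notin> {norm x<..<real m}" using less_trans[OF n, of t] by auto
            then show ?thesis by simp
          qed
        qed
        also have "\<dots> = (LINT t:{0<..<real m}|lborel. log_mellin x t) + \<phi> 0 * (ln (real m) - ln (norm x))"
        proof -
          have i: "has_bochner_integral lborel (\<lambda>t. \<phi> 0 * (indicator {norm x<..<real m} t * (1 / t))) (\<phi> 0 * (ln (real m) - ln (norm x)))"
            using log_integral[OF n, of "real m"] elim by (intro has_bochner_integral_mult_right) auto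
          have "integrable lborel (\<lambda>t. indicator {0<..<real m} t *\<^sub>R log_mellin x t)"
            by (rule integrable_mult_indicator[OF _ int]) simp
          then show ?thesis
            using i unfolding set_lebesgue_integral_def by (subst Bochner_Integration.integral_add) (auto simp: has_bochner_integral_iff)
        qed
        finally have eq: "(LINT t:{0<..<real m}|lborel. (t ^ DIM('a) + 0) * dilate t \<phi> x / t)
            = (LINT t:{0<..<real m}|lborel. log_mellin x t) + \<phi> 0 * (ln (real m) - ln (norm x))" .
        show ?case unfolding eq using pos by (simp add: field_simps)
      qed
    qed
  qed
qed

end

section \<open>A kernel with slowly decaying Fourier transform\<close>

text \<open>Gaussians of width \<open>2\<^bsup>-k\<^esup>\<close>. The Fourier transform of the \<open>k\<close>-th one has height
\<open>2 powr (- (d + b) * k)\<close> up to frequencies of order \<open>2\<^bsup>k\<^esup>\<close>, so that the sum decays like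
\<open>|\<xi>| powr (- (d + b))\<close>.\<close>

definition gauss_term :: "real \<Rightarrow> nat \<Rightarrow> 'a::euclidean_space \<Rightarrow> real" where
  "gauss_term b k x = (2 powr (- b)) ^ k * exp (- pi * 4 ^ k * (norm x)\<^sup>2)"

definition gauss_series :: "real \<Rightarrow> 'a::euclidean_space \<Rightarrow> real" where
  "gauss_series b x = (\<Sum>k. gauss_term b k x)"

locale gauss_exponent = fixes b :: real assumes b: "b > 0"
begin

lemma ratio: "0 < 2 powr (- b)" "2 powr (- b) < 1"
  using b powr_less_mono[of "- b" 0 2] by auto

lemma ratio_summable: "summable (\<lambda>k. (2 powr (- b)) ^ k)"
  using ratio by (intro summable_geometric) simp

lemma term_pos: "0 < gauss_term b k x"
  unfolding gauss_term_def using ratio by (intro mult_pos_pos zero_less_power) auto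

lemma term_le: "gauss_term b k x \<le> (2 powr (- b)) ^ k"
proof -
  have "exp (- pi * 4 ^ k * (norm x)\<^sup>2) \<le> 1" by simp
  then have "(2 powr (- b)) ^ k * exp (- pi * 4 ^ k * (norm x)\<^sup>2) \<le> (2 powr (- b)) ^ k * 1"
    using ratio by (intro mult_left_mono) auto
  then show ?thesis by (simp add: gauss_term_def)
qed

lemma term_norm_le: "norm (gauss_term b k x) \<le> (2 powr (- b)) ^ k"
  using term_le[of k x] term_pos[of k x] unfolding real_norm_def by linarith

lemma term_summable: "summable (\<lambda>k. gauss_term b k x)"
  by (rule summable_comparison_test'[OF ratio_summable term_norm_le])

lemma series_pos: "0 < gauss_series b x"
  unfolding gauss_series_def by (intro suminf_pos term_summable term_pos)

lemma series_decr: "norm x \<le> norm y \<Longrightarrow> gauss_series b y \<le> gauss_series b x"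
  unfolding gauss_series_def
  by (intro suminf_le term_summable) (auto simp: gauss_term_def intro!: mult_left_mono power_mono)

lemma series_continuous: "continuous_on UNIV (gauss_series b :: 'a::euclidean_space \<Rightarrow> real)"
proof (rule uniform_limit_theorem)
  show "\<forall>\<^sub>F n in sequentially. continuous_on UNIV (\<lambda>x::'a. \<Sum>k<n. gauss_term b k x)"
    unfolding gauss_term_def by (intro always_eventually allI continuous_intros)
  show "uniform_limit UNIV (\<lambda>n x. \<Sum>k<n. gauss_term b k x) (gauss_series b) sequentially"
    unfolding gauss_series_def
    by (rule Weierstrass_m_test[OF term_norm_le ratio_summable])
qed simp

lemma series_le_gaussian: "gauss_series b x \<le> gauss_series b (0::'a::euclidean_space) * exp (- pi * (norm (x::'a))\<^sup>2)"
proof -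
  have "gauss_series b x \<le> (\<Sum>k. gauss_term b k (0::'a) * exp (- pi * (norm x)\<^sup>2))"
    unfolding gauss_series_def
  proof (intro suminf_le term_summable summable_mult2)
    fix k
    have "(norm x)\<^sup>2 \<le> 4 ^ k * (norm x)\<^sup>2" by (simp add: mult_le_cancel_right1)
    then have "exp (- pi * 4 ^ k * (norm x)\<^sup>2) \<le> exp (- pi * (norm x)\<^sup>2)" by simp
    then show "gauss_term b k x \<le> gauss_term b k (0::'a) * exp (- pi * (norm x)\<^sup>2)"
      by (simp add: gauss_term_def mult_left_mono)
  qed
  also have "\<dots> = gauss_series b (0::'a) * exp (- pi * (norm x)\<^sup>2)"
    unfolding gauss_series_def by (rule suminf_mult2[symmetric, OF term_summable])
  finally show ?thesis .
qed

lemma series_integrable: "integrable lborel (gauss_series b :: 'a::euclidean_space \<Rightarrow> real)"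
proof (rule Bochner_Integration.integrable_bound)
  show "integrable lborel (\<lambda>x::'a. gauss_series b (0::'a) * exp (- pi * 1 * (norm x)\<^sup>2))"
    using gaussian_integral[of 1, where 'a='a] by (intro integrable_mult_right) (simp add: has_bochner_integral_iff)
  show "gauss_series b \<in> borel_measurable (lborel :: 'a measure)"
    using borel_measurable_continuous_onI[OF series_continuous] by simp
  show "AE x::'a in lborel. norm (gauss_series b x) \<le> norm (gauss_series b (0::'a) * exp (- pi * 1 * (norm x)\<^sup>2))"
  proof (rule AE_I2)
    fix x :: 'a
    show "norm (gauss_series b x) \<le> norm (gauss_series b (0::'a) * exp (- pi * 1 * (norm x)\<^sup>2))"
      using series_le_gaussian[of x] series_pos[of x] unfolding real_norm_def by simp
  qed
qed

text \<open>From \<open>1 + u \<le> n (1 + u / n) \<le> n exp (u / n)\<close> with \<open>u = |x|\<^sup>2\<close>, raised to the power \<open>n\<close>.\<close>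

lemma series_decay:
  assumes n: "n \<ge> 1"
  shows "gauss_series b x \<le> gauss_series b (0::'a::euclidean_space) * real n ^ n * jbracket (x::'a) powr (- (2 * real n))"
proof -
  let ?u = "(norm x)\<^sup>2"
  have "exp (- pi * ?u) * (1 + ?u) ^ n \<le> real n ^ n"
  proof -
    have "1 + ?u \<le> real n * (1 + ?u / real n)" using n by (simp add: distrib_left)
    also have "\<dots> \<le> real n * exp (?u / real n)" by (intro mult_left_mono exp_ge_add_one_self) simp
    finally have "(1 + ?u) ^ n \<le> (real n * exp (?u / real n)) ^ n" by (intro power_mono) auto
    also have "\<dots> = real n ^ n * exp ?u" using n by (simp add: power_mult_distrib exp_of_nat_mult[symmetric])
    finally have "(1 + ?u) ^ n \<le> real n ^ n * exp ?u" .
    then have "exp (- pi * ?u) * (1 + ?u) ^ n \<le> exp (- pi * ?u) * (real n ^ n * exp ?u)" by (intro mult_left_mono) auto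
    also have "\<dots> = real n ^ n * exp ((1 - pi) * ?u)" by (simp add: mult_exp_exp algebra_simps)
    also have "\<dots> \<le> real n ^ n * 1"
    proof (intro mult_left_mono)
      have "(1 - pi) * ?u \<le> 0" using pi_gt3 by (intro mult_nonpos_nonneg) auto
      then show "exp ((1 - pi) * ?u) \<le> 1" by simp
    qed simp
    finally show ?thesis by simp
  qed
  moreover have "jbracket x powr (- (2 * real n)) = 1 / (1 + ?u) ^ n"
  proof -
    have "jbracket x powr (2 * real n) = (jbracket x powr real 2) powr real n" by (simp only: powr_powr) simp
    also have "jbracket x powr real 2 = 1 + ?u" using jbracket_pos(1)[of x] by (subst powr_realpow) (auto simp: jbracket_def)
    also have "(1 + ?u) powr real n = (1 + ?u) ^ n" by (rule powr_realpow) (simp add: add_pos_nonneg)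
    finally show ?thesis by (simp add: powr_minus_divide)
  qed
  moreover have "0 < (1 + ?u) ^ n" by (simp add: add_pos_nonneg)
  ultimately have "exp (- pi * ?u) \<le> real n ^ n * jbracket x powr (- (2 * real n))"
    by (simp add: pos_le_divide_eq)
  then have "gauss_series b (0::'a) * exp (- pi * ?u) \<le> gauss_series b (0::'a) * (real n ^ n * jbracket x powr (- (2 * real n)))"
    using series_pos[of "0::'a"] by (intro mult_left_mono) auto
  then show ?thesis using series_le_gaussian[of x] by (simp add: mult.assoc)
qed

text \<open>The Fourier transform of \<open>gauss_term b k\<close> at \<open>\<xi>\<close>.\<close>

definition coeff :: "'a::euclidean_space \<Rightarrow> nat \<Rightarrow> real" where
  "coeff \<xi> k = (2 powr (- b)) ^ k * (exp (- pi * (norm \<xi>)\<^sup>2 / 4 ^ k) / sqrt (4 ^ k) ^ DIM('a))"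

lemma coeff_nonneg: "0 \<le> coeff \<xi> k" by (simp add: coeff_def)

lemma coeff_le: "coeff \<xi> k \<le> (2 powr (- b)) ^ k"
proof -
  have "exp (- pi * (norm \<xi>)\<^sup>2 / 4 ^ k) / sqrt (4 ^ k) ^ DIM('a) \<le> 1 / 1"
    by (intro frac_le one_le_power) auto
  then have "(2 powr (- b)) ^ k * (exp (- pi * (norm \<xi>)\<^sup>2 / 4 ^ k) / sqrt (4 ^ k) ^ DIM('a)) \<le> (2 powr (- b)) ^ k * 1"
    by (intro mult_left_mono) auto
  then show ?thesis by (simp add: coeff_def)
qed

lemma coeff_summable: "summable (coeff \<xi>)"
  by (rule summable_comparison_test'[OF ratio_summable]) (simp add: coeff_le coeff_nonneg)

lemma term_fourier:
  fixes \<xi> :: "'a::euclidean_space"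
  shows "has_bochner_integral lborel (\<lambda>x. gauss_term b k x *\<^sub>R cis (- 2 * pi * (\<xi> \<bullet> x))) (of_real (coeff \<xi> k))"
proof -
  have "has_bochner_integral lborel (\<lambda>x. (2 powr (- b)) ^ k *\<^sub>R (exp (- pi * 4 ^ k * (norm x)\<^sup>2) *\<^sub>R cis (2 * pi * ((- \<xi>) \<bullet> x))))
      ((2 powr (- b)) ^ k *\<^sub>R of_real (exp (- pi * (norm (- \<xi>))\<^sup>2 / 4 ^ k) / sqrt (4 ^ k) ^ DIM('a)))"
    by (intro has_bochner_integral_scaleR_right gaussian_fourier) simp
  then show ?thesis by (simp add: gauss_term_def coeff_def scaleR_conv_of_real mult.assoc)
qed

lemma series_fourier:
  fixes \<xi> :: "'a::euclidean_space"
  shows "fourier (gauss_series b) \<xi> = of_real (\<Sum>k. coeff \<xi> k)"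
proof -
  let ?f = "\<lambda>k x. gauss_term b k x *\<^sub>R cis (- 2 * pi * (\<xi> \<bullet> x))"
  have nf: "norm (?f k x) = gauss_term b k x" for k x using term_pos[of k x] by simp
  have "fourier (gauss_series b) \<xi> = (LINT x|lborel. (\<Sum>k. ?f k x))"
    unfolding fourier_def gauss_series_def
    by (intro Bochner_Integration.integral_cong refl bounded_linear.suminf[OF bounded_linear_scaleR_left term_summable])
  also have "\<dots> = (\<Sum>k. LINT x|lborel. ?f k x)"
  proof (rule integral_suminf)
    show "integrable lborel (?f k)" for k using term_fourier[of k \<xi>] by (simp add: has_bochner_integral_iff)
    show "AE x in lborel. summable (\<lambda>k. norm (?f k x))" unfolding nf by (intro AE_I2 term_summable)
    have "(LINT x|lborel. norm (?f k x)) = coeff (0::'a) k" for k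
    proof -
      have "has_bochner_integral lborel (\<lambda>x. complex_of_real (gauss_term b k (x::'a))) (of_real (coeff (0::'a) k))"
        using term_fourier[of k "0::'a"] by (simp add: scaleR_conv_of_real)
      from has_bochner_integral_Re[OF this] show ?thesis unfolding nf by (simp add: has_bochner_integral_iff)
    qed
    then show "summable (\<lambda>k. LINT x|lborel. norm (?f k x))" by (simp only: coeff_summable)
  qed
  also have "\<dots> = (\<Sum>k. of_real (coeff \<xi> k))"
    using term_fourier[of _ \<xi>] by (simp add: has_bochner_integral_iff)
  also have "\<dots> = of_real (\<Sum>k. coeff \<xi> k)" by (rule suminf_of_real[symmetric, OF coeff_summable])
  finally show ?thesis .
qed

lemma series_fourier_ge: "coeff \<xi> k \<le> Re (fourier (gauss_series b) \<xi>)"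
proof -
  have "sum (coeff \<xi>) {k} \<le> suminf (coeff \<xi>)"
    by (intro sum_le_suminf coeff_summable) (auto simp: coeff_nonneg)
  then show ?thesis by (simp add: series_fourier)
qed

lemma four_power: "(4::real) ^ k = (2 ^ k)\<^sup>2"
proof -
  have "(4::real) ^ k = (2 * 2) ^ k" by simp
  then show ?thesis by (simp only: power_mult_distrib power2_eq_square)
qed

text \<open>All terms are nonnegative, so a single one suffices: the one with \<open>2\<^bsup>k\<^esup>\<close> between \<open>jbracket \<xi>\<close> and
\<open>2 * jbracket \<xi>\<close>.\<close>

lemma series_fourier_lower:
  fixes \<xi> :: "'a::euclidean_space"
  shows "2 powr (- (DIM('a) + b)) * exp (- pi) * jbracket \<xi> powr (- (DIM('a) + b)) \<le> Re (fourier (gauss_series b) \<xi>)"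
proof -
  define j where "j = jbracket \<xi>"
  have j: "j \<ge> 1" using jbracket_pos(2) by (simp add: j_def)
  \<comment> \<open>rounding up costs the factor 2 in \<open>p2\<close>; the logarithm is nonnegative, so \<open>nat\<close> does not truncate\<close>
  define k where "k = nat \<lceil>log 2 j\<rceil>"
  have l0: "0 \<le> log 2 j" using j by simp
  have k1: "log 2 j \<le> real k" using l0 unfolding k_def by linarith
  have k2: "real k \<le> log 2 j + 1" using l0 unfolding k_def by linarith
  have p1: "j \<le> 2 ^ k"
  proof -
    have "j = 2 powr log 2 j" using j by simp
    also have "\<dots> \<le> 2 powr real k" using k1 by simp
    finally show ?thesis by (simp add: powr_realpow)
  qed
  have p2: "2 ^ k \<le> 2 * j"
  proof -
    have "2 powr real k \<le> 2 powr (log 2 j + 1)" using k2 by simp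
    also have "\<dots> = 2 * j" using j by (simp add: powr_add)
    finally show ?thesis by (simp add: powr_realpow)
  qed
  have s4: "sqrt (4 ^ k) = 2 ^ k"
  proof -
    have "(4::real) ^ k = (2 ^ k)\<^sup>2" by (rule four_power)
    then show ?thesis by simp
  qed
  have e: "(2 powr (- b)) ^ k / sqrt (4 ^ k) ^ DIM('a) = (2 ^ k) powr (- (DIM('a) + b))"
  proof -
    have "(2 powr (- b)) ^ k = (2 powr (- b)) powr real k" by (simp add: powr_realpow)
    also have "\<dots> = (2 powr real k) powr (- b)" by (simp add: powr_powr mult.commute)
    also have "\<dots> = (2 ^ k) powr (- b)" by (simp add: powr_realpow)
    finally have 1: "(2 powr (- b)) ^ k = (2 ^ k) powr (- b)" .
    have "sqrt (4 ^ k) ^ DIM('a) = (2 ^ k) powr DIM('a)" unfolding s4 by (rule powr_realpow[symmetric]) simp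
    then have "(2 powr (- b)) ^ k / sqrt (4 ^ k) ^ DIM('a) = (2 ^ k) powr (- b) / (2 ^ k) powr DIM('a)" using 1 by simp
    also have "\<dots> = (2 ^ k) powr (- b - DIM('a))" by (rule powr_diff[symmetric])
    finally show ?thesis by (simp add: algebra_simps)
  qed
  have "(norm \<xi>)\<^sup>2 \<le> j\<^sup>2" by (simp add: j_def jbracket_def)
  also have "\<dots> \<le> (2 ^ k)\<^sup>2" using p1 j by (intro power_mono) auto
  also have "\<dots> = 4 ^ k" by (rule four_power[symmetric])
  finally have "(norm \<xi>)\<^sup>2 / 4 ^ k \<le> 1" by (simp add: pos_divide_le_eq)
  then have "pi * ((norm \<xi>)\<^sup>2 / 4 ^ k) \<le> pi * 1" by (intro mult_left_mono) auto
  then have ex: "exp (- pi) \<le> exp (- pi * (norm \<xi>)\<^sup>2 / 4 ^ k)" by simp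
  have "2 powr (- (DIM('a) + b)) * exp (- pi) * j powr (- (DIM('a) + b)) = (2 * j) powr (- (DIM('a) + b)) * exp (- pi)"
    using j by (simp add: powr_mult)
  also have "\<dots> \<le> (2 ^ k) powr (- (DIM('a) + b)) * exp (- pi * (norm \<xi>)\<^sup>2 / 4 ^ k)"
    using p2 b ex by (intro mult_mono powr_mono2') auto
  also have "\<dots> = coeff \<xi> k" unfolding coeff_def e[symmetric] by simp
  also have "\<dots> \<le> Re (fourier (gauss_series b) \<xi>)" by (rule series_fourier_ge)
  finally show ?thesis by (simp add: j_def)
qed

text \<open>The left-hand side is at most the minimum of 1 and \<open>v\<close>.\<close>

lemma one_minus_exp_le:
  fixes v \<theta> :: real
  assumes "0 \<le> v" "0 < \<theta>" "\<theta> \<le> 1"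
  shows "1 - exp (- v) \<le> v powr \<theta>"
proof (cases "v \<le> 1")
  case True
  have "1 - exp (- v) \<le> v" using exp_ge_add_one_self[of "- v"] by simp
  also have "v \<le> v powr \<theta>"
  proof (cases "v = 0")
    case False
    then have "v powr 1 \<le> v powr \<theta>" using assms True by (intro powr_mono') auto
    then show ?thesis using assms False by simp
  qed simp
  finally show ?thesis .
next
  case False
  have "1 - exp (- v) \<le> 1" by simp
  also have "1 \<le> v powr \<theta>" using False assms by (intro ge_one_powr_ge_zero) auto
  finally show ?thesis .
qed

text \<open>The \<open>k\<close>-th term varies by at most \<open>(4\<^bsup>k\<^esup> |x|\<^sup>2) powr \<theta>\<close>, up to a constant. The factor
\<open>4 powr (\<theta> * k)\<close> is compensated by the coefficient \<open>2 powr (- b * k)\<close> as long as \<open>2 * \<theta> < b\<close>.\<close>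

lemma series_Hoelder:
  "\<exists>M \<alpha>. 0 < \<alpha> \<and> (\<forall>x::'a::euclidean_space. gauss_series b (0::'a) - gauss_series b x \<le> M * norm x powr \<alpha>)"
proof -
  \<comment> \<open>small enough for the geometric series with ratio \<open>q\<close> to converge\<close>
  define \<theta> where "\<theta> = min 1 (b / 4)"
  have \<theta>: "0 < \<theta>" "\<theta> \<le> 1" "2 * \<theta> < b" using b by (auto simp: \<theta>_def min_def)
  define q where "q = 2 powr (- b) * 4 powr \<theta>"
  have q: "0 \<le> q" "q < 1"
  proof -
    have "(4::real) powr \<theta> = (2 powr 2) powr \<theta>" by simp
    also have "\<dots> = 2 powr (2 * \<theta>)" by (simp only: powr_powr)
    finally have "q = 2 powr (2 * \<theta> - b)" by (simp add: q_def powr_diff powr_minus_divide)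
    moreover have "2 powr (2 * \<theta> - b) < (2::real) powr 0" using \<theta> by (intro powr_less_mono) auto
    ultimately show "q < 1" by simp
  qed (simp add: q_def)
  have qs: "summable (\<lambda>k. q ^ k)" using q by (intro summable_geometric) simp
  define M where "M = (\<Sum>k. pi powr \<theta> * q ^ k)"
  have "gauss_series b (0::'a) - gauss_series b x \<le> M * norm x powr (2 * \<theta>)" for x :: 'a
  proof -
    have "gauss_series b (0::'a) - gauss_series b x = (\<Sum>k. gauss_term b k (0::'a) - gauss_term b k x)"
      unfolding gauss_series_def by (rule suminf_diff[OF term_summable term_summable])
    also have "\<dots> \<le> (\<Sum>k. pi powr \<theta> * q ^ k * norm x powr (2 * \<theta>))"
    proof (intro suminf_le summable_diff term_summable summable_mult2 summable_mult qs)
      fix k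
      have "(pi * 4 ^ k * (norm x)\<^sup>2) powr \<theta> = pi powr \<theta> * (4 powr \<theta>) ^ k * norm x powr (2 * \<theta>)"
      proof -
        have "(4 ^ k) powr \<theta> = (4 powr \<theta>) ^ k"
        proof -
          have "((4::real) ^ k) powr \<theta> = (4 powr real k) powr \<theta>" by (simp add: powr_realpow)
          also have "\<dots> = (4 powr \<theta>) powr real k" by (simp add: powr_powr mult.commute)
          also have "\<dots> = (4 powr \<theta>) ^ k" by (simp add: powr_realpow)
          finally show ?thesis .
        qed
        moreover have "((norm x)\<^sup>2) powr \<theta> = norm x powr (2 * \<theta>)"
        proof (cases "x = 0")
          case False
          then have "(norm x)\<^sup>2 = norm x powr 2" by (simp add: powr_numeral)
          then show ?thesis by (simp only: powr_powr)
        qed simp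
        ultimately show ?thesis by (simp add: powr_mult)
      qed
      moreover have "1 - exp (- (pi * 4 ^ k * (norm x)\<^sup>2)) \<le> (pi * 4 ^ k * (norm x)\<^sup>2) powr \<theta>"
        using \<theta> by (intro one_minus_exp_le) auto
      ultimately have "(2 powr (- b)) ^ k * (1 - exp (- (pi * 4 ^ k * (norm x)\<^sup>2)))
          \<le> (2 powr (- b)) ^ k * (pi powr \<theta> * (4 powr \<theta>) ^ k * norm x powr (2 * \<theta>))"
        by (intro mult_left_mono) auto
      then show "gauss_term b k (0::'a) - gauss_term b k x \<le> pi powr \<theta> * q ^ k * norm x powr (2 * \<theta>)"
        by (simp add: gauss_term_def q_def power_mult_distrib right_diff_distrib mult_ac)
    qed
    also have "\<dots> = M * norm x powr (2 * \<theta>)"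
      unfolding M_def by (rule suminf_mult2[symmetric]) (intro summable_mult qs)
    finally show ?thesis .
  qed
  then show ?thesis using \<theta> by (intro exI[of _ M] exI[of _ "2 * \<theta>"]) auto
qed

text \<open>The decay exponent \<open>2 d\<close> is an arbitrary choice above \<open>s\<close>.\<close>

lemma series_kernel:
  fixes s :: real
  assumes s: "0 \<le> s" "s < DIM('a)"
  shows "\<exists>\<gamma> C\<^sub>\<gamma>. radial_kernel (gauss_series b :: 'a::euclidean_space \<Rightarrow> real) s \<gamma> C\<^sub>\<gamma>"
proof -
  let ?n = "DIM('a)"
  have n: "?n \<ge> 1" by simp
  have "radial_kernel (gauss_series b :: 'a \<Rightarrow> real) s (2 * real ?n) (gauss_series b (0::'a) * real ?n ^ ?n)"
  proof
    show "0 \<le> gauss_series b x" for x :: 'a by (rule series_pos[THEN less_imp_le])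
    show "0 \<le> Re (fourier (gauss_series b) \<xi>)" for \<xi> :: 'a
      using series_fourier_ge[of \<xi> 0] coeff_nonneg[of \<xi> 0] by linarith
    show "s < 2 * real ?n" using s by linarith
  qed (use s n series_continuous series_integrable series_decr series_pos series_decay[OF n] in blast)+
  then show ?thesis by blast
qed

end

section \<open>Coercivity\<close>

theorem Riesz_coercivity:
  fixes s r :: real
  assumes s: "0 \<le> s" "s < DIM('a::euclidean_space)" and p: "ennreal (DIM('a) / (DIM('a) - s)) < p"
    and r: "r > DIM('a)"
  shows "\<exists>C>0. coercivity_estimate s r p C 1 0 (g_Riesz s :: 'a \<Rightarrow> real)"
proof -
  define b where "b = r - DIM('a)"
  interpret gauss_exponent b by unfold_locales (use r in \<open>simp add: b_def\<close>)
  let ?\<phi> = "gauss_series b :: 'a \<Rightarrow> real"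
  obtain \<gamma> C\<^sub>\<gamma> where k: "radial_kernel ?\<phi> s \<gamma> C\<^sub>\<gamma>" using series_kernel[OF s] by blast
  interpret radial_kernel ?\<phi> s \<gamma> C\<^sub>\<gamma> by (rule k)
  have rb: "DIM('a) + b = r" by (simp add: b_def)
  have C0: "0 < 2 powr (- r) * exp (- pi)" by simp
  have r0: "0 \<le> r" using r by (meson less_imp_le of_nat_0_le_iff order_trans)
  note low = series_fourier_lower[where 'a='a, unfolded rb]
  show ?thesis
  proof (cases "s = 0")
    case False
    then have s0: "s > 0" using s by simp
    obtain c where c: "c > 0" and lim: "\<forall>x::'a. x \<noteq> 0 \<longrightarrow> (\<lambda>n. c * (LINT t:{0<..<real n}|lborel. t powr (DIM('a) - s) * dilate t ?\<phi> x / t)) \<longlonglongrightarrow> g_Riesz s x"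
      using Riesz_limit[OF s0 series_pos] by blast
    from power_coercivity[OF k s0 p c C0 r0 low] show ?thesis
    proof (elim exE conjE)
      fix C :: real
      assume C: "C > 0" and est: "\<forall>\<zeta> K R g. \<zeta> \<in> borel_measurable borel \<longrightarrow> K > 0 \<longrightarrow>
        (\<forall>t>0. t powr (DIM('a) - s) / K \<le> \<zeta> t \<and> \<zeta> t \<le> K * t powr (DIM('a) - s)) \<longrightarrow>
        (\<forall>x. x \<noteq> 0 \<longrightarrow> (\<lambda>n. c * (LINT t:{0<..<real n}|lborel. \<zeta> t * dilate t ?\<phi> x / t)) \<longlonglongrightarrow> g x) \<longrightarrow>
        coercivity_estimate s r p C K R g"
      have "coercivity_estimate s r p C 1 0 (g_Riesz s :: 'a \<Rightarrow> real)"
        by (rule est[rule_format, of "\<lambda>t. t powr (DIM('a) - s)"]) (use lim in auto)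
      then show ?thesis using C by blast
    qed
  next
    case s0: True
    obtain M \<alpha> where "0 < \<alpha>" "\<And>x::'a. ?\<phi> 0 - ?\<phi> x \<le> M * norm x powr \<alpha>"
      using series_Hoelder by blast
    from log_limit[OF s0 this] obtain k0 where
      lim: "\<forall>x::'a. x \<noteq> 0 \<longrightarrow> (\<lambda>n. 1 / ?\<phi> 0 * ((LINT t:{0<..<real n}|lborel. (t ^ DIM('a) + 0) * dilate t ?\<phi> x / t)
        - (?\<phi> 0 * ln (real n) - k0))) \<longlonglongrightarrow> g_Riesz 0 x" by blast
    from log_coercivity[OF k[unfolded s0] p[unfolded s0] C0 r0 low, of k0] show ?thesis
    proof (elim exE conjE)
      fix C :: real
      assume C: "C > 0" and est: "\<forall>\<rho> g. \<rho> \<in> borel_measurable borel \<longrightarrow> (\<forall>t>0. 0 \<le> \<rho> t) \<longrightarrow>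
        set_integrable lborel {0<..} (\<lambda>t. \<rho> t / t ^ DIM('a) / t) \<longrightarrow>
        (\<forall>x. x \<noteq> 0 \<longrightarrow> (\<lambda>n. 1 / ?\<phi> 0 * ((LINT t:{0<..<real n}|lborel. (t ^ DIM('a) + \<rho> t) * dilate t ?\<phi> x / t)
            - (?\<phi> 0 * ln (real n) - k0))) \<longlonglongrightarrow> g x) \<longrightarrow>
        coercivity_estimate 0 r p C 1 (LINT t:{0<..}|lborel. \<rho> t / t ^ DIM('a) / t) g"
      have "coercivity_estimate 0 r p C 1 (LINT t:{0<..}|lborel. 0 / t ^ DIM('a) / t) (g_Riesz 0 :: 'a \<Rightarrow> real)"
        by (rule est[rule_format, of "\<lambda>_. 0"]) (use lim in \<open>auto simp: set_integrable_def\<close>)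
      then have "coercivity_estimate s r p C 1 0 (g_Riesz s :: 'a \<Rightarrow> real)"
        by (simp add: s0 set_lebesgue_integral_def)
      then show ?thesis using C by blast
    qed
  qed
qed

theorem proposition2p15:
  shows "\<exists>C\<^sub>\<rho> :: (real \<Rightarrow> real) \<Rightarrow> real.
    (\<forall>\<rho>. 0 \<le> C\<^sub>\<rho> \<rho>) \<and> (\<forall>\<rho>. (\<forall>t>0. \<rho> t = 0) \<longrightarrow> C\<^sub>\<rho> \<rho> = 0) \<and>
    (\<forall>(s::real) (p::ennreal).
       0 \<le> s \<longrightarrow> s < real DIM('a::euclidean_space) \<longrightarrow>
       ennreal (real DIM('a) / (real DIM('a) - s)) < p \<longrightarrow>
       (\<forall>(r::real) (\<phi> :: 'a \<Rightarrow> real).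
          r > real DIM('a) \<longrightarrow>
          (\<exists>C\<^sub>\<phi>>0. \<forall>\<xi>. Re (fourier \<phi> \<xi>) \<ge> C\<^sub>\<phi> * jbracket \<xi> powr (- r)) \<longrightarrow>
          (\<exists>C>0. \<forall>\<zeta> C\<^sub>\<zeta> \<rho> g. admissible_potential s \<phi> \<zeta> C\<^sub>\<zeta> \<rho> g \<longrightarrow>
             coercivity_estimate s r p C (if s = 0 then 1 else C\<^sub>\<zeta>) (C\<^sub>\<rho> \<rho>) g)) \<and>
       (\<forall>(a::real) (G :: 'a \<Rightarrow> real).
          a > real DIM('a) \<longrightarrow> is_bessel_potential a G \<longrightarrow>
          (\<exists>C>0. \<forall>\<zeta> C\<^sub>\<zeta> \<rho> g. admissible_potential s G \<zeta> C\<^sub>\<zeta> \<rho> g \<longrightarrow>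
             coercivity_estimate s a p C (if s = 0 then 1 else C\<^sub>\<zeta>) (C\<^sub>\<rho> \<rho>) g)) \<and>
       (\<forall>r::real. r > real DIM('a) \<longrightarrow>
          (\<exists>C>0. coercivity_estimate s r p C 1 0 (g_Riesz s :: 'a \<Rightarrow> real))))"
proof (intro exI[of _ "log_remainder DIM('a)"] conjI allI impI)
  show "0 \<le> log_remainder DIM('a) \<rho>" for \<rho> by (rule log_remainder_nonneg)
  show "log_remainder DIM('a) \<rho> = 0" if "\<forall>t>0. \<rho> t = 0" for \<rho> by (rule log_remainder_0[OF that])
next
  fix s :: real and p :: ennreal
  assume s: "0 \<le> s" "s < real DIM('a)" and p: "ennreal (real DIM('a) / (real DIM('a) - s)) < p"
  have nonneg: "0 \<le> r" if "r > real DIM('a)" for r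
    using that by (meson less_imp_le of_nat_0_le_iff order_trans)
  {
    fix r :: real and \<phi> :: "'a \<Rightarrow> real"
    assume r: "r > real DIM('a)" and "\<exists>C\<^sub>\<phi>>0. \<forall>\<xi>. Re (fourier \<phi> \<xi>) \<ge> C\<^sub>\<phi> * jbracket \<xi> powr (- r)"
    then obtain C\<^sub>\<phi> where "C\<^sub>\<phi> > 0" "\<And>\<xi>. C\<^sub>\<phi> * jbracket \<xi> powr (- r) \<le> Re (fourier \<phi> \<xi>)" by blast
    from admissible_coercivity[OF s p this(1) nonneg[OF r] this(2)]
    show "\<exists>C>0. \<forall>\<zeta> C\<^sub>\<zeta> \<rho> g. admissible_potential s \<phi> \<zeta> C\<^sub>\<zeta> \<rho> g \<longrightarrow>
             coercivity_estimate s r p C (if s = 0 then 1 else C\<^sub>\<zeta>) (log_remainder DIM('a) \<rho>) g" .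
  next
    fix a :: real and G :: "'a \<Rightarrow> real"
    assume a: "a > real DIM('a)" and G: "is_bessel_potential a G"
    show "\<exists>C>0. \<forall>\<zeta> C\<^sub>\<zeta> \<rho> g. admissible_potential s G \<zeta> C\<^sub>\<zeta> \<rho> g \<longrightarrow>
             coercivity_estimate s a p C (if s = 0 then 1 else C\<^sub>\<zeta>) (log_remainder DIM('a) \<rho>) g"
      by (rule admissible_coercivity[OF s p _ nonneg[OF a] bessel_lower_bound[OF G nonneg[OF a]]]) simp
  next
    fix r :: real
    assume "r > real DIM('a)"
    then show "\<exists>C>0. coercivity_estimate s r p C 1 0 (g_Riesz s :: 'a \<Rightarrow> real)"
      by (rule Riesz_coercivity[OF s p])
  }
qed

end
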